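(* Let $\mathbb F$ be a field. Fix an integer $k\ge1$, $\boldsymbol\zeta=(\zeta_1,\dots,\zeta_k)\in(0,\infty)^k$, $\mathbf c\in\mathbb F^k$, and a nontrivial additive subgroup $\mathbb E\subset(\mathbb R,+)$ such that $\zeta_j^{\pm1}\mathbb E\subset\mathbb E$ for $1\le j\le k$. (1) The algebra $\mathcal A_{\boldsymbol\zeta}(\mathbb E,\mathbf c)$ is a strict RTA with $\mathcal Q_0^+=(\mathbb Z^+)^k\ltimes_{\boldsymbol\zeta}(\mathbb E\cap[0,\infty))$. (2) The algebra $\mathcal A_{\boldsymbol\zeta}(\mathbb E,\mathbf c)$ is based if and only if it is discretely graded, if and only if $\mathbb E=\eta\mathbb Z$ for some $\eta\in\mathbb R^\times$ and $\zeta_j=1$ for all $j$.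
   Context: $\mathbb Z^+=\{0,1,2,\dots\}$; algebras are associative and unital, $\otimes=\otimes_{\mathbb F}$. **The algebra $\mathcal A_{\boldsymbol\zeta}(\mathbb E,\mathbf c)$.** For $\mathbf n\in\mathbb Z^k$ put $\boldsymbol\zeta^{\mathbf n}=\prod_j\zeta_j^{n_j}$. Let $G=\mathbb Z^k\ltimes_{\boldsymbol\zeta}\mathbb E$ be the semidirect product group in which $\mathbf n\in\mathbb Z^k$ acts on $\mathbb E$ by $e\mapsto\boldsymbol\zeta^{\mathbf n}e$, i.e. $(\mathbf n,0)(0,e)(\mathbf n,0)^{-1}=(0,\boldsymbol\zeta^{\mathbf n}e)$; $(\mathbb Z^+)^k\ltimes_{\boldsymbol\zeta}(\mathbb E\cap[0,\infty))$ is its submonoid of elements with nonnegative components. Let $\varepsilon_1,\dots,\varepsilon_k$ be the standard basis of $\mathbb Z^k$, and $H_0$ the $\mathbb F$-algebra of all functions $f:G\to\mathbb F$ with pointwise operations. $\mathcal A_{\boldsymbol\zeta}(\mathbb E,\mathbf c)$ is the $\mathbb F$-algebra generated by the algebra $H_0$ and elements $t^e$ ($e\in\mathbb E$), $x_j^\pm$ ($1\le j\le k$), with relations - $t^0=1$; $t^{e}t^{e'}=t^{e+e'}$ and $t^{-e}t^{-e'}=t^{-e-e'}$, $t^{e}t^{-e'}=t^{-e'}t^{e}$ for all $e,e'\in\mathbb E\cap[0,\infty)$; - $t^{e}f(-)=f((0,-e)\cdot-)\,t^{e}$ for $e\in\mathbb E$, and $x_j^\pm f(-)=f((\mp\varepsilon_j,0)\cdot-)\,x_j^\pm$,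 for $f\in H_0$; - $[x_j^\pm,x_{j'}^+]=[x_j^\pm,x_{j'}^-]=0$ for $j\ne j'$; $[x_j^+,x_j^-]=c_j$; $x_j^\pm t^e=t^{\zeta_j^{\pm1}e}x_j^\pm$ for $e\in\mathbb E$. (In particular $t^{-e}$ is not assumed to be the inverse of $t^e$.) Its RTA data are: $H_1=H_0$; $B^\pm$ the subalgebra generated by the $x_j^\pm$ and the $t^{\pm e}$, $e\in\mathbb E\cap[0,\infty)$; $i$ the anti-involution fixing $H_0$ and exchanging $t^e\leftrightarrow t^{-e}$, $x_j^+\leftrightarrow x_j^-$; and elements $g\in G$ are identified with the automorphisms $f(-)\mapsto f(g^{-1}\cdot-)$ of $H_0$. **Strict RTAs.** If $H_0$ is a subalgebra of an $\mathbb F$-algebra $A$ and $\theta\in\mathrm{Aut}_{\mathbb F\text{-alg}}(H_0)$, put $A_\theta=\{a\in A:ah=\theta(h)a\ \forall h\in H_0\}$, and $B_\theta=B\cap A_\theta$ for $B\subset A$. A strict RTA is an $\mathbb F$-algebra $A$ with data $(B^\pm,H_1=H_0,\mathcal Q_0^+,i)$ such that: (RTA1) $B^\pm,H_0$ are unital subalgebras and multiplication $B^-\otimes H_0\otimes B^+\to A$ is a vector space isomorphism; (RTA2) $\mathcal Q_0^+\subset\mathrm{Aut}_{\mathbb F\text{-alg}}(H_0)$ is a submonoid such that $\mathcal Q_0^+\setminus\{\mathrm{id}\}$ is a semigroup, $B^+=\bigoplus_{\theta\in\mathcal Q_0^+}B^+_\theta$, $B^+_{\mathrm{id}}=\mathbb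 F\cdot1$ and $\dim B^+_\theta<\infty$ for all $\theta$; (RTA3) $i$ is an anti-involution of $A$ fixing $H_0$ pointwise and sending $B^\pm$ into the image of $H_0\otimes B^\mp$. It is *based* if there is a pairwise commuting $\mathbb Z$-linearly independent set $\Delta\subset\mathcal Q_0^+$ with $\mathcal Q_0^+=\mathbb Z^+\Delta$ (the monoid generated by $\Delta$). It is *discretely graded* if for every $\theta_0\in\mathcal Q_0^+$ the interval $[\mathrm{id},\theta_0]$ is finite, for the order $\theta\ge\theta'$ iff $\theta=\theta''\theta'$ with $\theta''\in\mathcal Q_0^+$. *)

theory Defs
  imports
    "HOL-Analysis.Finite_Cartesian_Product"
    "HOL-Library.Poly_Mapping"
    "HOL-Algebra.Algebra"
    "HOL-Algebra.Algebraic_Closure_Type"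
begin

section \<open>Associative unital algebras over a field\<close>

text \<open>
  The field is a type \<open>'f\<close> of class \<^class>\<open>field\<close>. An algebra is a record with carrier, of the
  HOL-Algebra type \<open>('f, 'a) module\<close>, which extends \<open>'a ring\<close> by a scalar multiplication.
\<close>

abbreviation base_field :: "'f::field ring" where
  "base_field \<equiv> ring_of_type_algebra"

definition F_algebra :: "('f::field, 'a) module \<Rightarrow> bool" where
  "F_algebra A \<longleftrightarrow> ring A \<and> module base_field A \<and>
     (\<forall>c. \<forall>x\<in>carrier A. \<forall>y\<in>carrier A.
        (c \<odot>\<^bsub>A\<^esub> x) \<otimes>\<^bsub>A\<^esub> y = c \<odot>\<^bsub>A\<^esub> (x \<otimes>\<^bsub>A\<^esub> y) \<and>
        x \<otimes>\<^bsub>A\<^esub> (c \<odot>\<^bsub>A\<^esub> y) = c \<odot>\<^bsub>A\<^esub> (x \<otimes>\<^bsub>A\<^esub> y))"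

text \<open>\<^const>\<open>ring_hom\<close> includes preservation of the unit.\<close>

definition alg_hom :: "('f::field, 'a) module \<Rightarrow> ('f, 'b) module \<Rightarrow> ('a \<Rightarrow> 'b) set" where
  "alg_hom A B = {\<phi> \<in> ring_hom A B. \<forall>c. \<forall>x\<in>carrier A. \<phi> (c \<odot>\<^bsub>A\<^esub> x) = c \<odot>\<^bsub>B\<^esub> \<phi> x}"

definition alg_aut :: "('f::field, 'a) module \<Rightarrow> ('a \<Rightarrow> 'a) monoid" where
  "alg_aut A = BijGroup (carrier A) \<lparr>carrier := Bij (carrier A) \<inter> alg_hom A A\<rparr>"

definition unital_subalg :: "'a set \<Rightarrow> ('f::field, 'a) module \<Rightarrow> bool" where
  "unital_subalg B A \<longleftrightarrow> subring B A \<and> submodule B (base_field :: 'f ring) A"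

definition subalg_gen :: "('f::field, 'a) module \<Rightarrow> 'a set \<Rightarrow> 'a set" where
  "subalg_gen A S = \<Inter>{B. unital_subalg B A \<and> S \<subseteq> B}"

definition lin_span :: "('f::field, 'a) module \<Rightarrow> 'a set \<Rightarrow> 'a set" where
  "lin_span M S = \<Inter>{N. submodule N (base_field :: 'f ring) M \<and> S \<subseteq> N}"

definition anti_involution :: "('f::field, 'a) module \<Rightarrow> ('a \<Rightarrow> 'a) \<Rightarrow> bool" where
  "anti_involution A i \<longleftrightarrow>
     i \<in> carrier A \<rightarrow> carrier A \<and> i \<one>\<^bsub>A\<^esub> = \<one>\<^bsub>A\<^esub> \<and>
     (\<forall>x\<in>carrier A. \<forall>y\<in>carrier A. i (x \<oplus>\<^bsub>A\<^esub> y) = i x \<oplus>\<^bsub>A\<^esub> i y \<and> i (x \<otimes>\<^bsub>A\<^esub> y) = i y \<otimes>\<^bsub>A\<^esub> i x) \<and>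
     (\<forall>c. \<forall>x\<in>carrier A. i (c \<odot>\<^bsub>A\<^esub> x) = c \<odot>\<^bsub>A\<^esub> i x) \<and>
     (\<forall>x\<in>carrier A. i (i x) = x)"

definition lin_iso :: "('f::field, 'a) module \<Rightarrow> ('f, 'b) module \<Rightarrow> ('a \<Rightarrow> 'b) set" where
  "lin_iso M N = {\<phi>. bij_betw \<phi> (carrier M) (carrier N) \<and>
     (\<forall>x\<in>carrier M. \<forall>y\<in>carrier M. \<phi> (x \<oplus>\<^bsub>M\<^esub> y) = \<phi> x \<oplus>\<^bsub>N\<^esub> \<phi> y) \<and>
     (\<forall>c. \<forall>x\<in>carrier M. \<phi> (c \<odot>\<^bsub>M\<^esub> x) = c \<odot>\<^bsub>N\<^esub> \<phi> x)}"


section \<open>Quotients, free vector spaces, tensor products\<close>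

text \<open>
  Used both for a two-sided ideal of an algebra and for a subspace of a vector space; in the second
  case the fields \<open>mult\<close> and \<open>one\<close> carry no meaning.
\<close>

definition quot_alg :: "('f::field, 'a) module \<Rightarrow> 'a set \<Rightarrow> ('f, 'a set) module" where
  "quot_alg M N = ring.extend (M Quot N)
     (module.fields (\<lambda>c Y. \<Union>x\<in>Y. N +>\<^bsub>M\<^esub> (c \<odot>\<^bsub>M\<^esub> x)))"

text \<open>The vector space with basis \<open>S\<close>; again \<open>mult\<close> and \<open>one\<close> carry no meaning.\<close>

definition free_vs :: "'u set \<Rightarrow> ('f::field, 'u \<Rightarrow>\<^sub>0 'f) module" where
  "free_vs S = \<lparr>carrier = {p. Poly_Mapping.keys p \<subseteq> S}, monoid.mult = undefined, one = undefined,
     ring.zero = 0, ring.add = (+), module.smult = (\<lambda>c. Poly_Mapping.map ((*) c))\<rparr>"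

definition lin_ext :: "('f::field, 'a) module \<Rightarrow> ('u \<Rightarrow> 'a) \<Rightarrow> ('u \<Rightarrow>\<^sub>0 'f) \<Rightarrow> 'a" where
  "lin_ext A m p = (\<Oplus>\<^bsub>A\<^esub>u\<in>Poly_Mapping.keys p. Poly_Mapping.lookup p u \<odot>\<^bsub>A\<^esub> m u)"

definition tensor3_rels ::
  "('f::field, 'u) module \<Rightarrow> ('f, 'v) module \<Rightarrow> ('f, 'w) module \<Rightarrow> ('u \<times> 'v \<times> 'w \<Rightarrow>\<^sub>0 'f) set" where
  "tensor3_rels U V W = (let b = (\<lambda>u v w. Poly_Mapping.single (u, v, w) (1::'f)) in
     {b (u \<oplus>\<^bsub>U\<^esub> u') v w - (b u v w + b u' v w) | u u' v w.
        u \<in> carrier U \<and> u' \<in> carrier U \<and> v \<in> carrier V \<and> w \<in> carrier W} \<union>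
     {b u (v \<oplus>\<^bsub>V\<^esub> v') w - (b u v w + b u v' w) | u v v' w.
        u \<in> carrier U \<and> v \<in> carrier V \<and> v' \<in> carrier V \<and> w \<in> carrier W} \<union>
     {b u v (w \<oplus>\<^bsub>W\<^esub> w') - (b u v w + b u v w') | u v w w'.
        u \<in> carrier U \<and> v \<in> carrier V \<and> w \<in> carrier W \<and> w' \<in> carrier W} \<union>
     {b (c \<odot>\<^bsub>U\<^esub> u) v w - Poly_Mapping.single (u, v, w) c | c u v w.
        u \<in> carrier U \<and> v \<in> carrier V \<and> w \<in> carrier W} \<union>
     {b u (c \<odot>\<^bsub>V\<^esub> v) w - Poly_Mapping.single (u, v, w) c | c u v w.
        u \<in> carrier U \<and> v \<in> carrier V \<and> w \<in> carrier W} \<union>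
     {b u v (c \<odot>\<^bsub>W\<^esub> w) - Poly_Mapping.single (u, v, w) c | c u v w.
        u \<in> carrier U \<and> v \<in> carrier V \<and> w \<in> carrier W})"

definition tensor3 ::
  "('f::field, 'u) module \<Rightarrow> ('f, 'v) module \<Rightarrow> ('f, 'w) module \<Rightarrow>
     ('f, ('u \<times> 'v \<times> 'w \<Rightarrow>\<^sub>0 'f) set) module" where
  "tensor3 U V W =
     (let M = free_vs (carrier U \<times> carrier V \<times> carrier W)
      in quot_alg M (lin_span M (tensor3_rels U V W)))"


section \<open>Strict regular triangular algebras\<close>

text \<open>
  \<open>H0\<close> is an algebra in its own right, and its embedding into \<open>A\<close> is the map \<open>\<iota>\<close>, so that
  \<open>\<theta> \<in> Aut(H0)\<close> does not depend on \<open>A\<close>.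
\<close>

definition weight_space ::
  "('f::field, 'a) module \<Rightarrow> ('f, 'h) module \<Rightarrow> ('h \<Rightarrow> 'a) \<Rightarrow> 'a set \<Rightarrow> ('h \<Rightarrow> 'h) \<Rightarrow> 'a set" where
  "weight_space A H0 \<iota> B \<theta> =
     {a \<in> B \<inter> carrier A. \<forall>h\<in>carrier H0. a \<otimes>\<^bsub>A\<^esub> \<iota> h = \<iota> (\<theta> h) \<otimes>\<^bsub>A\<^esub> a}"

text \<open>The multiplication map \<open>Bm \<otimes> H0 \<otimes> Bp \<rightarrow> A\<close>, on cosets of formal sums of triples.\<close>

definition triangular_mult ::
  "('f::field, 'a) module \<Rightarrow> ('h \<Rightarrow> 'a) \<Rightarrow> ('a \<times> 'h \<times> 'a \<Rightarrow>\<^sub>0 'f) set \<Rightarrow> 'a" where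
  "triangular_mult A \<iota> Y =
     the_elem (lin_ext A (\<lambda>(b, h, b'). b \<otimes>\<^bsub>A\<^esub> \<iota> h \<otimes>\<^bsub>A\<^esub> b') ` Y)"

text \<open>The image of \<open>H0 \<otimes> B\<close> under multiplication.\<close>

definition H0_times ::
  "('f::field, 'a) module \<Rightarrow> ('f, 'h) module \<Rightarrow> ('h \<Rightarrow> 'a) \<Rightarrow> 'a set \<Rightarrow> 'a set" where
  "H0_times A H0 \<iota> B =
     {lin_ext A (\<lambda>(h, b). \<iota> h \<otimes>\<^bsub>A\<^esub> b) p | p. Poly_Mapping.keys p \<subseteq> carrier H0 \<times> B}"

definition RTA1 ::
  "('f::field, 'a) module \<Rightarrow> ('f, 'h) module \<Rightarrow> ('h \<Rightarrow> 'a) \<Rightarrow> 'a set \<Rightarrow> 'a set \<Rightarrow> bool" where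
  "RTA1 A H0 \<iota> Bm Bp \<longleftrightarrow>
     unital_subalg Bm A \<and> unital_subalg Bp A \<and>
     F_algebra H0 \<and> \<iota> \<in> alg_hom H0 A \<and> inj_on \<iota> (carrier H0) \<and>
     triangular_mult A \<iota> \<in> lin_iso (tensor3 (A\<lparr>carrier := Bm\<rparr>) H0 (A\<lparr>carrier := Bp\<rparr>)) A"

definition RTA2 ::
  "('f::field, 'a) module \<Rightarrow> ('f, 'h) module \<Rightarrow> ('h \<Rightarrow> 'a) \<Rightarrow> 'a set \<Rightarrow> ('h \<Rightarrow> 'h) set \<Rightarrow> bool" where
  "RTA2 A H0 \<iota> Bp Q \<longleftrightarrow>
     submonoid Q (alg_aut H0) \<and>
     (\<forall>\<theta>\<in>Q - {\<one>\<^bsub>alg_aut H0\<^esub>}. \<forall>\<theta>'\<in>Q - {\<one>\<^bsub>alg_aut H0\<^esub>}.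
        \<theta> \<otimes>\<^bsub>alg_aut H0\<^esub> \<theta>' \<in> Q - {\<one>\<^bsub>alg_aut H0\<^esub>}) \<and>
     (\<forall>b\<in>Bp. \<exists>!a. a \<in> (\<Pi>\<^sub>E \<theta>\<in>Q. weight_space A H0 \<iota> Bp \<theta>) \<and>
        finite {\<theta>\<in>Q. a \<theta> \<noteq> \<zero>\<^bsub>A\<^esub>} \<and> (\<Oplus>\<^bsub>A\<^esub>\<theta>\<in>{\<theta>\<in>Q. a \<theta> \<noteq> \<zero>\<^bsub>A\<^esub>}. a \<theta>) = b) \<and>
     weight_space A H0 \<iota> Bp \<one>\<^bsub>alg_aut H0\<^esub> = {c \<odot>\<^bsub>A\<^esub> \<one>\<^bsub>A\<^esub> | c. True} \<and>
     (\<forall>\<theta>\<in>Q. \<exists>S. finite S \<and> S \<subseteq> carrier A \<and> weight_space A H0 \<iota> Bp \<theta> = lin_span A S)"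

definition RTA3 ::
  "('f::field, 'a) module \<Rightarrow> ('f, 'h) module \<Rightarrow> ('h \<Rightarrow> 'a) \<Rightarrow> 'a set \<Rightarrow> 'a set \<Rightarrow> ('a \<Rightarrow> 'a) \<Rightarrow> bool"
  where
  "RTA3 A H0 \<iota> Bm Bp i \<longleftrightarrow>
     anti_involution A i \<and> (\<forall>h\<in>carrier H0. i (\<iota> h) = \<iota> h) \<and>
     i ` Bp \<subseteq> H0_times A H0 \<iota> Bm \<and> i ` Bm \<subseteq> H0_times A H0 \<iota> Bp"

definition strict_RTA ::
  "('f::field, 'a) module \<Rightarrow> ('f, 'h) module \<Rightarrow> ('h \<Rightarrow> 'a) \<Rightarrow> 'a set \<Rightarrow> 'a set \<Rightarrow> ('h \<Rightarrow> 'h) set \<Rightarrow>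
     ('a \<Rightarrow> 'a) \<Rightarrow> bool" where
  "strict_RTA A H0 \<iota> Bm Bp Q i \<longleftrightarrow>
     F_algebra A \<and> RTA1 A H0 \<iota> Bm Bp \<and> RTA2 A H0 \<iota> Bp Q \<and> RTA3 A H0 \<iota> Bm Bp i"

text \<open>
  For a pairwise commuting set \<open>\<Delta>\<close> the subgroup it generates is abelian, so the product over a
  finite subset of \<open>\<Delta>\<close> is taken there. The group being written multiplicatively, a \<open>\<int>\<close>-linear
  combination of elements of \<open>\<Delta>\<close> is a product of integer powers.
\<close>

definition Z_independent :: "'g monoid \<Rightarrow> 'g set \<Rightarrow> bool" where
  "Z_independent G \<Delta> \<longleftrightarrow> (\<forall>S n. finite S \<and> S \<subseteq> \<Delta> \<and>
     finprod (subgroup_generated G \<Delta>) (\<lambda>\<delta>. \<delta> [^]\<^bsub>G\<^esub> (n \<delta> :: int)) S = \<one>\<^bsub>G\<^esub>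
       \<longrightarrow> (\<forall>\<delta>\<in>S. n \<delta> = 0))"

definition RTA_based :: "('f::field, 'h) module \<Rightarrow> ('h \<Rightarrow> 'h) set \<Rightarrow> bool" where
  "RTA_based H0 Q \<longleftrightarrow> (\<exists>\<Delta>\<subseteq>Q.
     (\<forall>\<delta>\<in>\<Delta>. \<forall>\<delta>'\<in>\<Delta>. \<delta> \<otimes>\<^bsub>alg_aut H0\<^esub> \<delta>' = \<delta>' \<otimes>\<^bsub>alg_aut H0\<^esub> \<delta>) \<and>
     Z_independent (alg_aut H0) \<Delta> \<and>
     Q = \<Inter>{M. submonoid M (alg_aut H0) \<and> \<Delta> \<subseteq> M})"

definition RTA_ge :: "('f::field, 'h) module \<Rightarrow> ('h \<Rightarrow> 'h) set \<Rightarrow> ('h \<Rightarrow> 'h) \<Rightarrow> ('h \<Rightarrow> 'h) \<Rightarrow> bool" where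
  "RTA_ge H0 Q \<theta> \<theta>' \<longleftrightarrow> (\<exists>\<theta>''\<in>Q. \<theta> = \<theta>'' \<otimes>\<^bsub>alg_aut H0\<^esub> \<theta>')"

definition RTA_discretely_graded :: "('f::field, 'h) module \<Rightarrow> ('h \<Rightarrow> 'h) set \<Rightarrow> bool" where
  "RTA_discretely_graded H0 Q \<longleftrightarrow> (\<forall>\<theta>0\<in>Q.
     finite {\<theta> \<in> carrier (alg_aut H0). RTA_ge H0 Q \<theta> \<one>\<^bsub>alg_aut H0\<^esub> \<and> RTA_ge H0 Q \<theta>0 \<theta>})"


section \<open>Free algebras and presentations\<close>

text \<open>
  The free monoid, so that \<open>'g free_word \<Rightarrow>\<^sub>0 'f\<close>, with the convolution product of
  \<^theory>\<open>HOL-Library.Poly_Mapping\<close>, is the free \<open>'f\<close>-algebra on \<open>'g\<close>. The monoid operation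
  (concatenation) has to be written additively.
\<close>

datatype 'g free_word = Word (letters: "'g list")

instantiation free_word :: (type) monoid_add
begin

definition "0 = Word []"

definition "v + w = Word (letters v @ letters w)"

instance
  by standard (simp_all add: zero_free_word_def plus_free_word_def)

end

definition free_alg :: "'g set \<Rightarrow> ('f::field, 'g free_word \<Rightarrow>\<^sub>0 'f) module" where
  "free_alg S = (free_vs {w. set (letters w) \<subseteq> S})\<lparr>monoid.mult := (*), one := 1\<rparr>"

definition free_gen :: "'g \<Rightarrow> ('g free_word \<Rightarrow>\<^sub>0 'f::field)" where
  "free_gen g = Poly_Mapping.single (Word [g]) 1"

definition rel_ideal ::
  "'g set \<Rightarrow> (('g free_word \<Rightarrow>\<^sub>0 'f) \<times> ('g free_word \<Rightarrow>\<^sub>0 'f)) set \<Rightarrow> ('g free_word \<Rightarrow>\<^sub>0 'f::field) set"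
  where
  "rel_ideal S R = genideal (free_alg S) {l - r | l r. (l, r) \<in> R}"

definition presented_alg ::
  "'g set \<Rightarrow> (('g free_word \<Rightarrow>\<^sub>0 'f) \<times> ('g free_word \<Rightarrow>\<^sub>0 'f)) set \<Rightarrow>
     ('f::field, ('g free_word \<Rightarrow>\<^sub>0 'f) set) module" where
  "presented_alg S R = quot_alg (free_alg S) (rel_ideal S R)"


section \<open>The group \<open>\<int>\<^sup>k \<ltimes> \<E>\<close>\<close>

text \<open>
  \<open>k\<close> is the number of elements of the finite index type \<open>'k\<close>. The pair \<open>(n, e)\<close> stands for the
  element \<open>(0, e) (n, 0)\<close>.
\<close>

definition zeta_pow :: "real^'k \<Rightarrow> int^'k \<Rightarrow> real" where
  "zeta_pow \<zeta> n = (\<Prod>j\<in>UNIV. (\<zeta>$j) powi (n$j))"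

definition sdp :: "real^'k \<Rightarrow> real set \<Rightarrow> ((int^'k) \<times> real) monoid" where
  "sdp \<zeta> E = \<lparr>carrier = UNIV \<times> E,
     monoid.mult = (\<lambda>(m, d) (n, e). (m + n, d + zeta_pow \<zeta> m * e)), one = (0, 0)\<rparr>"

definition sdp_nonneg :: "real^'k \<Rightarrow> real set \<Rightarrow> ((int^'k) \<times> real) set" where
  "sdp_nonneg \<zeta> E = {(n, e). (n, e) \<in> carrier (sdp \<zeta> E) \<and> (\<forall>j. 0 \<le> n$j) \<and> 0 \<le> e}"

definition fun_alg :: "'g set \<Rightarrow> ('f::field, 'g \<Rightarrow> 'f) module" where
  "fun_alg Y = \<lparr>carrier = Y \<rightarrow>\<^sub>E UNIV,
     monoid.mult = (\<lambda>f g. \<lambda>x\<in>Y. f x * g x), one = (\<lambda>x\<in>Y. 1),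
     ring.zero = (\<lambda>x\<in>Y. 0), ring.add = (\<lambda>f g. \<lambda>x\<in>Y. f x + g x), module.smult = (\<lambda>c f. \<lambda>x\<in>Y. c * f x)\<rparr>"

text \<open>The function \<open>f(g \<cdot> -)\<close> on the group.\<close>

definition ltrans :: "('g, 'm) monoid_scheme \<Rightarrow> 'g \<Rightarrow> ('g \<Rightarrow> 'f) \<Rightarrow> ('g \<Rightarrow> 'f)" where
  "ltrans G g f = (\<lambda>x\<in>carrier G. f (g \<otimes>\<^bsub>G\<^esub> x))"

definition fun_aut :: "('g, 'm) monoid_scheme \<Rightarrow> 'g \<Rightarrow> (('g \<Rightarrow> 'f::field) \<Rightarrow> ('g \<Rightarrow> 'f))" where
  "fun_aut G g = (\<lambda>f\<in>carrier (fun_alg (carrier G)). ltrans G (inv\<^bsub>G\<^esub> g) f)"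


section \<open>The algebra\<close>

datatype pm = Plus | Minus

primrec pm_neg :: "pm \<Rightarrow> pm" where
  "pm_neg Plus = Minus"
| "pm_neg Minus = Plus"

primrec pm_int :: "pm \<Rightarrow> int" where
  "pm_int Plus = 1"
| "pm_int Minus = - 1"

datatype ('h, 'k) gen = GenH 'h | GenT real | GenX pm 'k

type_synonym ('f, 'k) H0_fun = "(int^'k) \<times> real \<Rightarrow> 'f"
type_synonym ('f, 'k) gens = "(('f, 'k) H0_fun, 'k) gen"
type_synonym ('f, 'k) free_elem = "('f, 'k) gens free_word \<Rightarrow>\<^sub>0 'f"

definition A_gens :: "real set \<Rightarrow> ('f, 'k::finite) gens set" where
  "A_gens E = GenH ` (UNIV \<times> E \<rightarrow>\<^sub>E UNIV) \<union> GenT ` E \<union> range (case_prod GenX)"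

definition A_H0 :: "real^'k \<Rightarrow> real set \<Rightarrow> ('f::field, ('f, 'k) H0_fun) module" where
  "A_H0 \<zeta> E = fun_alg (carrier (sdp \<zeta> E))"

context
  fixes \<zeta> :: "real^'k" and E :: "real set" and c :: "'f::field^'k"
begin

private abbreviation h :: "('f, 'k) H0_fun \<Rightarrow> ('f, 'k) free_elem" where
  "h f \<equiv> free_gen (GenH f)"

private abbreviation t :: "real \<Rightarrow> ('f, 'k) free_elem" where
  "t e \<equiv> free_gen (GenT e)"

private abbreviation x :: "pm \<Rightarrow> 'k \<Rightarrow> ('f, 'k) free_elem" where
  "x s j \<equiv> free_gen (GenX s j)"

private abbreviation scal :: "'f \<Rightarrow> ('f, 'k) free_elem" where
  "scal a \<equiv> Poly_Mapping.single 0 a"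

text \<open>The first four rules make \<open>h\<close> a homomorphism of unital algebras on \<open>H0\<close>.\<close>

inductive_set A_rels :: "(('f, 'k) free_elem \<times> ('f, 'k) free_elem) set" where
  h_add: "f \<in> carrier (A_H0 \<zeta> E) \<Longrightarrow> g \<in> carrier (A_H0 \<zeta> E) \<Longrightarrow>
    (h f + h g, h (f \<oplus>\<^bsub>A_H0 \<zeta> E\<^esub> g)) \<in> A_rels"
| h_mult: "f \<in> carrier (A_H0 \<zeta> E) \<Longrightarrow> g \<in> carrier (A_H0 \<zeta> E) \<Longrightarrow>
    (h f * h g, h (f \<otimes>\<^bsub>A_H0 \<zeta> E\<^esub> g)) \<in> A_rels"
| h_smult: "f \<in> carrier (A_H0 \<zeta> E) \<Longrightarrow> (scal a * h f, h (a \<odot>\<^bsub>A_H0 \<zeta> E\<^esub> f)) \<in> A_rels"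
| h_one: "(h \<one>\<^bsub>A_H0 \<zeta> E\<^esub>, 1) \<in> A_rels"
| t_zero: "(t 0, 1) \<in> A_rels"
| t_plus: "e \<in> E \<inter> {0..} \<Longrightarrow> e' \<in> E \<inter> {0..} \<Longrightarrow> (t e * t e', t (e + e')) \<in> A_rels"
| t_minus: "e \<in> E \<inter> {0..} \<Longrightarrow> e' \<in> E \<inter> {0..} \<Longrightarrow> (t (- e) * t (- e'), t (- e - e')) \<in> A_rels"
| t_comm: "e \<in> E \<inter> {0..} \<Longrightarrow> e' \<in> E \<inter> {0..} \<Longrightarrow> (t e * t (- e'), t (- e') * t e) \<in> A_rels"
| t_h: "e \<in> E \<Longrightarrow> f \<in> carrier (A_H0 \<zeta> E) \<Longrightarrow>
    (t e * h f, h (ltrans (sdp \<zeta> E) (0, - e) f) * t e) \<in> A_rels"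
| x_h: "f \<in> carrier (A_H0 \<zeta> E) \<Longrightarrow>
    (x s j * h f, h (ltrans (sdp \<zeta> E) (axis j (- pm_int s), 0) f) * x s j) \<in> A_rels"
| x_comm: "j \<noteq> j' \<Longrightarrow> (x s j * x s' j' - x s' j' * x s j, 0) \<in> A_rels"
| x_weyl: "(x Plus j * x Minus j - x Minus j * x Plus j, scal (c$j)) \<in> A_rels"
| x_t: "e \<in> E \<Longrightarrow> (x s j * t e, t ((\<zeta>$j) powi pm_int s * e) * x s j) \<in> A_rels"

definition A_ideal :: "('f, 'k) free_elem set" where
  "A_ideal = rel_ideal (A_gens E) A_rels"

definition A_alg :: "('f, ('f, 'k) free_elem set) module" where
  "A_alg = presented_alg (A_gens E) A_rels"

definition A_cls :: "('f, 'k) gens \<Rightarrow> ('f, 'k) free_elem set" where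
  "A_cls g = A_ideal +>\<^bsub>free_alg (A_gens E)\<^esub> free_gen g"

definition A_emb :: "('f, 'k) H0_fun \<Rightarrow> ('f, 'k) free_elem set" where
  "A_emb f = A_cls (GenH f)"

definition A_Bplus :: "('f, 'k) free_elem set set" where
  "A_Bplus = subalg_gen A_alg
     (range (\<lambda>j. A_cls (GenX Plus j)) \<union> {A_cls (GenT e) | e. e \<in> E \<inter> {0..}})"

definition A_Bminus :: "('f, 'k) free_elem set set" where
  "A_Bminus = subalg_gen A_alg
     (range (\<lambda>j. A_cls (GenX Minus j)) \<union> {A_cls (GenT (- e)) | e. e \<in> E \<inter> {0..}})"

end

text \<open>
  The anti-involution reverses words and exchanges the generators. \<open>free_flip\<close> is its lift to the
  free algebra (\<open>flip_word\<close> is an involution, so precomposing the coefficient function with it is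
  the linear extension of \<open>flip_word\<close>). As \<open>free_flip\<close> maps the ideal of relations onto itself,
  the induced map on the quotient sends a coset to its image.
\<close>

primrec flip_gen :: "('h, 'k) gen \<Rightarrow> ('h, 'k) gen" where
  "flip_gen (GenH f) = GenH f"
| "flip_gen (GenT e) = GenT (- e)"
| "flip_gen (GenX s j) = GenX (pm_neg s) j"

definition flip_word :: "('h, 'k) gen free_word \<Rightarrow> ('h, 'k) gen free_word" where
  "flip_word w = Word (rev (map flip_gen (letters w)))"

definition free_flip :: "('f::field, 'k::finite) free_elem \<Rightarrow> ('f, 'k) free_elem" where
  "free_flip p = Poly_Mapping.map_key flip_word p"

definition A_inv :: "('f::field, 'k::finite) free_elem set \<Rightarrow> ('f, 'k) free_elem set" where
  "A_inv Y = free_flip ` Y"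

lemma flip_word_flip_word [simp]:
  fixes w :: "('h, 'k) gen free_word"
  shows "flip_word (flip_word w) = w"
proof -
  have "pm_neg (pm_neg s) = s" for s
    by (cases s) simp_all
  then have "flip_gen (flip_gen g) = g" for g :: "('h, 'k) gen"
    by (cases g) simp_all
  then show ?thesis
    by (simp add: flip_word_def rev_map comp_def)
qed

text \<open>\<^const>\<open>Poly_Mapping.map_key\<close> is only meaningful for an injective map of indices.\<close>

lemma lookup_free_flip:
  fixes p :: "('f::field, 'k::finite) free_elem"
  shows "Poly_Mapping.lookup (free_flip p) w = Poly_Mapping.lookup p (flip_word w)"
proof -
  have "inj (flip_word :: ('f, 'k) gens free_word \<Rightarrow> _)"
    by (rule inj_on_inverseI[where g = flip_word]) simp
  then show ?thesis
    by (simp add: free_flip_def map_key.rep_eq)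
qed

text \<open>\<open>(\<int>\<^sup>+)\<^sup>k \<ltimes> (\<E> \<inter> [0, \<infinity>))\<close> inside \<open>Aut(H0)\<close>.\<close>

definition A_Q :: "real^'k \<Rightarrow> real set \<Rightarrow> (('f::field, 'k) H0_fun \<Rightarrow> ('f, 'k) H0_fun) set" where
  "A_Q \<zeta> E = fun_aut (sdp \<zeta> E) ` sdp_nonneg \<zeta> E"

end

theory Submission
  imports Defs
begin

text \<open>
  Let \<open>C\<close> be the cone of elements of the group \<open>G = \<int>\<^sup>k \<ltimes> \<E>\<close> with nonnegative components, and for
  \<open>g = (n, e)\<close> in \<open>C\<close> put \<open>P\<^sub>g = t\<^sup>e \<Prod>\<^sub>j (x\<^sub>j\<^sup>+)\<^bsup>n j\<^esup>\<close> and \<open>N\<^sub>g = i(P\<^sub>g)\<close>. The relations give \<open>P\<^sub>g P\<^sub>h = P\<^sub>g\<^sub>h\<close> and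
  \<open>P\<^sub>g f = g(f) P\<^sub>g\<close> for \<open>f\<close> in \<open>H0\<close> (\<open>Pm_mult\<close>, \<open>Pm_h\<close>), so that the \<open>P\<^sub>g\<close> span \<open>B\<^sup>+\<close> and the \<open>N\<^sub>g\<close>
  span \<open>B\<^sup>-\<close>. The products \<open>N\<^sub>g f P\<^sub>h\<close> span the algebra, because their span contains \<open>1\<close> and is
  stable under left multiplication by every generator (\<open>Span_carrier\<close>); the essential case
  is \<open>x\<^sub>j\<^sup>+\<close>, which is moved past \<open>N\<^sub>g\<close> by the Weyl relation.

  The main point is that these products are linearly independent over \<open>H0\<close>. The algebra acts on the
  vector space with basis the tuples \<open>(e, e', m, n, y)\<close>, where \<open>y\<close> is in \<open>G\<close>, \<open>m\<close> and \<open>n\<close> are in \<open>\<int>\<^sup>k\<close> and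
  \<open>e, e'\<close> are real. Such a tuple stands for the element \<open>t\<^sup>e t\<^bsup>-e'\<^esup> (x\<^sup>-)\<^sup>m (x\<^sup>+)\<^sup>n\<close> acting on a weight
  vector, \<open>y\<close> being the resulting weight, at which \<open>f\<close> in \<open>H0\<close> is evaluated. The action of each
  generator is read off from the commutation rules (\<open>act\<close>), and checking the defining relations is
  then a computation with tuples (\<open>pact_rel\<close>); no basis of the algebra is presupposed. With
  \<open>g = (m, d)\<close> and \<open>h = (n, e)\<close>, the element \<open>N\<^sub>g f P\<^sub>h\<close> maps the tuple \<open>(0, 0, 0, 0, y)\<close> to \<open>f(h y)\<close> times
  the tuple that starts with \<open>\<zeta>\<^bsup>-m\<^esup> e, \<zeta>\<^bsup>-m\<^esup> d, m, n\<close> (\<open>rep_tri\<close>). Hence \<open>g\<close>, \<open>h\<close> and \<open>f\<close> can be recovered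
  (\<open>indep_NP\<close>). This gives the triangular decomposition: a general lemma about bases of the two outer
  factors (\<open>triangular_mult_iso\<close>) turns spanning and independence into an isomorphism from the tensor
  product. As distinct elements of \<open>G\<close> act differently on \<open>H0\<close>, the weight spaces of \<open>B\<^sup>+\<close> are the
  lines spanned by the \<open>P\<^sub>g\<close>. The anti-involution exists because reversing words and exchanging
  generators preserves the relations.

  The second part only concerns the monoid \<open>C\<close>. If all intervals are finite, then \<open>\<E>\<close> has finitely many
  elements between \<open>0\<close> and any given one, so it has a least positive element \<open>\<eta>\<close> and equals \<open>\<eta>\<int>\<close>; an
  automorphism of \<open>\<eta>\<int>\<close> by a positive factor is trivial, so all \<open>\<zeta>\<^sub>j\<close> are \<open>1\<close>. If \<open>C\<close> has a base, it is
  commutative, which forces \<open>\<zeta>\<^sub>j = 1\<close>. If \<open>(0, a)\<close> and \<open>(0, b)\<close> were in the base with \<open>a < b\<close>, then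
  \<open>(0, b - a)\<close> would be a nonnegative combination of the base, and \<open>a + (b - a) = b\<close> a nontrivial
  relation. So exactly one element of the base has the form \<open>(0, a)\<close>, and \<open>\<E> = a\<int>\<close>. For the converse, when \<open>\<E> = \<eta>\<int>\<close> with \<open>\<eta> > 0\<close> and all \<open>\<zeta>\<^sub>j = 1\<close>,
  the elements \<open>(\<epsilon>\<^sub>j, 0)\<close> and \<open>(0, \<eta>)\<close> form a base and intervals are finite.
\<close>

text \<open>The symbol \<open>$\<close> always means the component of a vector.\<close>

no_notation fps_nth (infixl \<open>$\<close> 75)

section \<open>Vector spaces\<close>

lemma lookup_map_mult [simp]: "Poly_Mapping.lookup (Poly_Mapping.map ((*) c) p) u = c * Poly_Mapping.lookup p u"
  for c :: "'b::mult_zero"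
  by (simp add: map.rep_eq when_def)

lemma keys_map_mult: "Poly_Mapping.keys (Poly_Mapping.map ((*) c) p) \<subseteq> Poly_Mapping.keys p"
  for c :: "'b::mult_zero"
  by (auto simp: in_keys_iff)

lemma single_smult: "Poly_Mapping.map ((*) c) (Poly_Mapping.single u a) = Poly_Mapping.single u (c * a)"
  for c :: "'b::mult_zero"
  by (rule poly_mapping_eqI) (simp add: lookup_single when_def)

lemma map_mult_add:
  "Poly_Mapping.map ((*) c) (p + q) = Poly_Mapping.map ((*) c) p + Poly_Mapping.map ((*) c) q"
  for c :: "'b::ring"
  by (rule poly_mapping_eqI) (simp add: lookup_add algebra_simps)

lemma base_field_simps [simp]:
  "carrier (base_field :: 'f::field ring) = UNIV"
  "x \<oplus>\<^bsub>base_field\<^esub> y = (x + y :: 'f)"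
  "x \<otimes>\<^bsub>base_field\<^esub> y = (x * y :: 'f)"
  "\<zero>\<^bsub>base_field\<^esub> = (0 :: 'f)"
  "\<one>\<^bsub>base_field\<^esub> = (1 :: 'f)"
  by (simp_all add: ring_of_type_algebra_def)

text \<open>
  The locale \<open>vspace\<close> uses no more than the additive group and the scalar multiplication of the record,
  so that it also covers free vector spaces, whose ring multiplication is meaningless.
\<close>

locale vspace = abelian_group M for M :: "('f::field, 'a) module" (structure) +
  assumes vs_module: "module base_field M"
begin

lemma smult_closed [simp, intro]: "x \<in> carrier M \<Longrightarrow> c \<odot> x \<in> carrier M"
  using module.smult_closed[OF vs_module, of c x] by simp

lemma smult_add_left: "x \<in> carrier M \<Longrightarrow> (a + b) \<odot> x = a \<odot> x \<oplus> b \<odot> x"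
  using module.smult_l_distr[OF vs_module, of a b x] by simp

lemma smult_add_right:
  "x \<in> carrier M \<Longrightarrow> y \<in> carrier M \<Longrightarrow> c \<odot> (x \<oplus> y) = c \<odot> x \<oplus> c \<odot> y"
  using module.smult_r_distr[OF vs_module, of c x y] by simp

lemma smult_smult: "x \<in> carrier M \<Longrightarrow> a \<odot> (b \<odot> x) = (a * b) \<odot> x"
  using module.smult_assoc1[OF vs_module, of a b x] by simp

lemma smult_1 [simp]: "x \<in> carrier M \<Longrightarrow> 1 \<odot> x = x"
  using module.smult_one[OF vs_module, of x] by simp

lemma smult_0 [simp]: "x \<in> carrier M \<Longrightarrow> 0 \<odot> x = \<zero>"
  using smult_add_left[of x 0 0] smult_closed[of x 0] by (metis add.r_cancel_one' add_0)

lemma smult_zero [simp]: "c \<odot> \<zero> = \<zero>"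
  using smult_smult[of \<zero> c 0] by simp

lemma smult_minus_1: "x \<in> carrier M \<Longrightarrow> (- 1) \<odot> x = \<ominus> x"
  using smult_add_left[of x "- 1" 1] minus_equality[of "(- 1) \<odot> x" x] by simp

lemma smult_minus: "x \<in> carrier M \<Longrightarrow> c \<odot> (\<ominus> x) = \<ominus> (c \<odot> x)"
  using smult_smult[of x c "- 1"] smult_smult[of x "- 1" c] smult_minus_1[of x] smult_minus_1[of "c \<odot> x"]
  by simp

text \<open>
  Closure under negation follows from closure under multiplication by \<open>-1\<close>.
\<close>

lemma subspaceI:
  assumes "N \<subseteq> carrier M" "\<zero> \<in> N" "\<And>x y. x \<in> N \<Longrightarrow> y \<in> N \<Longrightarrow> x \<oplus> y \<in> N"
    "\<And>c x. x \<in> N \<Longrightarrow> c \<odot> x \<in> N"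
  shows "submodule N base_field M"
proof (rule module.submoduleI[OF vs_module])
  show "\<ominus> x \<in> N" if "x \<in> N" for x
    using assms(4)[of x "- 1"] assms(1) that smult_minus_1 by (metis subsetD)
qed (use assms in auto)

lemma subspaceD:
  assumes "submodule N base_field M"
  shows "N \<subseteq> carrier M" "\<zero> \<in> N" "x \<in> N \<Longrightarrow> y \<in> N \<Longrightarrow> x \<oplus> y \<in> N" "x \<in> N \<Longrightarrow> c \<odot> x \<in> N"
    "x \<in> N \<Longrightarrow> \<ominus> x \<in> N"
proof -
  note E = module.submoduleE[OF vs_module assms]
  show 1: "N \<subseteq> carrier M" by (rule E(1))
  show "x \<in> N \<Longrightarrow> y \<in> N \<Longrightarrow> x \<oplus> y \<in> N" by (rule E(5))
  show "x \<in> N \<Longrightarrow> \<ominus> x \<in> N" by (rule E(3))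
  have s: "c \<odot> x \<in> N" if "x \<in> N" for c x using E(4)[of c x] that by simp
  then show "x \<in> N \<Longrightarrow> c \<odot> x \<in> N" .
  from E(2) obtain z where "z \<in> N" by auto
  with s[of z 0] 1 show "\<zero> \<in> N" by (metis smult_0 subsetD)
qed

lemma subspace_minus:
  "submodule N base_field M \<Longrightarrow> x \<in> N \<Longrightarrow> y \<in> N \<Longrightarrow> x \<ominus> y \<in> N"
  by (simp add: a_minus_def subspaceD)

lemma subspace_carrier: "submodule (carrier M) base_field M"
  by (rule subspaceI) auto

lemma subspace_finsum:
  assumes N: "submodule N base_field M" and "\<And>i. i \<in> I \<Longrightarrow> f i \<in> N"
  shows "finsum M f I \<in> N"
  using assms(2)
proof (induction I rule: infinite_finite_induct)
  case (insert i I)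
  then have "f \<in> I \<rightarrow> carrier M" "f i \<in> carrier M" using subspaceD(1)[OF N] by auto
  then show ?case using insert by (simp add: subspaceD(3)[OF N])
qed (use subspaceD[OF N] in \<open>auto simp: finsum_infinite\<close>)

lemma smult_finsum:
  assumes "\<And>i. i \<in> I \<Longrightarrow> f i \<in> carrier M"
  shows "c \<odot> finsum M f I = finsum M (\<lambda>i. c \<odot> f i) I"
  using assms
proof (induction I rule: infinite_finite_induct)
  case (insert i I)
  then have "f \<in> I \<rightarrow> carrier M" "(\<lambda>i. c \<odot> f i) \<in> I \<rightarrow> carrier M" by auto
  then show ?case using insert by (simp add: smult_add_right finsum_closed)
qed (auto simp: finsum_infinite)

lemma lin_span_incl: "S \<subseteq> lin_span M S"
  by (auto simp: lin_span_def)

lemma lin_span_least: "submodule N base_field M \<Longrightarrow> S \<subseteq> N \<Longrightarrow> lin_span M S \<subseteq> N"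
  by (auto simp: lin_span_def)

lemma lin_span_subspace: "S \<subseteq> carrier M \<Longrightarrow> submodule (lin_span M S) base_field M"
proof (rule subspaceI)
  assume S: "S \<subseteq> carrier M"
  show "lin_span M S \<subseteq> carrier M"
    by (rule lin_span_least[OF subspace_carrier S])
qed (auto simp: lin_span_def subspaceD)

lemma lin_span_induct [consumes 2, case_names base zero add smult]:
  assumes x: "x \<in> lin_span M S" and S: "S \<subseteq> carrier M"
    and "\<And>x. x \<in> S \<Longrightarrow> P x" "P \<zero>"
    "\<And>x y. x \<in> lin_span M S \<Longrightarrow> y \<in> lin_span M S \<Longrightarrow> P x \<Longrightarrow> P y \<Longrightarrow> P (x \<oplus> y)"
    "\<And>c x. x \<in> lin_span M S \<Longrightarrow> P x \<Longrightarrow> P (c \<odot> x)"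
  shows "P x"
proof -
  note sp = lin_span_subspace[OF S]
  have "submodule {x \<in> lin_span M S. P x} base_field M"
    by (rule subspaceI) (use assms subspaceD[OF sp] in auto)
  then have "lin_span M S \<subseteq> {x \<in> lin_span M S. P x}"
    by (rule lin_span_least) (use assms(3) lin_span_incl in auto)
  with x show ?thesis by auto
qed

lemma lin_ext_closed: "(\<And>u. u \<in> Poly_Mapping.keys p \<Longrightarrow> m u \<in> carrier M) \<Longrightarrow> lin_ext M m p \<in> carrier M"
  unfolding lin_ext_def by (rule finsum_closed) auto

lemma lin_ext_superset:
  assumes "finite S" "Poly_Mapping.keys p \<subseteq> S" "\<And>u. u \<in> S \<Longrightarrow> m u \<in> carrier M"
  shows "lin_ext M m p = finsum M (\<lambda>u. Poly_Mapping.lookup p u \<odot> m u) S"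
  unfolding lin_ext_def
  by (rule add.finprod_mono_neutral_cong_left) (use assms in \<open>auto simp: in_keys_iff\<close>)

lemma lin_ext_0 [simp]: "lin_ext M m 0 = \<zero>"
  by (simp add: lin_ext_def)

lemma lin_ext_add:
  assumes "\<And>u. u \<in> Poly_Mapping.keys p \<Longrightarrow> m u \<in> carrier M" "\<And>u. u \<in> Poly_Mapping.keys q \<Longrightarrow> m u \<in> carrier M"
  shows "lin_ext M m (p + q) = lin_ext M m p \<oplus> lin_ext M m q"
proof -
  let ?S = "Poly_Mapping.keys p \<union> Poly_Mapping.keys q"
  have c: "\<And>u. u \<in> ?S \<Longrightarrow> m u \<in> carrier M" using assms by auto
  have "lin_ext M m (p + q) = finsum M (\<lambda>u. Poly_Mapping.lookup (p + q) u \<odot> m u) ?S"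
    by (rule lin_ext_superset) (use c in \<open>auto dest: subsetD[OF keys_add]\<close>)
  also have "\<dots> = finsum M (\<lambda>u. Poly_Mapping.lookup p u \<odot> m u \<oplus> Poly_Mapping.lookup q u \<odot> m u) ?S"
    by (rule finsum_cong') (use c in \<open>auto simp: lookup_add smult_add_left\<close>)
  also have "\<dots> = finsum M (\<lambda>u. Poly_Mapping.lookup p u \<odot> m u) ?S \<oplus> finsum M (\<lambda>u. Poly_Mapping.lookup q u \<odot> m u) ?S"
    by (rule finsum_addf) (use c in auto)
  also have "\<dots> = lin_ext M m p \<oplus> lin_ext M m q"
    using lin_ext_superset[of ?S p m] lin_ext_superset[of ?S q m] c by simp
  finally show ?thesis .
qed

lemma lin_ext_smult:
  assumes "\<And>u. u \<in> Poly_Mapping.keys p \<Longrightarrow> m u \<in> carrier M"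
  shows "lin_ext M m (Poly_Mapping.map ((*) c) p) = c \<odot> lin_ext M m p"
proof -
  have "lin_ext M m (Poly_Mapping.map ((*) c) p)
      = finsum M (\<lambda>u. Poly_Mapping.lookup (Poly_Mapping.map ((*) c) p) u \<odot> m u) (Poly_Mapping.keys p)"
    by (rule lin_ext_superset) (use assms in \<open>auto dest: subsetD[OF keys_map_mult]\<close>)
  also have "\<dots> = finsum M (\<lambda>u. c \<odot> (Poly_Mapping.lookup p u \<odot> m u)) (Poly_Mapping.keys p)"
    by (rule finsum_cong') (use assms in \<open>auto simp: smult_smult\<close>)
  also have "\<dots> = c \<odot> lin_ext M m p"
    unfolding lin_ext_def by (rule smult_finsum[symmetric]) (use assms in auto)
  finally show ?thesis .
qed

lemma lin_ext_single [simp]: "m u \<in> carrier M \<Longrightarrow> lin_ext M m (Poly_Mapping.single u c) = c \<odot> m u"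
  using lin_ext_superset[of "{u}" "Poly_Mapping.single u c" m] by simp

lemma lin_span_image:
  assumes "m \<in> S \<rightarrow> carrier M"
  shows "lin_span M (m ` S) = lin_ext M m ` {p. Poly_Mapping.keys p \<subseteq> S}"
proof
  have c: "Poly_Mapping.keys p \<subseteq> S \<Longrightarrow> u \<in> Poly_Mapping.keys p \<Longrightarrow> m u \<in> carrier M" for u and p :: "'b \<Rightarrow>\<^sub>0 'f" using assms by auto
  let ?L = "lin_ext M m ` {p. Poly_Mapping.keys p \<subseteq> S}"
  have "submodule ?L base_field M"
  proof (rule subspaceI)
    show "?L \<subseteq> carrier M" using c by (auto intro!: lin_ext_closed)
    show "\<zero> \<in> ?L" by (rule image_eqI[of _ _ 0]) auto
    show "x \<oplus> y \<in> ?L" if xy: "x \<in> ?L" "y \<in> ?L" for x y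
    proof -
      from xy obtain p q where "Poly_Mapping.keys p \<subseteq> S" "x = lin_ext M m p" "Poly_Mapping.keys q \<subseteq> S" "y = lin_ext M m q"
        by auto
      then have "x \<oplus> y = lin_ext M m (p + q)" "Poly_Mapping.keys (p + q) \<subseteq> S"
        using c keys_add[of p q] by (auto intro!: lin_ext_add[symmetric])
      then show ?thesis by auto
    qed
    show "a \<odot> x \<in> ?L" if xy: "x \<in> ?L" for x a
    proof -
      from xy obtain p where "Poly_Mapping.keys p \<subseteq> S" "x = lin_ext M m p" by auto
      then have "a \<odot> x = lin_ext M m (Poly_Mapping.map ((*) a) p)"
          "Poly_Mapping.keys (Poly_Mapping.map ((*) a) p) \<subseteq> S"
        using c keys_map_mult[of a p] by (auto intro!: lin_ext_smult[symmetric])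
      then show ?thesis by blast
    qed
  qed
  moreover have "m ` S \<subseteq> ?L"
  proof
    fix y assume "y \<in> m ` S"
    then obtain u where "u \<in> S" "y = m u" by auto
    moreover have "m u \<in> carrier M" using \<open>u \<in> S\<close> assms by auto
    ultimately show "y \<in> ?L" by (intro image_eqI[of _ _ "Poly_Mapping.single u 1"]) auto
  qed
  ultimately show "lin_span M (m ` S) \<subseteq> ?L" by (rule lin_span_least)
  have sp: "submodule (lin_span M (m ` S)) base_field M"
    by (rule lin_span_subspace) (use assms in auto)
  have "lin_ext M m p \<in> lin_span M (m ` S)" if "Poly_Mapping.keys p \<subseteq> S" for p
    unfolding lin_ext_def
  proof (rule subspace_finsum[OF sp])
    fix u assume "u \<in> Poly_Mapping.keys p"
    then have "m u \<in> m ` S" using that by auto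
    then show "Poly_Mapping.lookup p u \<odot> m u \<in> lin_span M (m ` S)"
      using lin_span_incl[of "m ` S"] subspaceD(4)[OF sp] by auto
  qed
  then show "?L \<subseteq> lin_span M (m ` S)" by auto
qed

end

lemma vspaceI: "module base_field M \<Longrightarrow> vspace M"
  unfolding vspace_def vspace_axioms_def by (auto simp: module_def)

section \<open>Quotient spaces\<close>

context vspace
begin

lemma quot_simps:
  "carrier (quot_alg M N) = {N +> x | x. x \<in> carrier M}"
  "Y \<oplus>\<^bsub>quot_alg M N\<^esub> Z = Y <+> Z"
  "Y \<otimes>\<^bsub>quot_alg M N\<^esub> Z = Y \<otimes>\<^bsub>M Quot N\<^esub> Z"
  "\<one>\<^bsub>quot_alg M N\<^esub> = \<one>\<^bsub>M Quot N\<^esub>"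
  "\<zero>\<^bsub>quot_alg M N\<^esub> = N"
  by (auto simp: quot_alg_def ring.defs module.defs FactRing_def A_RCOSETS_def' set_add_defs)

lemma subspace_abelian_subgroup:
  assumes "submodule N base_field M"
  shows "abelian_subgroup N M"
  using assms abelian_group_axioms
  by (auto intro!: abelian_subgroupI3 additive_subgroup.intro simp: submodule_def)

context
  fixes N :: "'a set" assumes N: "submodule N base_field M"
begin

interpretation N: abelian_subgroup N M
  by (rule subspace_abelian_subgroup[OF N])

lemma quot_add:
  "x \<in> carrier M \<Longrightarrow> y \<in> carrier M \<Longrightarrow> (N +> x) \<oplus>\<^bsub>quot_alg M N\<^esub> (N +> y) = N +> (x \<oplus> y)"
  by (simp add: quot_simps N.a_rcos_sum)

lemma quot_eq_iff:
  assumes "x \<in> carrier M" "y \<in> carrier M"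
  shows "N +> x = N +> y \<longleftrightarrow> x \<ominus> y \<in> N"
proof
  assume "N +> x = N +> y"
  then have "x \<in> N +> y" using N.a_rcos_self[OF assms(1)] by simp
  then show "x \<ominus> y \<in> N" using assms N.a_rcos_module[OF assms(2) assms(1)] by (simp add: a_minus_def)
next
  assume "x \<ominus> y \<in> N"
  then have "x \<in> N +> y" using N.a_rcos_module[OF assms(2) assms(1)] by (simp add: a_minus_def)
  then show "N +> x = N +> y" using N.a_repr_independence'[of x y] assms by simp
qed

lemma quot_mem_iff: "x \<in> carrier M \<Longrightarrow> y \<in> N +> x \<longleftrightarrow> y \<in> carrier M \<and> y \<ominus> x \<in> N"
  using N.a_elemrcos_carrier[of x y] N.a_rcos_module[of x y] unfolding a_minus_def by blast

lemma quot_smult: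
  assumes x: "x \<in> carrier M"
  shows "c \<odot>\<^bsub>quot_alg M N\<^esub> (N +> x) = N +> (c \<odot> x)"
proof -
  have "N +> (c \<odot> y) = N +> (c \<odot> x)" if "y \<in> N +> x" for y
  proof -
    have y: "y \<in> carrier M" "y \<ominus> x \<in> N" using that x by (auto simp: quot_mem_iff)
    have "c \<odot> y \<ominus> c \<odot> x = c \<odot> (y \<ominus> x)"
      using x y by (simp add: a_minus_def smult_add_right smult_minus)
    then show ?thesis using x y subspaceD(4)[OF N] by (subst quot_eq_iff) auto
  qed
  then have "(\<Union>y\<in>N +> x. N +> (c \<odot> y)) = (\<Union>y\<in>N +> x. N +> (c \<odot> x))"
    by (intro SUP_cong) auto
  also have "\<dots> = N +> (c \<odot> x)"
    using N.a_rcos_self[OF x] by (subst UN_constant) auto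
  finally show ?thesis
    by (simp add: quot_alg_def ring.defs module.defs)
qed

lemma quot_abelian_group: "abelian_group (quot_alg M N)"
proof (rule abelian_groupI)
  have 0: "\<zero>\<^bsub>quot_alg M N\<^esub> = N +> \<zero>"
    using a_coset_add_zero[of N] subspaceD(1)[OF N] by (simp add: quot_simps)
  show "\<zero>\<^bsub>quot_alg M N\<^esub> \<in> carrier (quot_alg M N)"
    unfolding 0 by (auto simp: quot_simps(1))
  fix Y assume "Y \<in> carrier (quot_alg M N)"
  then obtain y where y: "Y = N +> y" "y \<in> carrier M" by (auto simp: quot_simps(1))
  show "\<zero>\<^bsub>quot_alg M N\<^esub> \<oplus>\<^bsub>quot_alg M N\<^esub> Y = Y"
    unfolding 0 using y by (simp add: quot_add)
  have "N +> (\<ominus> y) \<in> carrier (quot_alg M N)" using y by (auto simp: quot_simps(1))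
  moreover have "(N +> (\<ominus> y)) \<oplus>\<^bsub>quot_alg M N\<^esub> Y = \<zero>\<^bsub>quot_alg M N\<^esub>"
    unfolding 0 using y by (simp add: quot_add l_neg)
  ultimately show "\<exists>Z\<in>carrier (quot_alg M N). Z \<oplus>\<^bsub>quot_alg M N\<^esub> Y = \<zero>\<^bsub>quot_alg M N\<^esub>" by blast
  fix Z assume "Z \<in> carrier (quot_alg M N)"
  then obtain z where z: "Z = N +> z" "z \<in> carrier M" by (auto simp: quot_simps(1))
  show "Y \<oplus>\<^bsub>quot_alg M N\<^esub> Z \<in> carrier (quot_alg M N)"
    using y z by (auto simp: quot_add quot_simps(1))
  show "Y \<oplus>\<^bsub>quot_alg M N\<^esub> Z = Z \<oplus>\<^bsub>quot_alg M N\<^esub> Y"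
    using y z by (simp add: quot_add a_comm)
  fix W assume "W \<in> carrier (quot_alg M N)"
  then obtain x where x: "W = N +> x" "x \<in> carrier M" by (auto simp: quot_simps(1))
  show "Y \<oplus>\<^bsub>quot_alg M N\<^esub> Z \<oplus>\<^bsub>quot_alg M N\<^esub> W = Y \<oplus>\<^bsub>quot_alg M N\<^esub> (Z \<oplus>\<^bsub>quot_alg M N\<^esub> W)"
    using x y z by (simp add: quot_add a_assoc)
qed

lemma quot_module: "module base_field (quot_alg M N)"
proof (rule moduleI)
  show "cring (base_field :: 'f ring)" using vs_module by (rule Module.module.axioms)
  show "abelian_group (quot_alg M N)" by (rule quot_abelian_group)
  fix a b :: 'f and Y assume "Y \<in> carrier (quot_alg M N)"
  then obtain y where y: "Y = N +> y" "y \<in> carrier M" by (auto simp: quot_simps(1))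
  show "a \<odot>\<^bsub>quot_alg M N\<^esub> Y \<in> carrier (quot_alg M N)"
    using y by (auto simp: quot_simps(1) quot_smult)
  show "\<one>\<^bsub>base_field\<^esub> \<odot>\<^bsub>quot_alg M N\<^esub> Y = Y"
    using y by (simp add: quot_smult)
  show "(a \<oplus>\<^bsub>base_field\<^esub> b) \<odot>\<^bsub>quot_alg M N\<^esub> Y = a \<odot>\<^bsub>quot_alg M N\<^esub> Y \<oplus>\<^bsub>quot_alg M N\<^esub> b \<odot>\<^bsub>quot_alg M N\<^esub> Y"
    using y by (simp add: quot_smult quot_add smult_add_left)
  show "(a \<otimes>\<^bsub>base_field\<^esub> b) \<odot>\<^bsub>quot_alg M N\<^esub> Y = a \<odot>\<^bsub>quot_alg M N\<^esub> (b \<odot>\<^bsub>quot_alg M N\<^esub> Y)"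
    using y by (simp add: quot_smult smult_smult)
  fix Z assume "Z \<in> carrier (quot_alg M N)"
  then obtain z where z: "Z = N +> z" "z \<in> carrier M" by (auto simp: quot_simps(1))
  show "a \<odot>\<^bsub>quot_alg M N\<^esub> (Y \<oplus>\<^bsub>quot_alg M N\<^esub> Z) = a \<odot>\<^bsub>quot_alg M N\<^esub> Y \<oplus>\<^bsub>quot_alg M N\<^esub> a \<odot>\<^bsub>quot_alg M N\<^esub> Z"
    using y z by (simp add: quot_smult quot_add smult_add_right)
qed

end

end

section \<open>Algebras and their subalgebras\<close>

text \<open>
  An associative unital algebra over the field \<open>'f\<close>, as a context for calculations.
\<close>

locale falg =
  fixes A :: "('f::field, 'a) module" (structure)
  assumes F_algebra: "F_algebra A"

sublocale falg \<subseteq> ring A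
  using F_algebra by (simp add: F_algebra_def)

sublocale falg \<subseteq> vspace A
  using F_algebra by (intro vspaceI) (simp add: F_algebra_def)

context falg
begin

lemma smult_mult_left: "x \<in> carrier A \<Longrightarrow> y \<in> carrier A \<Longrightarrow> (c \<odot> x) \<otimes> y = c \<odot> (x \<otimes> y)"
  using F_algebra by (simp add: F_algebra_def)

lemma smult_mult_right: "x \<in> carrier A \<Longrightarrow> y \<in> carrier A \<Longrightarrow> x \<otimes> (c \<odot> y) = c \<odot> (x \<otimes> y)"
  using F_algebra by (simp add: F_algebra_def)

lemma unital_subalgI:
  assumes "B \<subseteq> carrier A" "\<one> \<in> B" "\<And>x y. x \<in> B \<Longrightarrow> y \<in> B \<Longrightarrow> x \<oplus> y \<in> B"
    "\<And>x y. x \<in> B \<Longrightarrow> y \<in> B \<Longrightarrow> x \<otimes> y \<in> B" "\<And>c x. x \<in> B \<Longrightarrow> c \<odot> x \<in> B"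
  shows "unital_subalg B A"
  unfolding unital_subalg_def
proof
  have "\<zero> \<in> B" using assms(1) assms(2) assms(5)[of \<one> 0] by auto
  then show s: "submodule B base_field A" by (intro subspaceI) (use assms in auto)
  show "subring B A"
    by (rule subringI) (use assms subspaceD(5)[OF s] in auto)
qed

lemma unital_subalgD:
  assumes "unital_subalg B A"
  shows "submodule B base_field A" "B \<subseteq> carrier A" "\<one> \<in> B" "\<zero> \<in> B"
    "x \<in> B \<Longrightarrow> y \<in> B \<Longrightarrow> x \<oplus> y \<in> B"
    "x \<in> B \<Longrightarrow> y \<in> B \<Longrightarrow> x \<otimes> y \<in> B" "x \<in> B \<Longrightarrow> c \<odot> x \<in> B"
proof -
  show s: "submodule B base_field A" using assms by (simp add: unital_subalg_def)
  show "B \<subseteq> carrier A" "\<zero> \<in> B" "x \<in> B \<Longrightarrow> y \<in> B \<Longrightarrow> x \<oplus> y \<in> B" "x \<in> B \<Longrightarrow> c \<odot> x \<in> B"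
    by (simp_all add: subspaceD[OF s])
  have "subring B A" using assms by (simp add: unital_subalg_def)
  then show "\<one> \<in> B" "x \<in> B \<Longrightarrow> y \<in> B \<Longrightarrow> x \<otimes> y \<in> B"
    by (simp_all add: subringE)
qed

lemma subalg_gen_incl: "S \<subseteq> subalg_gen A S"
  by (auto simp: subalg_gen_def)

lemma subalg_gen_least: "unital_subalg B A \<Longrightarrow> S \<subseteq> B \<Longrightarrow> subalg_gen A S \<subseteq> B"
  by (auto simp: subalg_gen_def)

lemma unital_subalg_carrier: "unital_subalg (carrier A) A"
  by (rule unital_subalgI) auto

lemma unital_subalg_gen: "S \<subseteq> carrier A \<Longrightarrow> unital_subalg (subalg_gen A S) A"
  using subalg_gen_least[OF unital_subalg_carrier, of S]
  by (intro unital_subalgI) (auto simp: subalg_gen_def unital_subalgD)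

lemma unital_subalg_span:
  assumes P: "P \<subseteq> carrier A" "\<one> \<in> P" "\<And>x y. x \<in> P \<Longrightarrow> y \<in> P \<Longrightarrow> x \<otimes> y \<in> P"
  shows "unital_subalg (lin_span A P) A"
proof (rule unital_subalgI)
  note sp = lin_span_subspace[OF P(1)]
  note D = subspaceD[OF sp]
  have 1: "x \<otimes> y \<in> lin_span A P" if "x \<in> P" "y \<in> lin_span A P" for x y
    using that(2) P(1)
  proof (induction rule: lin_span_induct)
    case (base y) then show ?case using P(3)[OF that(1)] lin_span_incl by auto
  next
    case zero then show ?case using that P D by (metis r_null subsetD)
  next
    case (add y z)
    then have "x \<in> carrier A" "y \<in> carrier A" "z \<in> carrier A" using P that D(1) by auto
    then show ?case using D(3)[OF add(3,4)] by (simp add: r_distr)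
  next
    case (smult c y)
    then have "x \<in> carrier A" "y \<in> carrier A" using P that D(1) by auto
    then show ?case using D(4)[OF smult(2)] by (simp add: smult_mult_right)
  qed
  show "x \<otimes> y \<in> lin_span A P" if "x \<in> lin_span A P" and y: "y \<in> lin_span A P" for x y
    using that(1) P(1)
  proof (induction rule: lin_span_induct)
    case (base y) then show ?case using 1 y by auto
  next
    case zero then show ?case using y P D by (metis l_null subsetD)
  next
    case (add x z)
    then have "x \<in> carrier A" "y \<in> carrier A" "z \<in> carrier A" using P y D(1) by auto
    then show ?case using D(3)[OF add(3,4)] by (simp add: l_distr)
  next
    case (smult c x)
    then have "x \<in> carrier A" "y \<in> carrier A" using P y D(1) by auto
    then show ?case using D(4)[OF smult(2)] by (simp add: smult_mult_left)
  qed
  show "\<one> \<in> lin_span A P" using P(2) lin_span_incl by auto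
qed (use subspaceD[OF lin_span_subspace[OF P(1)]] in auto)

text \<open>
  If the generators lie in a multiplicative submonoid \<open>P\<close> of the subalgebra that they generate, then that subalgebra is the linear span of \<open>P\<close>.
\<close>

lemma subalg_gen_eq_span:
  assumes "S \<subseteq> P" "P \<subseteq> subalg_gen A S" "P \<subseteq> carrier A" "\<one> \<in> P"
    "\<And>x y. x \<in> P \<Longrightarrow> y \<in> P \<Longrightarrow> x \<otimes> y \<in> P"
  shows "subalg_gen A S = lin_span A P"
proof
  show "subalg_gen A S \<subseteq> lin_span A P"
    by (rule subalg_gen_least[OF unital_subalg_span[OF assms(3-5)] order.trans[OF assms(1) lin_span_incl]])
  have "unital_subalg (subalg_gen A S) A"
    by (rule unital_subalg_gen) (use assms in auto)
  then show "lin_span A P \<subseteq> subalg_gen A S"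
    using lin_span_least[OF unital_subalgD(1) assms(2)] by auto
qed

end

section \<open>Triangular decompositions from bases\<close>

lemma free_vs_simps [simp]:
  "carrier (free_vs S) = {p. Poly_Mapping.keys p \<subseteq> S}"
  "x \<oplus>\<^bsub>free_vs S\<^esub> y = x + y" "\<zero>\<^bsub>free_vs S\<^esub> = 0" "c \<odot>\<^bsub>free_vs S\<^esub> x = Poly_Mapping.map ((*) c) x"
  by (simp_all add: free_vs_def)

lemma free_vs_abelian_group: "abelian_group (free_vs S :: ('f::field, 'u \<Rightarrow>\<^sub>0 'f) module)"
proof (rule abelian_groupI)
  fix p :: "'u \<Rightarrow>\<^sub>0 'f" assume "p \<in> carrier (free_vs S)"
  then show "\<exists>q\<in>carrier (free_vs S). q \<oplus>\<^bsub>free_vs S\<^esub> p = \<zero>\<^bsub>free_vs S\<^esub>"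
    by (intro bexI[of _ "- p"]) auto
qed (auto simp: algebra_simps dest: subsetD[OF keys_add])

lemma free_vs_vspace: "vspace (free_vs S :: ('f::field, 'u \<Rightarrow>\<^sub>0 'f) module)"
proof (rule vspaceI, rule moduleI)
  show "cring (base_field :: 'f ring)" by (rule cring_from_type_algebra)
  show "abelian_group (free_vs S :: ('f, 'u \<Rightarrow>\<^sub>0 'f) module)" by (rule free_vs_abelian_group)
qed (auto simp: lookup_add algebra_simps map_mult_add intro!: poly_mapping_eqI dest: subsetD[OF keys_map_mult])

lemma free_vs_uminus: "p \<in> carrier (free_vs S) \<Longrightarrow> \<ominus>\<^bsub>free_vs S\<^esub> p = - p"
  for p :: "'u \<Rightarrow>\<^sub>0 'f::field"
  by (rule abelian_group.minus_equality[OF free_vs_abelian_group]) auto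

lemma free_vs_minus: "p \<in> carrier (free_vs S) \<Longrightarrow> q \<in> carrier (free_vs S) \<Longrightarrow> p \<ominus>\<^bsub>free_vs S\<^esub> q = p - q"
  for p :: "'u \<Rightarrow>\<^sub>0 'f::field"
  by (simp add: a_minus_def free_vs_uminus)


lemma poly_mapping_sum_singles:
  "p = (\<Sum>u\<in>Poly_Mapping.keys p. Poly_Mapping.single u (Poly_Mapping.lookup p u))"
proof (rule poly_mapping_eqI)
  fix k
  have "(\<Sum>u\<in>Poly_Mapping.keys p. Poly_Mapping.lookup (Poly_Mapping.single u (Poly_Mapping.lookup p u)) k)
      = (\<Sum>u\<in>Poly_Mapping.keys p. if u = k then Poly_Mapping.lookup p u else 0)"
    by (rule sum.cong) (auto simp: lookup_single when_def)
  also have "\<dots> = Poly_Mapping.lookup p k" by (simp add: sum.delta in_keys_iff)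
  finally show "Poly_Mapping.lookup p k
      = Poly_Mapping.lookup (\<Sum>u\<in>Poly_Mapping.keys p. Poly_Mapping.single u (Poly_Mapping.lookup p u)) k"
    by (simp add: lookup_sum)
qed

lemma sum_in_subspace:
  assumes "0 \<in> R" "\<And>x y. x \<in> R \<Longrightarrow> y \<in> R \<Longrightarrow> x + y \<in> R" "\<And>i. i \<in> I \<Longrightarrow> f i \<in> R"
  shows "sum f I \<in> R"
  using assms(3) by (induction I rule: infinite_finite_induct) (use assms(1,2) in auto)

lemma alg_homD:
  assumes "\<phi> \<in> alg_hom A B"
  shows "x \<in> carrier A \<Longrightarrow> \<phi> x \<in> carrier B"
    "x \<in> carrier A \<Longrightarrow> y \<in> carrier A \<Longrightarrow> \<phi> (x \<oplus>\<^bsub>A\<^esub> y) = \<phi> x \<oplus>\<^bsub>B\<^esub> \<phi> y"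
    "x \<in> carrier A \<Longrightarrow> y \<in> carrier A \<Longrightarrow> \<phi> (x \<otimes>\<^bsub>A\<^esub> y) = \<phi> x \<otimes>\<^bsub>B\<^esub> \<phi> y"
    "\<phi> \<one>\<^bsub>A\<^esub> = \<one>\<^bsub>B\<^esub>" "x \<in> carrier A \<Longrightarrow> \<phi> (c \<odot>\<^bsub>A\<^esub> x) = c \<odot>\<^bsub>B\<^esub> \<phi> x"
  using assms by (auto simp: alg_hom_def ring_hom_def)

text \<open>
  To show that a set contains all defining relations of a triple tensor product, it suffices to treat
  additivity and homogeneity in each of the three arguments.
\<close>

lemma tensor3_rels_subset:
  fixes U :: "('f::field, 'u) module" and V :: "('f, 'v) module" and W :: "('f, 'w) module"
  defines "b \<equiv> (\<lambda>u v w. Poly_Mapping.single (u, v, w) (1::'f))"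
  assumes
    "\<And>u u' v w. u \<in> carrier U \<Longrightarrow> u' \<in> carrier U \<Longrightarrow> v \<in> carrier V \<Longrightarrow> w \<in> carrier W \<Longrightarrow>
      b (u \<oplus>\<^bsub>U\<^esub> u') v w - (b u v w + b u' v w) \<in> K"
    "\<And>u v v' w. u \<in> carrier U \<Longrightarrow> v \<in> carrier V \<Longrightarrow> v' \<in> carrier V \<Longrightarrow> w \<in> carrier W \<Longrightarrow>
      b u (v \<oplus>\<^bsub>V\<^esub> v') w - (b u v w + b u v' w) \<in> K"
    "\<And>u v w w'. u \<in> carrier U \<Longrightarrow> v \<in> carrier V \<Longrightarrow> w \<in> carrier W \<Longrightarrow> w' \<in> carrier W \<Longrightarrow>
      b u v (w \<oplus>\<^bsub>W\<^esub> w') - (b u v w + b u v w') \<in> K"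
    "\<And>c u v w. u \<in> carrier U \<Longrightarrow> v \<in> carrier V \<Longrightarrow> w \<in> carrier W \<Longrightarrow>
      b (c \<odot>\<^bsub>U\<^esub> u) v w - Poly_Mapping.single (u, v, w) c \<in> K"
    "\<And>c u v w. u \<in> carrier U \<Longrightarrow> v \<in> carrier V \<Longrightarrow> w \<in> carrier W \<Longrightarrow>
      b u (c \<odot>\<^bsub>V\<^esub> v) w - Poly_Mapping.single (u, v, w) c \<in> K"
    "\<And>c u v w. u \<in> carrier U \<Longrightarrow> v \<in> carrier V \<Longrightarrow> w \<in> carrier W \<Longrightarrow>
      b u v (c \<odot>\<^bsub>W\<^esub> w) - Poly_Mapping.single (u, v, w) c \<in> K"
  shows "tensor3_rels U V W \<subseteq> K"
  using assms(2-) unfolding tensor3_rels_def Let_def b_def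
  by (intro Un_least subsetI; elim CollectE exE conjE; simp only:)

lemma tensor3_relsI:
  fixes U :: "('f::field, 'u) module" and V :: "('f, 'v) module" and W :: "('f, 'w) module"
  defines "b \<equiv> (\<lambda>u v w. Poly_Mapping.single (u, v, w) (1::'f))"
  assumes "u \<in> carrier U" "v \<in> carrier V" "w \<in> carrier W"
  shows tensor3_rels_addU: "u' \<in> carrier U \<Longrightarrow> b (u \<oplus>\<^bsub>U\<^esub> u') v w - (b u v w + b u' v w) \<in> tensor3_rels U V W"
    and tensor3_rels_addV: "v' \<in> carrier V \<Longrightarrow> b u (v \<oplus>\<^bsub>V\<^esub> v') w - (b u v w + b u v' w) \<in> tensor3_rels U V W"
    and tensor3_rels_addW: "w' \<in> carrier W \<Longrightarrow> b u v (w \<oplus>\<^bsub>W\<^esub> w') - (b u v w + b u v w') \<in> tensor3_rels U V W"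
    and tensor3_rels_smultU: "b (c \<odot>\<^bsub>U\<^esub> u) v w - Poly_Mapping.single (u, v, w) c \<in> tensor3_rels U V W"
    and tensor3_rels_smultV: "b u (c \<odot>\<^bsub>V\<^esub> v) w - Poly_Mapping.single (u, v, w) c \<in> tensor3_rels U V W"
    and tensor3_rels_smultW: "b u v (c \<odot>\<^bsub>W\<^esub> w) - Poly_Mapping.single (u, v, w) c \<in> tensor3_rels U V W"
proof -
  note defs = tensor3_rels_def Let_def b_def
  show "b (u \<oplus>\<^bsub>U\<^esub> u') v w - (b u v w + b u' v w) \<in> tensor3_rels U V W" if "u' \<in> carrier U"
    unfolding defs
    by (intro UnI1, rule CollectI, rule exI[of _ u], rule exI[of _ u'], rule exI[of _ v], rule exI[of _ w])
      (use assms(2-) that in auto)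
  show "b u (v \<oplus>\<^bsub>V\<^esub> v') w - (b u v w + b u v' w) \<in> tensor3_rels U V W" if "v' \<in> carrier V"
    unfolding defs using assms(2-) that by blast
  show "b u v (w \<oplus>\<^bsub>W\<^esub> w') - (b u v w + b u v w') \<in> tensor3_rels U V W" if "w' \<in> carrier W"
    unfolding defs using assms(2-) that by blast
  show "b (c \<odot>\<^bsub>U\<^esub> u) v w - Poly_Mapping.single (u, v, w) c \<in> tensor3_rels U V W"
    unfolding defs using assms(2-) by blast
  show "b u (c \<odot>\<^bsub>V\<^esub> v) w - Poly_Mapping.single (u, v, w) c \<in> tensor3_rels U V W"
    unfolding defs using assms(2-) by blast
  show "b u v (c \<odot>\<^bsub>W\<^esub> w) - Poly_Mapping.single (u, v, w) c \<in> tensor3_rels U V W"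
    unfolding defs using assms(2-) by blast
qed

text \<open>
  Families \<open>N\<close> and \<open>P\<close> in an algebra such that the products \<open>N i \<cdot> h \<cdot> P j\<close> with \<open>h\<close> in \<open>H0\<close> span the algebra
  and are independent over \<open>H0\<close>. The vector space \<open>H0\<close> is not assumed to have a basis.
\<close>

locale triangular_basis = falg A + H0: falg H0
  for A :: "('f::field, 'a) module" (structure) and H0 :: "('f, 'h) module" +
  fixes \<iota> :: "'h \<Rightarrow> 'a" and N :: "'i \<Rightarrow> 'a" and I :: "'i set" and P :: "'j \<Rightarrow> 'a" and J :: "'j set"
  assumes hom: "\<iota> \<in> alg_hom H0 A"
    and N_closed: "i \<in> I \<Longrightarrow> N i \<in> carrier A"
    and P_closed: "j \<in> J \<Longrightarrow> P j \<in> carrier A"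
    and span: "carrier A \<subseteq> lin_span A {N i \<otimes> \<iota> h \<otimes> P j | i h j. i \<in> I \<and> h \<in> carrier H0 \<and> j \<in> J}"
    and indep: "\<And>F h. finite F \<Longrightarrow> F \<subseteq> I \<times> J \<Longrightarrow> (\<And>u. u \<in> F \<Longrightarrow> h u \<in> carrier H0) \<Longrightarrow>
      (\<Oplus>u\<in>F. N (fst u) \<otimes> \<iota> (h u) \<otimes> P (snd u)) = \<zero> \<Longrightarrow> \<forall>u\<in>F. h u = \<zero>\<^bsub>H0\<^esub>"
begin

text \<open>
  \<open>Fr\<close> is the vector space of formal sums of triples, \<open>Rl\<close> the subspace of relations, so that the
  quotient of \<open>Fr\<close> by \<open>Rl\<close> is the tensor product, and \<open>mu\<close> the multiplication of formal sums. The task is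
  to show that \<open>Rl\<close> is the kernel of \<open>mu\<close>.
\<close>

abbreviation "Bm \<equiv> lin_span A (N ` I)"
abbreviation "Bp \<equiv> lin_span A (P ` J)"
abbreviation "Fr \<equiv> free_vs (Bm \<times> carrier H0 \<times> Bp) :: ('f, 'a \<times> 'h \<times> 'a \<Rightarrow>\<^sub>0 'f) module"
abbreviation "Rl \<equiv> lin_span Fr (tensor3_rels (A\<lparr>carrier := Bm\<rparr>) H0 (A\<lparr>carrier := Bp\<rparr>))"
abbreviation "mu \<equiv> lin_ext A (\<lambda>(b, h, b'). b \<otimes> \<iota> h \<otimes> b')"

lemma subspaces: "submodule Bm base_field A" "submodule Bp base_field A"
  by (rule lin_span_subspace; use N_closed P_closed in auto)+

lemmas BmD = subspaceD[OF subspaces(1)]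
lemmas BpD = subspaceD[OF subspaces(2)]

lemma Bm_carrier [simp]: "b \<in> Bm \<Longrightarrow> b \<in> carrier A" and Bp_carrier [simp]: "b' \<in> Bp \<Longrightarrow> b' \<in> carrier A"
  using BmD(1) BpD(1) by auto

lemma \<iota>_closed [simp]: "h \<in> carrier H0 \<Longrightarrow> \<iota> h \<in> carrier A"
  by (rule alg_homD(1)[OF hom])

interpretation Fr: vspace Fr by (rule free_vs_vspace)

lemma mu_closed: "p \<in> carrier Fr \<Longrightarrow> mu p \<in> carrier A"
  by (rule lin_ext_closed) auto

lemma mu_add: "p \<in> carrier Fr \<Longrightarrow> q \<in> carrier Fr \<Longrightarrow> mu (p + q) = mu p \<oplus> mu q"
  by (rule lin_ext_add) auto

lemma mu_smult: "p \<in> carrier Fr \<Longrightarrow> mu (Poly_Mapping.map ((*) c) p) = c \<odot> mu p"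
  by (rule lin_ext_smult) auto

lemma mu_single: "b \<in> Bm \<Longrightarrow> h \<in> carrier H0 \<Longrightarrow> b' \<in> Bp \<Longrightarrow>
    mu (Poly_Mapping.single (b, h, b') c) = c \<odot> (b \<otimes> \<iota> h \<otimes> b')"
  by (subst lin_ext_single) auto

lemma Fr_minus: "p \<in> carrier Fr \<Longrightarrow> q \<in> carrier Fr \<Longrightarrow> p - q \<in> carrier Fr"
  by (auto dest!: subsetD[OF keys_diff])

lemma mu_minus:
  assumes "p \<in> carrier Fr" "q \<in> carrier Fr"
  shows "mu (p - q) = mu p \<ominus> mu q"
proof -
  have "mu p = mu (p - q) \<oplus> mu q"
    using mu_add[OF Fr_minus[OF assms] assms(2)] by simp
  then show ?thesis
    using assms mu_closed Fr_minus by (simp add: a_minus_def a_assoc r_neg)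
qed

lemma single_Fr: "b \<in> Bm \<Longrightarrow> h \<in> carrier H0 \<Longrightarrow> b' \<in> Bp \<Longrightarrow> Poly_Mapping.single (b, h, b') c \<in> carrier Fr"
  by simp

lemma Fr_add: "p \<in> carrier Fr \<Longrightarrow> q \<in> carrier Fr \<Longrightarrow> p + q \<in> carrier Fr"
  using Fr.a_closed by simp

lemma rels_kernel: "tensor3_rels (A\<lparr>carrier := Bm\<rparr>) H0 (A\<lparr>carrier := Bp\<rparr>) \<subseteq> {p \<in> carrier Fr. mu p = \<zero>}"
proof (rule tensor3_rels_subset, goal_cases)
  case (1 u u' v w) then show ?case
    using BmD(3) by (simp add: single_Fr Fr_minus Fr_add mu_minus mu_add mu_single l_distr a_minus_def r_neg
        del: free_vs_simps)
next
  case (2 u v v' w) then show ?case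
    by (simp add: single_Fr Fr_minus Fr_add mu_minus mu_add mu_single l_distr r_distr a_minus_def r_neg alg_homD[OF hom]
        del: free_vs_simps)
next
  case (3 u v w w') then show ?case
    using BpD(3) by (simp add: single_Fr Fr_minus Fr_add mu_minus mu_add mu_single l_distr r_distr a_minus_def r_neg
        del: free_vs_simps)
next
  case (4 c u v w) then show ?case
    using BmD(4) by (simp add: single_Fr Fr_minus Fr_add mu_minus mu_add mu_single smult_mult_left a_minus_def r_neg
        del: free_vs_simps)
next
  case (5 c u v w) then show ?case
    by (simp add: single_Fr Fr_minus Fr_add mu_minus mu_add mu_single smult_mult_left smult_mult_right a_minus_def r_neg
        alg_homD[OF hom] del: free_vs_simps)
next
  case (6 c u v w) then show ?case
    using BpD(4) by (simp add: single_Fr Fr_minus Fr_add mu_minus mu_add mu_single smult_mult_right a_minus_def r_neg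
        del: free_vs_simps)
qed


lemma rels_Fr: "tensor3_rels (A\<lparr>carrier := Bm\<rparr>) H0 (A\<lparr>carrier := Bp\<rparr>) \<subseteq> carrier Fr"
  using rels_kernel by blast

lemma Rl_subspace: "submodule Rl base_field Fr"
  by (rule Fr.lin_span_subspace[OF rels_Fr])

lemma Rl: "Rl \<subseteq> carrier Fr" "0 \<in> Rl" "x \<in> Rl \<Longrightarrow> y \<in> Rl \<Longrightarrow> x + y \<in> Rl"
    "x \<in> Rl \<Longrightarrow> Poly_Mapping.map ((*) c) x \<in> Rl" "x \<in> Rl \<Longrightarrow> y \<in> Rl \<Longrightarrow> x - y \<in> Rl"
proof -
  note D = Fr.subspaceD[OF Rl_subspace]
  show 1: "Rl \<subseteq> carrier Fr" by (rule D(1))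
  show "0 \<in> Rl" using D(2) unfolding free_vs_simps .
  show "x \<in> Rl \<Longrightarrow> y \<in> Rl \<Longrightarrow> x + y \<in> Rl" using D(3)[of x y] unfolding free_vs_simps .
  show "x \<in> Rl \<Longrightarrow> Poly_Mapping.map ((*) c) x \<in> Rl" using D(4)[of x c] unfolding free_vs_simps .
  show "x - y \<in> Rl" if "x \<in> Rl" "y \<in> Rl"
    using Fr.subspace_minus[OF Rl_subspace that]
    unfolding free_vs_minus[OF subsetD[OF 1 that(1)] subsetD[OF 1 that(2)]] .
qed

lemmas RlI = subsetD[OF vspace.lin_span_incl[OF free_vs_vspace]]

lemma Rl_kernel: "p \<in> Rl \<Longrightarrow> mu p = \<zero>"
proof -
  have "submodule {p \<in> carrier Fr. mu p = \<zero>} base_field Fr"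
    by (rule Fr.subspaceI) (use Fr_add mu_add mu_smult Fr.smult_closed in auto)
  from Fr.lin_span_least[OF this rels_kernel] show "p \<in> Rl \<Longrightarrow> mu p = \<zero>" by blast
qed

text \<open>
  Injectivity: modulo the relations, every formal sum is a sum of triples \<open>(N i, h i j, P j)\<close> over finitely
  many pairs \<open>(i, j)\<close>, with a single \<open>h i j\<close> for each pair. For such sums the independence hypothesis
  applies directly.
\<close>

abbreviation "pure u h \<equiv> Poly_Mapping.single (N (fst u), h, P (snd u)) (1::'f)"

lemma basis_mem: "i \<in> I \<Longrightarrow> N i \<in> Bm" "j \<in> J \<Longrightarrow> P j \<in> Bp"
  using lin_span_incl by blast+

lemma pure_zero: "b \<in> Bm \<Longrightarrow> b' \<in> Bp \<Longrightarrow> Poly_Mapping.single (b, \<zero>\<^bsub>H0\<^esub>, b') 1 \<in> Rl"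
  using RlI[OF tensor3_rels_smultV, of b "A\<lparr>carrier := Bm\<rparr>" "\<zero>\<^bsub>H0\<^esub>" H0 b' "A\<lparr>carrier := Bp\<rparr>" 0]
  by simp

text \<open>
  The formal sums that can be brought to this form with the set \<open>F\<close> of pairs.
\<close>

definition reduced :: "('i \<times> 'j) set \<Rightarrow> ('a \<times> 'h \<times> 'a \<Rightarrow>\<^sub>0 'f) set" where
  "reduced F = {p \<in> carrier Fr. \<exists>h\<in>F \<rightarrow> carrier H0. p - (\<Sum>u\<in>F. pure u (h u)) \<in> Rl}"

text \<open>
  The set of pairs can be enlarged, as triples with middle entry \<open>0\<close> are relations.
\<close>

lemma reduced_mono:
  assumes "p \<in> reduced F" "F \<subseteq> F'" "F' \<subseteq> I \<times> J" "finite F'"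
  shows "p \<in> reduced F'"
proof -
  from assms obtain h where h: "h \<in> F \<rightarrow> carrier H0" "p - (\<Sum>u\<in>F. pure u (h u)) \<in> Rl" and p: "p \<in> carrier Fr"
    by (auto simp: reduced_def)
  define h' where "h' u = (if u \<in> F then h u else \<zero>\<^bsub>H0\<^esub>)" for u
  have "(\<Sum>u\<in>F'. pure u (h' u)) = (\<Sum>u\<in>F. pure u (h' u)) + (\<Sum>u\<in>F'-F. pure u (h' u))"
    using assms by (simp add: sum.subset_diff)
  moreover have "(\<Sum>u\<in>F. pure u (h' u)) = (\<Sum>u\<in>F. pure u (h u))"
    by (rule sum.cong) (auto simp: h'_def)
  moreover have "(\<Sum>u\<in>F'-F. pure u (h' u)) \<in> Rl"
    by (rule sum_in_subspace[OF Rl(2) Rl(3)])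
      (use assms(3) basis_mem in \<open>auto simp: h'_def intro!: pure_zero\<close>)
  ultimately have "p - (\<Sum>u\<in>F'. pure u (h' u)) \<in> Rl"
    using Rl(5)[OF h(2), of "\<Sum>u\<in>F'-F. pure u (h' u)"] by (simp add: diff_diff_eq)
  moreover have "h' \<in> F' \<rightarrow> carrier H0" using h(1) by (auto simp: h'_def)
  ultimately show ?thesis using p by (auto simp: reduced_def)
qed

lemma reduced_add:
  assumes "p \<in> reduced F" "q \<in> reduced F" "F \<subseteq> I \<times> J"
  shows "p + q \<in> reduced F"
proof -
  from assms obtain h where h: "h \<in> F \<rightarrow> carrier H0" "p - (\<Sum>u\<in>F. pure u (h u)) \<in> Rl" and p: "p \<in> carrier Fr"
    by (auto simp: reduced_def)
  from assms obtain g where g: "g \<in> F \<rightarrow> carrier H0" "q - (\<Sum>u\<in>F. pure u (g u)) \<in> Rl" and q: "q \<in> carrier Fr"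
    by (auto simp: reduced_def)
  let ?k = "\<lambda>u. h u \<oplus>\<^bsub>H0\<^esub> g u"
  have "(\<Sum>u\<in>F. pure u (?k u) - (pure u (h u) + pure u (g u))) \<in> Rl"
  proof (rule sum_in_subspace[OF Rl(2) Rl(3)])
    fix u assume "u \<in> F"
    then show "pure u (?k u) - (pure u (h u) + pure u (g u)) \<in> Rl"
      using h(1) g(1) assms(3) basis_mem by (intro RlI[OF tensor3_rels_addV]) auto
  qed
  then have "(p - (\<Sum>u\<in>F. pure u (h u))) + (q - (\<Sum>u\<in>F. pure u (g u)))
      - (\<Sum>u\<in>F. pure u (?k u) - (pure u (h u) + pure u (g u))) \<in> Rl"
    by (rule Rl(5)[OF Rl(3)[OF h(2) g(2)]])
  then have "(p + q) - (\<Sum>u\<in>F. pure u (?k u)) \<in> Rl"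
    by (simp add: sum_subtractf sum.distrib algebra_simps)
  then show ?thesis using h(1) g(1) Fr_add[OF p q] by (auto simp: reduced_def intro!: bexI[of _ ?k])
qed

lemma map_mult_minus: "Poly_Mapping.map ((*) c) (x - y) = Poly_Mapping.map ((*) c) x - Poly_Mapping.map ((*) c) y"
  for c :: 'f
  by (rule poly_mapping_eqI) (simp add: lookup_minus algebra_simps)

lemma map_mult_sum: "Poly_Mapping.map ((*) c) (sum f F) = (\<Sum>u\<in>F. Poly_Mapping.map ((*) c) (f u))"
  for c :: 'f
  by (induction F rule: infinite_finite_induct) (auto simp: map_mult_add intro: poly_mapping_eqI)

lemma reduced_smult:
  assumes "p \<in> reduced F" "F \<subseteq> I \<times> J"
  shows "Poly_Mapping.map ((*) c) p \<in> reduced F"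
proof -
  from assms obtain h where h: "h \<in> F \<rightarrow> carrier H0" "p - (\<Sum>u\<in>F. pure u (h u)) \<in> Rl" and p: "p \<in> carrier Fr"
    by (auto simp: reduced_def)
  let ?k = "\<lambda>u. c \<odot>\<^bsub>H0\<^esub> h u"
  have "(\<Sum>u\<in>F. pure u (?k u) - Poly_Mapping.map ((*) c) (pure u (h u))) \<in> Rl"
  proof (rule sum_in_subspace[OF Rl(2) Rl(3)])
    fix u assume "u \<in> F"
    then show "pure u (?k u) - Poly_Mapping.map ((*) c) (pure u (h u)) \<in> Rl"
      using h(1) assms(2) basis_mem by (auto simp: single_smult intro!: RlI[OF tensor3_rels_smultV])
  qed
  then have "Poly_Mapping.map ((*) c) (p - (\<Sum>u\<in>F. pure u (h u)))
      - (\<Sum>u\<in>F. pure u (?k u) - Poly_Mapping.map ((*) c) (pure u (h u))) \<in> Rl"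
    by (rule Rl(5)[OF Rl(4)[OF h(2)]])
  then have "Poly_Mapping.map ((*) c) p - (\<Sum>u\<in>F. pure u (?k u)) \<in> Rl"
    by (simp add: sum_subtractf map_mult_minus map_mult_sum)
  moreover have "Poly_Mapping.map ((*) c) p \<in> carrier Fr"
    using Fr.smult_closed[OF p] by simp
  ultimately show ?thesis using h(1) by (auto simp: reduced_def intro!: bexI[of _ ?k])
qed

lemma reduced_cong:
  assumes "p \<in> reduced F" "q \<in> carrier Fr" "q - p \<in> Rl"
  shows "q \<in> reduced F"
proof -
  from assms(1) obtain h where h: "h \<in> F \<rightarrow> carrier H0" "p - (\<Sum>u\<in>F. pure u (h u)) \<in> Rl"
    unfolding reduced_def by blast
  have "q - (\<Sum>u\<in>F. pure u (h u)) \<in> Rl" using Rl(3)[OF assms(3) h(2)] by simp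
  with h(1) assms(2) show ?thesis unfolding reduced_def by blast
qed

text \<open>
  The formal sums that can be brought to this form with some finite set of pairs.
\<close>

definition Red :: "('a \<times> 'h \<times> 'a \<Rightarrow>\<^sub>0 'f) set" where
  "Red = (\<Union>F\<in>{F. finite F \<and> F \<subseteq> I \<times> J}. reduced F)"

lemma Red_add: "p \<in> Red \<Longrightarrow> q \<in> Red \<Longrightarrow> p + q \<in> Red"
proof -
  assume "p \<in> Red" "q \<in> Red"
  then obtain F F' where F: "finite F" "F \<subseteq> I \<times> J" "p \<in> reduced F" "finite F'" "F' \<subseteq> I \<times> J" "q \<in> reduced F'"
    by (auto simp: Red_def)
  then have "p + q \<in> reduced (F \<union> F')"
    by (intro reduced_add) (auto intro: reduced_mono)
  then show "p + q \<in> Red" using F by (auto simp: Red_def)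
qed

lemma Red_smult: "p \<in> Red \<Longrightarrow> Poly_Mapping.map ((*) c) p \<in> Red"
  by (auto simp: Red_def intro: reduced_smult)

lemma Red_cong: "p \<in> Red \<Longrightarrow> q \<in> carrier Fr \<Longrightarrow> q - p \<in> Rl \<Longrightarrow> q \<in> Red"
  unfolding Red_def by (elim UN_E, rule UN_I, assumption, rule reduced_cong)

lemma Red_pure:
  assumes "i \<in> I" "j \<in> J" "h \<in> carrier H0"
  shows "Poly_Mapping.single (N i, h, P j) 1 \<in> Red"
proof -
  have "Poly_Mapping.single (N i, h, P j) 1 - (\<Sum>u\<in>{(i, j)}. pure u h) \<in> Rl"
    using Rl(2) by simp
  moreover have "Poly_Mapping.single (N i, h, P j) 1 \<in> carrier Fr"
    by (rule single_Fr) (use assms basis_mem in blast)+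
  moreover have "(\<lambda>_. h) \<in> {(i, j)} \<rightarrow> carrier H0" using assms(3) by blast
  ultimately have "Poly_Mapping.single (N i, h, P j) 1 \<in> reduced {(i, j)}"
    unfolding reduced_def by (intro CollectI conjI bexI[of _ "\<lambda>_. h"])
  moreover have "finite {(i, j)}" "{(i, j)} \<subseteq> I \<times> J" using assms by auto
  ultimately show ?thesis unfolding Red_def by blast
qed

lemma Red_zero: "0 \<in> Red"
proof -
  have "0 \<in> reduced {}" using Rl(2) unfolding reduced_def by simp
  then show ?thesis unfolding Red_def by blast
qed

lemma Red_left:
  assumes h: "h \<in> carrier H0" and j: "j \<in> J" and b: "b \<in> Bm"
  shows "Poly_Mapping.single (b, h, P j) 1 \<in> Red"
proof -
  have "N ` I \<subseteq> carrier A" using N_closed by auto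
  with b show ?thesis
  proof (induction rule: lin_span_induct)
    case (base x) then show ?case using Red_pure h j by auto
  next
    case zero
    show ?case
      using RlI[OF tensor3_rels_smultU, of \<zero> "A\<lparr>carrier := Bm\<rparr>" h H0 "P j" "A\<lparr>carrier := Bp\<rparr>" 0] h j basis_mem BmD(2)
      by (intro Red_cong[OF Red_zero]) auto
  next
    case (add x y)
    then show ?case
      using RlI[OF tensor3_rels_addU, of x "A\<lparr>carrier := Bm\<rparr>" h H0 "P j" "A\<lparr>carrier := Bp\<rparr>" y] h j basis_mem BmD(3)
      by (intro Red_cong[OF Red_add[OF add(3,4)]]) auto
  next
    case (smult c x)
    then show ?case
      using RlI[OF tensor3_rels_smultU, of x "A\<lparr>carrier := Bm\<rparr>" h H0 "P j" "A\<lparr>carrier := Bp\<rparr>" c] h j basis_mem BmD(4)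
      by (intro Red_cong[OF Red_smult[OF smult(2), of c]]) (auto simp: single_smult)
  qed
qed

lemma Red_right:
  assumes h: "h \<in> carrier H0" and b: "b \<in> Bm" and b': "b' \<in> Bp"
  shows "Poly_Mapping.single (b, h, b') 1 \<in> Red"
proof -
  have "P ` J \<subseteq> carrier A" using P_closed by auto
  with b' show ?thesis
  proof (induction rule: lin_span_induct)
    case (base x) then show ?case using Red_left h b by auto
  next
    case zero
    show ?case
      using RlI[OF tensor3_rels_smultW, of b "A\<lparr>carrier := Bm\<rparr>" h H0 \<zero> "A\<lparr>carrier := Bp\<rparr>" 0] h b BpD(2)
      by (intro Red_cong[OF Red_zero]) auto
  next
    case (add x y)
    then show ?case
      using RlI[OF tensor3_rels_addW, of b "A\<lparr>carrier := Bm\<rparr>" h H0 x "A\<lparr>carrier := Bp\<rparr>" y] h b BpD(3)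
      by (intro Red_cong[OF Red_add[OF add(3,4)]]) auto
  next
    case (smult c x)
    then show ?case
      using RlI[OF tensor3_rels_smultW, of b "A\<lparr>carrier := Bm\<rparr>" h H0 x "A\<lparr>carrier := Bp\<rparr>" c] h b BpD(4)
      by (intro Red_cong[OF Red_smult[OF smult(2), of c]]) (auto simp: single_smult)
  qed
qed

lemma Red_all:
  assumes "p \<in> carrier Fr"
  shows "p \<in> Red"
proof -
  have "p = (\<Sum>u\<in>Poly_Mapping.keys p. Poly_Mapping.single u (Poly_Mapping.lookup p u))"
    by (rule poly_mapping_sum_singles)
  also have "\<dots> \<in> Red"
  proof (rule sum_in_subspace[OF Red_zero Red_add])
    fix u assume "u \<in> Poly_Mapping.keys p"
    with assms have "u \<in> Bm \<times> carrier H0 \<times> Bp" unfolding free_vs_simps by blast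
    then obtain b h b' where u: "u = (b, h, b')" "b \<in> Bm" "h \<in> carrier H0" "b' \<in> Bp" by blast
    show "Poly_Mapping.single u (Poly_Mapping.lookup p u) \<in> Red"
      using Red_smult[OF Red_right[OF u(3,2,4)], of "Poly_Mapping.lookup p u"]
      unfolding u(1) single_smult mult_1_right .
  qed
  finally show ?thesis .
qed

lemma mu_sum:
  assumes "\<And>u. u \<in> F \<Longrightarrow> f u \<in> carrier Fr"
  shows "sum f F \<in> carrier Fr \<and> mu (sum f F) = (\<Oplus>u\<in>F. mu (f u))"
  using assms
proof (induction F rule: infinite_finite_induct)
  case (insert u F)
  have f: "f v \<in> carrier Fr" if "v \<in> insert u F" for v using insert.prems that by blast
  have m: "(\<lambda>v. mu (f v)) \<in> F \<rightarrow> carrier A" by (rule Pi_I, rule mu_closed, rule f) simp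
  have mu: "mu (f u) \<in> carrier A" by (rule mu_closed, rule f) simp
  from insert.IH[OF f] have IH: "sum f F \<in> carrier Fr" "mu (sum f F) = (\<Oplus>v\<in>F. mu (f v))" by blast+
  have "sum f (insert u F) = f u + sum f F" "(\<Oplus>v\<in>insert u F. mu (f v)) = mu (f u) \<oplus> (\<Oplus>v\<in>F. mu (f v))"
    using finsum_insert[OF insert.hyps m mu] sum.insert[OF insert.hyps, of f] by simp_all
  moreover have "f u + sum f F \<in> carrier Fr" "mu (f u + sum f F) = mu (f u) \<oplus> mu (sum f F)"
    using Fr_add[OF f IH(1)] mu_add[OF f IH(1)] by simp_all
  ultimately show ?case unfolding IH(2) by metis
qed (simp_all add: finsum_infinite)

text \<open>
  The kernel of the multiplication map is the space of relations: in reduced form, the image under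
  \<open>mu\<close> vanishes only if all \<open>h i j\<close> do.
\<close>

lemma kernel_mu:
  assumes p: "p \<in> carrier Fr" and 0: "mu p = \<zero>"
  shows "p \<in> Rl"
proof -
  from Red_all[OF p] obtain F h where F: "finite F" "F \<subseteq> I \<times> J" and h: "h \<in> F \<rightarrow> carrier H0"
    and R: "p - (\<Sum>u\<in>F. pure u (h u)) \<in> Rl"
    by (auto simp: Red_def reduced_def)
  have s: "pure u (h u) \<in> carrier Fr" if "u \<in> F" for u
    using that F(2) h basis_mem by (auto intro!: single_Fr)
  note ms = mu_sum[of F "\<lambda>u. pure u (h u)", OF s]
  define q where "q = (\<Sum>u\<in>F. pure u (h u))"
  have q: "q \<in> carrier Fr" and mq: "mu q = (\<Oplus>u\<in>F. mu (pure u (h u)))"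
    using ms unfolding q_def by blast+
  have "mu p \<ominus> mu q = \<zero>"
    using Rl_kernel[OF R[folded q_def]] mu_minus[OF p q] by (rule trans[OF sym, rotated])
  then have "mu p = mu q"
    using r_right_minus_eq[OF mu_closed[OF p] mu_closed[OF q]] by blast
  then have e: "(\<Oplus>u\<in>F. mu (pure u (h u))) = \<zero>" unfolding mq 0 by (rule sym)
  have mem: "N (fst u) \<in> Bm" "h u \<in> carrier H0" "P (snd u) \<in> Bp" if "u \<in> F" for u
    using that F(2) h basis_mem by auto
  have "(\<Oplus>u\<in>F. N (fst u) \<otimes> \<iota> (h u) \<otimes> P (snd u)) = (\<Oplus>u\<in>F. mu (pure u (h u)))"
    by (rule finsum_cong') (use mem in \<open>auto simp: mu_single\<close>)
  with e have z0: "(\<Oplus>u\<in>F. N (fst u) \<otimes> \<iota> (h u) \<otimes> P (snd u)) = \<zero>" by (rule trans[rotated])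
  have z: "\<forall>u\<in>F. h u = \<zero>\<^bsub>H0\<^esub>" by (rule indep[OF F _ z0], rule mem(2))
  have "pure u (h u) \<in> Rl" if "u \<in> F" for u
    using pure_zero[OF mem(1)[OF that] mem(3)[OF that]] z that by simp
  with Rl(2,3) have "(\<Sum>u\<in>F. pure u (h u)) \<in> Rl" by (rule sum_in_subspace)
  with R have "p - (\<Sum>u\<in>F. pure u (h u)) + (\<Sum>u\<in>F. pure u (h u)) \<in> Rl" by (rule Rl(3))
  then show ?thesis by simp
qed

lemma mu_surj: "mu ` carrier Fr = carrier A"
proof
  show sub: "mu ` carrier Fr \<subseteq> carrier A" by (rule image_subsetI[OF mu_closed])
  have "submodule (mu ` carrier Fr) base_field A"
  proof (rule subspaceI)
    show "\<zero> \<in> mu ` carrier Fr" by (rule image_eqI[of _ _ 0]) simp_all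
    show "x \<oplus> y \<in> mu ` carrier Fr" if xy: "x \<in> mu ` carrier Fr" "y \<in> mu ` carrier Fr" for x y
    proof -
      obtain p where "x = mu p" "p \<in> carrier Fr" using xy(1) by (rule imageE)
      moreover obtain q where "y = mu q" "q \<in> carrier Fr" using xy(2) by (rule imageE)
      ultimately show ?thesis using mu_add[of p q] Fr_add[of p q] by (intro image_eqI[of _ _ "p + q"]) simp_all
    qed
    show "c \<odot> x \<in> mu ` carrier Fr" if x: "x \<in> mu ` carrier Fr" for c x
    proof -
      obtain p where p: "x = mu p" "p \<in> carrier Fr" using x by (rule imageE)
      then show ?thesis using mu_smult[OF p(2), of c] Fr.smult_closed[OF p(2), of c]
        by (intro image_eqI[of _ _ "Poly_Mapping.map ((*) c) p"]) simp_all
    qed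
  qed (rule sub)
  moreover have "{N i \<otimes> \<iota> h \<otimes> P j | i h j. i \<in> I \<and> h \<in> carrier H0 \<and> j \<in> J} \<subseteq> mu ` carrier Fr"
  proof clarify
    fix i h j assume "i \<in> I" "h \<in> carrier H0" "j \<in> J"
    then have "N i \<in> Bm" "h \<in> carrier H0" "P j \<in> Bp" using basis_mem by auto
    then show "N i \<otimes> \<iota> h \<otimes> P j \<in> mu ` carrier Fr"
      by (intro image_eqI[of _ _ "Poly_Mapping.single (N i, h, P j) 1"]) (simp_all add: mu_single)
  qed
  ultimately show "carrier A \<subseteq> mu ` carrier Fr"
    using span lin_span_least by blast
qed

theorem triangular_mult_iso:
  "triangular_mult A \<iota> \<in> lin_iso (tensor3 (A\<lparr>carrier := Bm\<rparr>) H0 (A\<lparr>carrier := Bp\<rparr>)) A"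
proof -
  let ?T = "quot_alg Fr Rl"
  have T: "tensor3 (A\<lparr>carrier := Bm\<rparr>) H0 (A\<lparr>carrier := Bp\<rparr>) = ?T"
  proof -
    have c: "carrier (A\<lparr>carrier := B\<rparr>) = B" for B by simp
    show ?thesis unfolding tensor3_def Let_def c by (rule refl)
  qed
  have cls: "triangular_mult A \<iota> (Rl +>\<^bsub>Fr\<^esub> p) = mu p" if p: "p \<in> carrier Fr" for p
  proof -
    have const: "mu q = mu p" if "q \<in> Rl +>\<^bsub>Fr\<^esub> p" for q
    proof -
      from that have q: "q \<in> carrier Fr" and d: "q \<ominus>\<^bsub>Fr\<^esub> p \<in> Rl"
        unfolding Fr.quot_mem_iff[OF Rl_subspace p] by blast+
      have "mu (q - p) = \<zero>"
        by (rule Rl_kernel) (use d in \<open>unfold free_vs_minus[OF q p]\<close>)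
      then have "mu q \<ominus> mu p = \<zero>" unfolding mu_minus[OF q p] .
      then show ?thesis using r_right_minus_eq[OF mu_closed[OF q] mu_closed[OF p]] by blast
    qed
    have "p \<in> Rl +>\<^bsub>Fr\<^esub> p"
      by (rule abelian_subgroup.a_rcos_self[OF Fr.subspace_abelian_subgroup[OF Rl_subspace] p])
    with const have "mu ` (Rl +>\<^bsub>Fr\<^esub> p) = {mu p}" by blast
    then show ?thesis unfolding triangular_mult_def by (metis the_elem_eq)
  qed
  have eq: "Rl +>\<^bsub>Fr\<^esub> p = Rl +>\<^bsub>Fr\<^esub> q" if "p \<in> carrier Fr" "q \<in> carrier Fr" "mu p = mu q" for p q
  proof -
    have "mu (p - q) = \<zero>"
      unfolding mu_minus[OF that(1,2)] that(3)
      using r_right_minus_eq[OF mu_closed[OF that(2)] mu_closed[OF that(2)]] by blast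
    then have "p - q \<in> Rl" by (rule kernel_mu[OF Fr_minus[OF that(1,2)]])
    then show ?thesis unfolding Fr.quot_eq_iff[OF Rl_subspace that(1,2)] free_vs_minus[OF that(1,2)] .
  qed
  have T_cases: "\<exists>p\<in>carrier Fr. Y = Rl +>\<^bsub>Fr\<^esub> p" if "Y \<in> carrier ?T" for Y
    using that unfolding Fr.quot_simps(1) by blast
  have "bij_betw (triangular_mult A \<iota>) (carrier ?T) (carrier A)"
    unfolding bij_betw_def
  proof
    show "inj_on (triangular_mult A \<iota>) (carrier ?T)"
    proof (rule inj_onI)
      fix Y Z assume "Y \<in> carrier ?T" "Z \<in> carrier ?T" and YZ: "triangular_mult A \<iota> Y = triangular_mult A \<iota> Z"
      obtain p where p: "p \<in> carrier Fr" "Y = Rl +>\<^bsub>Fr\<^esub> p" using T_cases[OF \<open>Y \<in> _\<close>] by (rule bexE)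
      obtain q where q: "q \<in> carrier Fr" "Z = Rl +>\<^bsub>Fr\<^esub> q" using T_cases[OF \<open>Z \<in> _\<close>] by (rule bexE)
      have "mu p = mu q" using YZ unfolding p(2) q(2) cls[OF p(1)] cls[OF q(1)] .
      then show "Y = Z" unfolding p(2) q(2) by (rule eq[OF p(1) q(1)])
    qed
    have T_eq: "carrier ?T = (\<lambda>p. Rl +>\<^bsub>Fr\<^esub> p) ` carrier Fr"
      unfolding Fr.quot_simps(1) by (rule Setcompr_eq_image)
    have "triangular_mult A \<iota> ` carrier ?T = mu ` carrier Fr"
      unfolding T_eq image_image by (rule image_cong[OF refl cls])
    then show "triangular_mult A \<iota> ` carrier ?T = carrier A" unfolding mu_surj .
  qed
  moreover have "triangular_mult A \<iota> (Y \<oplus>\<^bsub>?T\<^esub> Z) = triangular_mult A \<iota> Y \<oplus> triangular_mult A \<iota> Z"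
    if Y: "Y \<in> carrier ?T" and Z: "Z \<in> carrier ?T" for Y Z
  proof -
    obtain p where p: "p \<in> carrier Fr" "Y = Rl +>\<^bsub>Fr\<^esub> p" using T_cases[OF Y] by (rule bexE)
    obtain q where q: "q \<in> carrier Fr" "Z = Rl +>\<^bsub>Fr\<^esub> q" using T_cases[OF Z] by (rule bexE)
    have YZ: "Y \<oplus>\<^bsub>?T\<^esub> Z = Rl +>\<^bsub>Fr\<^esub> (p + q)"
      using Fr.quot_add[OF Rl_subspace p(1) q(1)] unfolding p(2) q(2) free_vs_simps(2) .
    have *: "triangular_mult A \<iota> Y = mu p" "triangular_mult A \<iota> Z = mu q"
      using cls[OF p(1)] cls[OF q(1)] unfolding p(2) q(2) .
    show ?thesis
      unfolding YZ * by (rule trans[OF cls[OF Fr_add[OF p(1) q(1)]] mu_add[OF p(1) q(1)]])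
  qed
  moreover have "triangular_mult A \<iota> (c \<odot>\<^bsub>?T\<^esub> Y) = c \<odot> triangular_mult A \<iota> Y"
    if Y: "Y \<in> carrier ?T" for c Y
  proof -
    obtain p where p: "p \<in> carrier Fr" "Y = Rl +>\<^bsub>Fr\<^esub> p" using T_cases[OF Y] by (rule bexE)
    have cY: "c \<odot>\<^bsub>?T\<^esub> Y = Rl +>\<^bsub>Fr\<^esub> (Poly_Mapping.map ((*) c) p)"
      using Fr.quot_smult[OF Rl_subspace p(1), of c] unfolding p(2) free_vs_simps(4) .
    have cp: "Poly_Mapping.map ((*) c) p \<in> carrier Fr"
      using Fr.smult_closed[OF p(1), of c] unfolding free_vs_simps(4) .
    have *: "triangular_mult A \<iota> Y = mu p" unfolding p(2) by (rule cls[OF p(1)])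
    show ?thesis
      unfolding cY * by (rule trans[OF cls[OF cp] mu_smult[OF p(1)]])
  qed
  ultimately show ?thesis unfolding T lin_iso_def by (intro CollectI conjI ballI allI)
qed

end

section \<open>Automorphisms of function algebras\<close>

lemma fun_alg_simps:
  "carrier (fun_alg Y) = Y \<rightarrow>\<^sub>E UNIV" "f \<otimes>\<^bsub>fun_alg Y\<^esub> g = (\<lambda>x\<in>Y. f x * g x)" "\<one>\<^bsub>fun_alg Y\<^esub> = (\<lambda>x\<in>Y. 1)"
  "\<zero>\<^bsub>fun_alg Y\<^esub> = (\<lambda>x\<in>Y. 0)" "f \<oplus>\<^bsub>fun_alg Y\<^esub> g = (\<lambda>x\<in>Y. f x + g x)" "c \<odot>\<^bsub>fun_alg Y\<^esub> f = (\<lambda>x\<in>Y. c * f x)"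
  by (simp_all add: fun_alg_def)

lemma fun_alg_carrier: "f \<in> carrier (fun_alg Y) \<longleftrightarrow> f \<in> extensional Y"
  by (simp add: fun_alg_simps PiE_def)

lemma fun_alg_F_algebra: "F_algebra (fun_alg Y :: ('f::field, 'g \<Rightarrow> 'f) module)"
proof -
  let ?H = "fun_alg Y :: ('f, 'g \<Rightarrow> 'f) module"
  note defs = fun_alg_simps(2-) fun_alg_carrier
  have ag: "abelian_group ?H"
  proof (rule abelian_groupI)
    fix f assume "f \<in> carrier ?H"
    then show "\<exists>g\<in>carrier ?H. g \<oplus>\<^bsub>?H\<^esub> f = \<zero>\<^bsub>?H\<^esub>"
      by (intro bexI[of _ "\<lambda>x\<in>Y. - f x"]) (auto simp: defs)
    show "\<zero>\<^bsub>?H\<^esub> \<oplus>\<^bsub>?H\<^esub> f = f" using \<open>f \<in> carrier ?H\<close> by (auto simp: defs fun_eq_iff extensional_def)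
  qed (auto simp: defs algebra_simps)
  have "ring ?H"
    by (rule ringI[OF ag]) (auto simp: defs algebra_simps monoid_def fun_eq_iff extensional_def)
  moreover have "module base_field ?H"
  proof (rule moduleI)
    show "cring (base_field :: 'f ring)" by (rule cring_from_type_algebra)
  qed (use ag in \<open>auto simp: defs algebra_simps fun_eq_iff extensional_def\<close>)
  ultimately show ?thesis
    by (auto simp: F_algebra_def defs algebra_simps fun_eq_iff)
qed

lemma alg_homI:
  assumes "\<And>x. x \<in> carrier A \<Longrightarrow> \<phi> x \<in> carrier B"
    "\<And>x y. x \<in> carrier A \<Longrightarrow> y \<in> carrier A \<Longrightarrow> \<phi> (x \<oplus>\<^bsub>A\<^esub> y) = \<phi> x \<oplus>\<^bsub>B\<^esub> \<phi> y"
    "\<And>x y. x \<in> carrier A \<Longrightarrow> y \<in> carrier A \<Longrightarrow> \<phi> (x \<otimes>\<^bsub>A\<^esub> y) = \<phi> x \<otimes>\<^bsub>B\<^esub> \<phi> y"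
    "\<phi> \<one>\<^bsub>A\<^esub> = \<one>\<^bsub>B\<^esub>" "\<And>c x. x \<in> carrier A \<Longrightarrow> \<phi> (c \<odot>\<^bsub>A\<^esub> x) = c \<odot>\<^bsub>B\<^esub> \<phi> x"
  shows "\<phi> \<in> alg_hom A B"
  using assms by (auto simp: alg_hom_def ring_hom_def)

lemma alg_aut_simps:
  "carrier (alg_aut A) = Bij (carrier A) \<inter> alg_hom A A" "\<one>\<^bsub>alg_aut A\<^esub> = (\<lambda>x\<in>carrier A. x)"
  "\<theta> \<in> carrier (alg_aut A) \<Longrightarrow> \<theta>' \<in> carrier (alg_aut A) \<Longrightarrow> \<theta> \<otimes>\<^bsub>alg_aut A\<^esub> \<theta>' = compose (carrier A) \<theta> \<theta>'"
  by (auto simp: alg_aut_def BijGroup_def)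

text \<open>
  The inverse of an algebra automorphism is again multiplicative and linear.
\<close>

lemma (in falg) group_alg_aut: "group (alg_aut A)"
proof -
  have "subgroup (Bij (carrier A) \<inter> alg_hom A A) (BijGroup (carrier A))"
  proof (rule group.subgroupI[OF group_BijGroup])
    show "Bij (carrier A) \<inter> alg_hom A A \<subseteq> carrier (BijGroup (carrier A))" by (auto simp: BijGroup_def)
    have "(\<lambda>x\<in>carrier A. x) \<in> alg_hom A A" by (rule alg_homI) auto
    then show "Bij (carrier A) \<inter> alg_hom A A \<noteq> {}" using id_Bij by blast
    fix \<theta> assume \<theta>: "\<theta> \<in> Bij (carrier A) \<inter> alg_hom A A"
    then have b: "bij_betw \<theta> (carrier A) (carrier A)" by (simp add: Bij_def)
    note D = alg_homD[OF IntD2[OF \<theta>]]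
    let ?\<psi> = "\<lambda>x\<in>carrier A. inv_into (carrier A) \<theta> x"
    have ex: "\<exists>z\<in>carrier A. \<theta> z = x \<and> ?\<psi> x = z" if "x \<in> carrier A" for x
    proof -
      have "x \<in> \<theta> ` carrier A" using b that by (simp add: bij_betw_def)
      then obtain u where "u \<in> carrier A" "\<theta> u = x" by blast
      with that show ?thesis by (intro bexI[of _ u]) (auto simp: bij_betw_inv_into_left[OF b])
    qed
    have "?\<psi> \<in> alg_hom A A"
    proof (rule alg_homI)
      have \<psi>: "?\<psi> (\<theta> z) = z" if "z \<in> carrier A" for z
        using that b D(1) by (simp add: bij_betw_inv_into_left)
      show "?\<psi> \<one> = \<one>" using \<psi>[of \<one>] D(4) by simp
      fix x assume "x \<in> carrier A"
      then obtain u where u: "u \<in> carrier A" "\<theta> u = x" "?\<psi> x = u" using ex by blast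
      show "?\<psi> x \<in> carrier A" using u by simp
      show "?\<psi> (c \<odot> x) = c \<odot> ?\<psi> x" for c using u \<psi>[of "c \<odot> u"] D(5) by simp
      fix y assume "y \<in> carrier A"
      then obtain v where v: "v \<in> carrier A" "\<theta> v = y" "?\<psi> y = v" using ex by blast
      show "?\<psi> (x \<oplus> y) = ?\<psi> x \<oplus> ?\<psi> y" using u v \<psi>[of "u \<oplus> v"] D(2)[of u v] by simp
      show "?\<psi> (x \<otimes> y) = ?\<psi> x \<otimes> ?\<psi> y" using u v \<psi>[of "u \<otimes> v"] D(3)[of u v] by simp
    qed
    then show "inv\<^bsub>BijGroup (carrier A)\<^esub> \<theta> \<in> Bij (carrier A) \<inter> alg_hom A A"
      using \<theta> restrict_inv_into_Bij[of \<theta> "carrier A"] by (simp add: inv_BijGroup)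
    fix \<theta>' assume \<theta>': "\<theta>' \<in> Bij (carrier A) \<inter> alg_hom A A"
    note D' = alg_homD[OF IntD2[OF \<theta>']]
    have "compose (carrier A) \<theta> \<theta>' \<in> alg_hom A A"
      by (rule alg_homI) (simp_all add: compose_def D D')
    then show "\<theta> \<otimes>\<^bsub>BijGroup (carrier A)\<^esub> \<theta>' \<in> Bij (carrier A) \<inter> alg_hom A A"
      using \<theta> \<theta>' compose_Bij by (auto simp: BijGroup_def)
  qed
  then show ?thesis
    unfolding alg_aut_def by (rule subgroup.subgroup_is_group[OF _ group_BijGroup])
qed

lemma ltrans_apply: "y \<in> carrier G \<Longrightarrow> ltrans G g f y = f (g \<otimes>\<^bsub>G\<^esub> y)"
  by (simp add: ltrans_def)

lemma ltrans_closed [simp]: "ltrans G g f \<in> carrier (fun_alg (carrier G))"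
  by (simp add: ltrans_def fun_alg_carrier)

context group
begin

abbreviation "Fun \<equiv> fun_alg (carrier G) :: ('f::field, 'a \<Rightarrow> 'f) module"

lemma ltrans_one: "f \<in> carrier Fun \<Longrightarrow> ltrans G \<one> f = f"
  by (auto simp: ltrans_def fun_alg_carrier extensional_def fun_eq_iff)

lemma ltrans_ltrans:
  "g \<in> carrier G \<Longrightarrow> h \<in> carrier G \<Longrightarrow> ltrans G g (ltrans G h f) = ltrans G (h \<otimes> g) f"
  by (auto simp: ltrans_def fun_eq_iff m_assoc)

lemma fun_aut_apply: "f \<in> carrier Fun \<Longrightarrow> fun_aut G g f = ltrans G (inv g) f"
  by (simp add: fun_aut_def)

lemma fun_aut_closed:
  assumes g: "g \<in> carrier G"
  shows "(fun_aut G g :: ('a \<Rightarrow> 'f::field) \<Rightarrow> _) \<in> carrier (alg_aut Fun)"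
proof -
  have 1: "fun_aut G h (fun_aut G (inv h) f) = f" if "h \<in> carrier G" "f \<in> carrier Fun" for h and f :: "'a \<Rightarrow> 'f"
    using that by (simp add: fun_aut_apply ltrans_ltrans ltrans_one)
  have "bij_betw (fun_aut G g :: ('a \<Rightarrow> 'f) \<Rightarrow> _) (carrier Fun) (carrier Fun)"
    by (rule bij_betwI[where g = "fun_aut G (inv g)"])
      (use g 1[of g] 1[of "inv g"] in \<open>auto simp: fun_aut_apply\<close>)
  moreover have "(fun_aut G g :: ('a \<Rightarrow> 'f) \<Rightarrow> _) \<in> extensional (carrier Fun)"
    by (simp add: fun_aut_def)
  moreover have "(fun_aut G g :: ('a \<Rightarrow> 'f) \<Rightarrow> _) \<in> alg_hom Fun Fun"
    using g by (intro alg_homI)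
      (auto simp: fun_aut_def fun_alg_simps(2-) fun_alg_carrier ltrans_def fun_eq_iff)
  ultimately show ?thesis by (auto simp: alg_aut_simps Bij_def)
qed

lemma fun_aut_group_hom: "group_hom G (alg_aut (Fun :: ('f::field, 'a \<Rightarrow> 'f) module)) (fun_aut G)"
proof -
  have "group (alg_aut (Fun :: ('f, 'a \<Rightarrow> 'f) module))"
    by (rule falg.group_alg_aut) (simp add: falg_def fun_alg_F_algebra)
  moreover have "fun_aut G \<in> hom G (alg_aut (Fun :: ('f, 'a \<Rightarrow> 'f) module))"
  proof (rule homI)
    show "fun_aut G (g \<otimes> h) = fun_aut G g \<otimes>\<^bsub>alg_aut (Fun :: ('f, 'a \<Rightarrow> 'f) module)\<^esub> fun_aut G h"
      if "g \<in> carrier G" "h \<in> carrier G" for g h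
    proof (rule extensionalityI[of _ "carrier Fun"])
      fix f :: "'a \<Rightarrow> 'f" assume "f \<in> carrier Fun"
      then show "fun_aut G (g \<otimes> h) f = (fun_aut G g \<otimes>\<^bsub>alg_aut Fun\<^esub> fun_aut G h) f"
        using that by (simp add: alg_aut_simps(3)[OF fun_aut_closed fun_aut_closed] compose_def fun_aut_apply ltrans_ltrans inv_mult_group)
    next
      show "fun_aut G (g \<otimes> h) \<in> extensional (carrier Fun)" by (simp add: fun_aut_def)
      show "fun_aut G g \<otimes>\<^bsub>alg_aut (Fun :: ('f, 'a \<Rightarrow> 'f) module)\<^esub> fun_aut G h \<in> extensional (carrier Fun)"
        unfolding alg_aut_simps(3)[OF fun_aut_closed[OF that(1)] fun_aut_closed[OF that(2)]]
        by (rule compose_extensional)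
    qed
  qed (rule fun_aut_closed)
  ultimately show ?thesis by (simp add: group_hom_def group_hom_axioms_def)
qed

text \<open>
  Distinct group elements act differently on functions, as is seen on the indicator function of the
  unit element.
\<close>

lemma fun_aut_separates:
  assumes "g \<in> carrier G" "h \<in> carrier G" "g \<noteq> h"
  shows "\<exists>f\<in>carrier Fun. \<exists>y\<in>carrier G. (fun_aut G g f y :: 'f::field) \<noteq> fun_aut G h f y"
proof -
  define f :: "'a \<Rightarrow> 'f" where "f = (\<lambda>x\<in>carrier G. if x = \<one> then 1 else 0)"
  have f: "f \<in> carrier Fun" by (simp add: f_def fun_alg_carrier)
  have "inv h \<otimes> g \<noteq> \<one>" using assms by (metis inv_equality inv_inv inv_closed)
  then have "fun_aut G g f g \<noteq> fun_aut G h f g"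
    using assms f by (simp add: fun_aut_apply ltrans_apply f_def)
  with f assms show ?thesis by blast
qed

lemma fun_aut_inj: "inj_on (fun_aut G :: 'a \<Rightarrow> ('a \<Rightarrow> 'f::field) \<Rightarrow> _) (carrier G)"
proof (rule inj_onI, rule ccontr)
  fix g h assume "g \<in> carrier G" "h \<in> carrier G" "g \<noteq> h"
    and "(fun_aut G g :: ('a \<Rightarrow> 'f) \<Rightarrow> _) = fun_aut G h"
  with fun_aut_separates[of g h, where 'f = 'f] show False by auto
qed

end

section \<open>The semidirect product\<close>

text \<open>
  The hypotheses on \<open>\<zeta>\<close> and \<open>\<E>\<close>, except that \<open>\<E>\<close> may be trivial.
\<close>

locale zeta_group =
  fixes \<zeta> :: "real^'k" and E :: "real set"
  assumes zeta_pos: "\<And>j. 0 < \<zeta>$j"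
    and E_zero: "0 \<in> E" and E_add: "\<And>d e. d \<in> E \<Longrightarrow> e \<in> E \<Longrightarrow> d + e \<in> E" and E_neg: "\<And>e. e \<in> E \<Longrightarrow> - e \<in> E"
    and zeta_E: "\<And>j e. e \<in> E \<Longrightarrow> \<zeta>$j * e \<in> E" "\<And>j e. e \<in> E \<Longrightarrow> inverse (\<zeta>$j) * e \<in> E"
begin

abbreviation "z \<equiv> zeta_pow \<zeta>"
abbreviation "SG \<equiv> sdp \<zeta> E"

lemma zeta_nz [simp]: "\<zeta>$j \<noteq> 0" using zeta_pos[of j] by simp

lemma z_zero [simp]: "z 0 = 1" by (simp add: zeta_pow_def)

lemma z_add: "z (m + n) = z m * z n"
  by (simp add: zeta_pow_def power_int_add prod.distrib)

lemma z_pos: "0 < z n"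
  by (simp add: zeta_pow_def zeta_pos prod_pos zero_less_power_int)

lemma z_nz [simp]: "z n \<noteq> 0" using z_pos[of n] by simp

lemma z_minus: "z (- n) = inverse (z n)"
  using z_add[of n "- n"] by (simp add: field_simps)

lemma z_axis: "z (axis j a) = \<zeta>$j powi a"
proof -
  have "z (axis j a) = (\<Prod>i\<in>UNIV. if i = j then \<zeta>$j powi a else 1)"
    unfolding zeta_pow_def by (rule prod.cong) (auto simp: axis_def)
  also have "\<dots> = \<zeta>$j powi a" by simp
  finally show ?thesis .
qed

lemma zeta_powi_E: "e \<in> E \<Longrightarrow> \<zeta>$j powi n * e \<in> E"
proof -
  have 1: "\<zeta>$j ^ m * e \<in> E" if "e \<in> E" for m e
    by (induction m) (use that zeta_E in \<open>auto simp: mult.assoc\<close>)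
  have 2: "inverse (\<zeta>$j) ^ m * e \<in> E" if "e \<in> E" for m e
    by (induction m) (use that zeta_E in \<open>auto simp: mult.assoc\<close>)
  show "e \<in> E \<Longrightarrow> \<zeta>$j powi n * e \<in> E"
    using 1 2 by (simp add: power_int_def)
qed

lemma z_E: "e \<in> E \<Longrightarrow> z n * e \<in> E"
proof -
  have "\<forall>e\<in>E. (\<Prod>j\<in>I. \<zeta>$j powi (n$j)) * e \<in> E" if "finite I" for I
    using that by (induction I) (auto simp: mult.assoc zeta_powi_E)
  from this[of UNIV] show "e \<in> E \<Longrightarrow> z n * e \<in> E" by (simp add: zeta_pow_def)
qed

lemma SG_simps: "carrier SG = UNIV \<times> E" "(m, d) \<otimes>\<^bsub>SG\<^esub> (n, e) = (m + n, d + z m * e)" "\<one>\<^bsub>SG\<^esub> = (0, 0)"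
  by (simp_all add: sdp_def)

lemma SG_group: "group SG"
proof (rule groupI)
  fix g assume "g \<in> carrier SG"
  then obtain n e where g: "g = (n, e)" "e \<in> E" by (auto simp: SG_simps)
  show "\<exists>h\<in>carrier SG. h \<otimes>\<^bsub>SG\<^esub> g = \<one>\<^bsub>SG\<^esub>"
    using g E_neg[OF z_E[of e "- n"]] by (intro bexI[of _ "(- n, - (z (- n) * e))"]) (auto simp: SG_simps)
qed (auto simp: SG_simps E_zero E_add z_E z_add distrib_left mult.assoc add.assoc)

sublocale SG: group SG by (rule SG_group)

lemma SG_inv: "e \<in> E \<Longrightarrow> inv\<^bsub>SG\<^esub> (n, e) = (- n, - (z (- n) * e))"
  by (rule SG.inv_equality) (use E_neg z_E in \<open>auto simp: SG_simps\<close>)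

lemma SG_nonneg: "(n, e) \<in> sdp_nonneg \<zeta> E \<longleftrightarrow> (\<forall>j. 0 \<le> n$j) \<and> e \<in> E \<and> 0 \<le> e"
  by (auto simp: sdp_nonneg_def SG_simps)

lemma nonneg_carrier: "g \<in> sdp_nonneg \<zeta> E \<Longrightarrow> g \<in> carrier SG"
  by (auto simp: sdp_nonneg_def)

lemma nonneg_one: "\<one>\<^bsub>SG\<^esub> \<in> sdp_nonneg \<zeta> E"
  by (simp add: SG_simps SG_nonneg E_zero)

lemma nonneg_mult: "g \<in> sdp_nonneg \<zeta> E \<Longrightarrow> h \<in> sdp_nonneg \<zeta> E \<Longrightarrow> g \<otimes>\<^bsub>SG\<^esub> h \<in> sdp_nonneg \<zeta> E"
  by (cases g; cases h) (auto simp: SG_simps SG_nonneg E_add z_E less_imp_le[OF z_pos])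

text \<open>
  The nonnegative elements contain no nontrivial pair of inverses, so that the nontrivial ones form a
  semigroup.
\<close>

lemma nonneg_mult_one:
  assumes "g \<in> sdp_nonneg \<zeta> E" "h \<in> sdp_nonneg \<zeta> E" "g \<otimes>\<^bsub>SG\<^esub> h = \<one>\<^bsub>SG\<^esub>"
  shows "g = \<one>\<^bsub>SG\<^esub>"
proof -
  obtain m d n e where gh: "g = (m, d)" "h = (n, e)" by (cases g; cases h)
  have "m + n = 0" "d + z m * e = 0" "\<forall>j. 0 \<le> m$j" "\<forall>j. 0 \<le> n$j" "0 \<le> d" "0 \<le> e"
    using assms by (auto simp: gh SG_simps SG_nonneg)
  moreover have "m$j = 0" for j
  proof -
    have "m$j + n$j = 0" using \<open>m + n = 0\<close> by (metis vector_add_component zero_index)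
    with \<open>\<forall>j. 0 \<le> m$j\<close> \<open>\<forall>j. 0 \<le> n$j\<close> show ?thesis by (metis add_nonneg_eq_0_iff)
  qed
  moreover have "0 \<le> z m * e" using \<open>0 \<le> e\<close> z_pos[of m] by simp
  ultimately show ?thesis by (auto simp: gh SG_simps vec_eq_iff)
qed

end

section \<open>Presented algebras\<close>

context falg
begin

lemma ideal_subspace:
  assumes "ideal K A"
  shows "submodule K base_field A"
proof (rule subspaceI)
  interpret K: ideal K A by (rule assms)
  show "K \<subseteq> carrier A" by (rule K.a_subset)
  show "\<zero> \<in> K" by simp
  show "x \<oplus> y \<in> K" if "x \<in> K" "y \<in> K" for x y using that by simp
  show "c \<odot> x \<in> K" if "x \<in> K" for c x
  proof -
    have "x \<in> carrier A" using that by simp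
    then have "c \<odot> x = (c \<odot> \<one>) \<otimes> x" by (simp add: smult_mult_left)
    then show ?thesis using K.I_l_closed[OF that, of "c \<odot> \<one>"] by simp
  qed
qed

lemma quot_mult:
  assumes "ideal K A" "x \<in> carrier A" "y \<in> carrier A"
  shows "(K +> x) \<otimes>\<^bsub>quot_alg A K\<^esub> (K +> y) = K +> (x \<otimes> y)"
  using ideal.rcoset_mult_add[OF assms] by (simp add: quot_simps(3) FactRing_def)

lemma quot_one: "\<one>\<^bsub>quot_alg A K\<^esub> = K +> \<one>"
  by (simp add: quot_simps(4) FactRing_def)

lemma quot_falg:
  assumes K: "ideal K A"
  shows "falg (quot_alg A K)"
proof
  note sp = ideal_subspace[OF K]
  let ?Q = "quot_alg A K"
  have obt: "\<exists>x\<in>carrier A. Y = K +> x" if "Y \<in> carrier ?Q" for Y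
    using that unfolding quot_simps(1) by blast
  have closed: "K +> x \<in> carrier ?Q" if "x \<in> carrier A" for x
    using that unfolding quot_simps(1) by blast
  note ms = quot_mult[OF K] quot_add[OF sp] quot_smult[OF sp] quot_one closed
  have "ring ?Q"
  proof (rule ringI)
    show "abelian_group ?Q" by (rule quot_abelian_group[OF sp])
    show "Group.monoid ?Q"
    proof (rule monoidI)
      show "\<one>\<^bsub>?Q\<^esub> \<in> carrier ?Q" by (simp add: ms)
      fix W assume "W \<in> carrier ?Q"
      then obtain x where x: "x \<in> carrier A" "W = K +> x" using obt by blast
      show "\<one>\<^bsub>?Q\<^esub> \<otimes>\<^bsub>?Q\<^esub> W = W" "W \<otimes>\<^bsub>?Q\<^esub> \<one>\<^bsub>?Q\<^esub> = W" using x by (simp_all add: ms)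
      fix Y assume "Y \<in> carrier ?Q"
      then obtain y where y: "y \<in> carrier A" "Y = K +> y" using obt by blast
      show "W \<otimes>\<^bsub>?Q\<^esub> Y \<in> carrier ?Q" using x y by (simp add: ms)
      fix Z assume "Z \<in> carrier ?Q"
      then obtain w where "w \<in> carrier A" "Z = K +> w" using obt by blast
      then show "W \<otimes>\<^bsub>?Q\<^esub> Y \<otimes>\<^bsub>?Q\<^esub> Z = W \<otimes>\<^bsub>?Q\<^esub> (Y \<otimes>\<^bsub>?Q\<^esub> Z)"
        using x y by (simp add: ms m_assoc)
    qed
    fix W Y Z assume UVW: "W \<in> carrier ?Q" "Y \<in> carrier ?Q" "Z \<in> carrier ?Q"
    obtain x where x: "x \<in> carrier A" "W = K +> x" using obt[OF UVW(1)] by blast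
    obtain y where y: "y \<in> carrier A" "Y = K +> y" using obt[OF UVW(2)] by blast
    obtain w where w: "w \<in> carrier A" "Z = K +> w" using obt[OF UVW(3)] by blast
    show "(W \<oplus>\<^bsub>?Q\<^esub> Y) \<otimes>\<^bsub>?Q\<^esub> Z = W \<otimes>\<^bsub>?Q\<^esub> Z \<oplus>\<^bsub>?Q\<^esub> Y \<otimes>\<^bsub>?Q\<^esub> Z"
      using x y w by (simp add: ms l_distr)
    show "Z \<otimes>\<^bsub>?Q\<^esub> (W \<oplus>\<^bsub>?Q\<^esub> Y) = Z \<otimes>\<^bsub>?Q\<^esub> W \<oplus>\<^bsub>?Q\<^esub> Z \<otimes>\<^bsub>?Q\<^esub> Y"
      using x y w by (simp add: ms r_distr)
  qed
  moreover have "(c \<odot>\<^bsub>?Q\<^esub> W) \<otimes>\<^bsub>?Q\<^esub> Y = c \<odot>\<^bsub>?Q\<^esub> (W \<otimes>\<^bsub>?Q\<^esub> Y) \<and> W \<otimes>\<^bsub>?Q\<^esub> (c \<odot>\<^bsub>?Q\<^esub> Y) = c \<odot>\<^bsub>?Q\<^esub> (W \<otimes>\<^bsub>?Q\<^esub> Y)"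
    if UV: "W \<in> carrier ?Q" "Y \<in> carrier ?Q" for c W Y
  proof -
    obtain x where x: "x \<in> carrier A" "W = K +> x" using obt[OF UV(1)] by blast
    obtain y where y: "y \<in> carrier A" "Y = K +> y" using obt[OF UV(2)] by blast
    show ?thesis using x y by (simp add: ms smult_mult_left smult_mult_right)
  qed
  ultimately show "F_algebra ?Q"
    unfolding F_algebra_def using quot_module[OF sp] by blast
qed

end

lemma free_alg_simps:
  "carrier (free_alg S) = {p. Poly_Mapping.keys p \<subseteq> {w. set (letters w) \<subseteq> S}}"
  "x \<otimes>\<^bsub>free_alg S\<^esub> y = x * y" "\<one>\<^bsub>free_alg S\<^esub> = 1" "x \<oplus>\<^bsub>free_alg S\<^esub> y = x + y"
  "\<zero>\<^bsub>free_alg S\<^esub> = 0" "c \<odot>\<^bsub>free_alg S\<^esub> x = Poly_Mapping.single 0 c * x"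
  by (simp_all add: free_alg_def free_vs_def mult_map_scale_conv_mult)

lemma free_alg_single: "set ws \<subseteq> S \<Longrightarrow> Poly_Mapping.single (Word ws) c \<in> carrier (free_alg S)"
  by (simp add: free_alg_simps)

lemma free_alg_closed:
  "p \<in> carrier (free_alg S) \<Longrightarrow> q \<in> carrier (free_alg S) \<Longrightarrow> p + q \<in> carrier (free_alg S)"
  "p \<in> carrier (free_alg S) \<Longrightarrow> q \<in> carrier (free_alg S) \<Longrightarrow> p * q \<in> carrier (free_alg S)"
  "p \<in> carrier (free_alg S) \<Longrightarrow> - p \<in> carrier (free_alg S)"
  "p \<in> carrier (free_alg S) \<Longrightarrow> q \<in> carrier (free_alg S) \<Longrightarrow> p - q \<in> carrier (free_alg S)"
  "0 \<in> carrier (free_alg S)" "1 \<in> carrier (free_alg S)" "Poly_Mapping.single 0 c \<in> carrier (free_alg S)"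
  for p q :: "'g free_word \<Rightarrow>\<^sub>0 'f::field"
proof -
  assume p: "p \<in> carrier (free_alg S)"
  then show "- p \<in> carrier (free_alg S)" by (simp add: free_alg_simps)
  assume q: "q \<in> carrier (free_alg S)"
  show "p + q \<in> carrier (free_alg S)"
    using p q keys_add[of p q] by (auto simp: free_alg_simps)
  show "p - q \<in> carrier (free_alg S)"
    using p q keys_diff[of p q] by (auto simp: free_alg_simps)
  show "p * q \<in> carrier (free_alg S)"
    unfolding free_alg_simps(1)
  proof (rule CollectI, rule subsetI)
    fix w assume "w \<in> Poly_Mapping.keys (p * q)"
    then obtain a b where "w = a + b" "a \<in> Poly_Mapping.keys p" "b \<in> Poly_Mapping.keys q"
      using keys_mult[of p q] by blast
    then show "w \<in> {w. set (letters w) \<subseteq> S}"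
      using p q by (fastforce simp: free_alg_simps plus_free_word_def)
  qed
next
  show "0 \<in> carrier (free_alg S)" "1 \<in> carrier (free_alg S)" "Poly_Mapping.single 0 c \<in> carrier (free_alg S)"
    by (auto simp: free_alg_simps zero_free_word_def simp flip: single_one)
qed

lemma free_gen_closed: "g \<in> S \<Longrightarrow> free_gen g \<in> carrier (free_alg S)"
  unfolding free_gen_def by (rule free_alg_single) simp

lemma single_0_commute: "p * Poly_Mapping.single 0 c = Poly_Mapping.single 0 c * p"
  for p :: "'g free_word \<Rightarrow>\<^sub>0 'f::field"
proof -
  have "p = (\<Sum>u\<in>Poly_Mapping.keys p. Poly_Mapping.single u (Poly_Mapping.lookup p u))"
    by (rule poly_mapping_sum_singles)
  moreover have "(\<Sum>u\<in>Poly_Mapping.keys p. Poly_Mapping.single u (Poly_Mapping.lookup p u)) * Poly_Mapping.single 0 c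
      = Poly_Mapping.single 0 c * (\<Sum>u\<in>Poly_Mapping.keys p. Poly_Mapping.single u (Poly_Mapping.lookup p u))"
    by (simp add: sum_distrib_left sum_distrib_right mult_single mult.commute)
  ultimately show ?thesis by metis
qed

lemma free_alg_falg: "falg (free_alg S :: ('f::field, 'g free_word \<Rightarrow>\<^sub>0 'f) module)"
proof
  let ?F = "free_alg S :: ('f, 'g free_word \<Rightarrow>\<^sub>0 'f) module"
  note s = free_alg_simps(2-) free_alg_closed
  have ag: "abelian_group ?F"
  proof (rule abelian_groupI)
    fix p assume "p \<in> carrier ?F"
    then show "\<exists>q\<in>carrier ?F. q \<oplus>\<^bsub>?F\<^esub> p = \<zero>\<^bsub>?F\<^esub>"
      by (intro bexI[of _ "- p"]) (simp_all add: s)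
  qed (simp_all add: s algebra_simps)
  have "ring ?F"
    by (rule ringI[OF ag]) (simp_all add: s monoid_def algebra_simps)
  moreover have "module base_field ?F"
  proof (rule moduleI)
    show "cring (base_field :: 'f ring)" by (rule cring_from_type_algebra)
  qed (simp_all add: ag s single_add mult_single single_one algebra_simps flip: mult.assoc)
  moreover have "Poly_Mapping.single 0 c * p * q = Poly_Mapping.single 0 c * (p * q)"
    "p * (Poly_Mapping.single 0 c * q) = Poly_Mapping.single 0 c * (p * q)"
    for c and p q :: "'g free_word \<Rightarrow>\<^sub>0 'f"
    by (simp_all add: mult.assoc[symmetric] single_0_commute)
  ultimately show "F_algebra ?F"
    by (simp add: F_algebra_def s)
qed

lemma free_alg_minus:
  "p \<in> carrier (free_alg S) \<Longrightarrow> q \<in> carrier (free_alg S) \<Longrightarrow> p \<ominus>\<^bsub>free_alg S\<^esub> q = p - q"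
  for p q :: "'g free_word \<Rightarrow>\<^sub>0 'f::field"
proof -
  interpret F: falg "free_alg S :: ('f, 'g free_word \<Rightarrow>\<^sub>0 'f) module" by (rule free_alg_falg)
  assume p: "p \<in> carrier (free_alg S)" and q: "q \<in> carrier (free_alg S)"
  have "\<ominus>\<^bsub>free_alg S\<^esub> q = - q"
    by (rule F.minus_equality) (simp_all add: q free_alg_closed free_alg_simps(4,5))
  then show ?thesis by (simp add: a_minus_def free_alg_simps(4))
qed

lemma free_alg_idealI:
  fixes K :: "('g free_word \<Rightarrow>\<^sub>0 'f::field) set"
  assumes "K \<subseteq> carrier (free_alg S)" "0 \<in> K" "\<And>p q. p \<in> K \<Longrightarrow> q \<in> K \<Longrightarrow> p + q \<in> K"
    "\<And>p q. p \<in> K \<Longrightarrow> q \<in> carrier (free_alg S) \<Longrightarrow> q * p \<in> K \<and> p * q \<in> K"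
  shows "ideal K (free_alg S)"
proof -
  interpret F: falg "free_alg S :: ('f, 'g free_word \<Rightarrow>\<^sub>0 'f) module" by (rule free_alg_falg)
  have "submodule K base_field (free_alg S)"
  proof (rule F.subspaceI)
    show "c \<odot>\<^bsub>free_alg S\<^esub> x \<in> K" if "x \<in> K" for c x
      using assms(4)[OF that free_alg_closed(7)[of c]] by (simp add: free_alg_simps(6))
  qed (use assms(1-3) in \<open>simp_all add: free_alg_simps(4,5)\<close>)
  then have "subgroup K (add_monoid (free_alg S))" by (simp add: submodule_def)
  then show ?thesis
    by (intro idealI F.ring_axioms) (use assms(4) in \<open>auto simp: free_alg_simps(2)\<close>)
qed

text \<open>
  A presentation whose relations involve generators in \<open>S\<close> only, with the class \<open>cls p\<close> of an element \<open>p\<close>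
  of the free algebra.
\<close>

locale presentation =
  fixes S :: "'g set" and R :: "(('g free_word \<Rightarrow>\<^sub>0 'f) \<times> ('g free_word \<Rightarrow>\<^sub>0 'f::field)) set"
  assumes rels: "(l, r) \<in> R \<Longrightarrow> l \<in> carrier (free_alg S) \<and> r \<in> carrier (free_alg S)"
begin

definition cls :: "('g free_word \<Rightarrow>\<^sub>0 'f) \<Rightarrow> ('g free_word \<Rightarrow>\<^sub>0 'f) set" where
  "cls p = rel_ideal S R +>\<^bsub>free_alg S\<^esub> p"

interpretation F: falg "free_alg S :: ('f, 'g free_word \<Rightarrow>\<^sub>0 'f) module" by (rule free_alg_falg)

lemma rels_sub: "{l - r | l r. (l, r) \<in> R} \<subseteq> carrier (free_alg S)"
  using rels free_alg_closed(4) by blast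

lemma ideal_J: "ideal (rel_ideal S R) (free_alg S)"
  unfolding rel_ideal_def by (rule F.genideal_ideal[OF rels_sub])

lemma J_least: "ideal K (free_alg S) \<Longrightarrow> (\<And>l r. (l, r) \<in> R \<Longrightarrow> l - r \<in> K) \<Longrightarrow> rel_ideal S R \<subseteq> K"
  unfolding rel_ideal_def by (rule F.genideal_minimal) auto

lemma falg: "falg (presented_alg S R)"
  unfolding presented_alg_def by (rule F.quot_falg[OF ideal_J])

lemma cls_eq_iff:
  "p \<in> carrier (free_alg S) \<Longrightarrow> q \<in> carrier (free_alg S) \<Longrightarrow> cls p = cls q \<longleftrightarrow> p - q \<in> rel_ideal S R"
  unfolding cls_def by (simp add: F.quot_eq_iff[OF F.ideal_subspace[OF ideal_J]] free_alg_minus)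

lemma cls_mem_iff:
  "p \<in> carrier (free_alg S) \<Longrightarrow> q \<in> cls p \<longleftrightarrow> q \<in> carrier (free_alg S) \<and> q - p \<in> rel_ideal S R"
  unfolding cls_def F.quot_mem_iff[OF F.ideal_subspace[OF ideal_J]] by (auto simp: free_alg_minus)

lemma cls_self: "p \<in> carrier (free_alg S) \<Longrightarrow> p \<in> cls p"
  using F.subspaceD(2)[OF F.ideal_subspace[OF ideal_J]] by (simp add: cls_mem_iff free_alg_simps(5))

lemma cls_rel: "(l, r) \<in> R \<Longrightarrow> cls l = cls r"
  using rels[of l r] F.genideal_self[OF rels_sub] by (subst cls_eq_iff) (auto simp: rel_ideal_def)

lemma carrier_presented: "carrier (presented_alg S R) = cls ` carrier (free_alg S)"
  unfolding presented_alg_def F.quot_simps(1) cls_def by blast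

lemma cls_closed: "p \<in> carrier (free_alg S) \<Longrightarrow> cls p \<in> carrier (presented_alg S R)"
  by (simp add: carrier_presented)

lemma cls_add:
  "p \<in> carrier (free_alg S) \<Longrightarrow> q \<in> carrier (free_alg S) \<Longrightarrow> cls (p + q) = cls p \<oplus>\<^bsub>presented_alg S R\<^esub> cls q"
  unfolding cls_def presented_alg_def by (simp add: F.quot_add[OF F.ideal_subspace[OF ideal_J]] free_alg_simps(4))

lemma cls_mult:
  "p \<in> carrier (free_alg S) \<Longrightarrow> q \<in> carrier (free_alg S) \<Longrightarrow> cls (p * q) = cls p \<otimes>\<^bsub>presented_alg S R\<^esub> cls q"
  unfolding cls_def presented_alg_def by (simp add: F.quot_mult[OF ideal_J] free_alg_simps(2))

lemma cls_smult:
  "p \<in> carrier (free_alg S) \<Longrightarrow> cls (Poly_Mapping.single 0 c * p) = c \<odot>\<^bsub>presented_alg S R\<^esub> cls p"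
  unfolding cls_def presented_alg_def by (simp add: F.quot_smult[OF F.ideal_subspace[OF ideal_J]] free_alg_simps(6))

lemma cls_one: "cls 1 = \<one>\<^bsub>presented_alg S R\<^esub>"
  unfolding cls_def presented_alg_def by (simp add: F.quot_one free_alg_simps(3))

lemma cls_scal: "cls (Poly_Mapping.single 0 c) = c \<odot>\<^bsub>presented_alg S R\<^esub> \<one>\<^bsub>presented_alg S R\<^esub>"
  using cls_smult[of 1 c] by (simp add: cls_one free_alg_closed)

lemma cls_zero: "cls 0 = \<zero>\<^bsub>presented_alg S R\<^esub>"
proof -
  interpret A: falg "presented_alg S R" by (rule falg)
  show ?thesis using cls_smult[of 0 0] A.smult_0[OF cls_closed, of 0] by (simp add: free_alg_closed)
qed

text \<open>
  A subspace that contains \<open>1\<close> and is stable under left multiplication by the generators is everything.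
\<close>

lemma carrier_generated:
  assumes L: "submodule L base_field (presented_alg S R)" and 1: "\<one>\<^bsub>presented_alg S R\<^esub> \<in> L"
    and mult: "\<And>g x. g \<in> S \<Longrightarrow> x \<in> L \<Longrightarrow> cls (free_gen g) \<otimes>\<^bsub>presented_alg S R\<^esub> x \<in> L"
  shows "L = carrier (presented_alg S R)"
proof -
  interpret A: falg "presented_alg S R" by (rule falg)
  have word: "cls (Poly_Mapping.single (Word ws) 1) \<in> L" if "set ws \<subseteq> S" for ws
    using that
  proof (induction ws)
    case Nil
    then show ?case using 1 cls_one by (simp flip: zero_free_word_def)
  next
    case (Cons g ws)
    have "Poly_Mapping.single (Word (g # ws)) 1 = free_gen g * Poly_Mapping.single (Word ws) (1::'f)"
      by (simp add: free_gen_def mult_single plus_free_word_def)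
    moreover have "(free_gen g :: 'g free_word \<Rightarrow>\<^sub>0 'f) \<in> carrier (free_alg S)"
        "Poly_Mapping.single (Word ws) (1::'f) \<in> carrier (free_alg S)"
      using Cons.prems by (auto intro: free_gen_closed free_alg_single)
    ultimately show ?case using mult[of g "cls (Poly_Mapping.single (Word ws) 1)"] Cons by (simp add: cls_mult)
  qed
  have "cls p \<in> L" if p: "p \<in> carrier (free_alg S)" for p
  proof -
    have "(\<Sum>w\<in>I. Poly_Mapping.single w (Poly_Mapping.lookup p w)) \<in> carrier (free_alg S) \<and>
        cls (\<Sum>w\<in>I. Poly_Mapping.single w (Poly_Mapping.lookup p w)) \<in> L"
      if "finite I" "I \<subseteq> {w. set (letters w) \<subseteq> S}" for I
      using that
    proof (induction I)
      case empty
      then show ?case using A.subspaceD(2)[OF L] by (simp add: cls_zero free_alg_closed)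
    next
      case (insert w I)
      define q where "q = Poly_Mapping.single w (Poly_Mapping.lookup p w)"
      have w: "Poly_Mapping.single w (1::'f) \<in> carrier (free_alg S)" "cls (Poly_Mapping.single w 1) \<in> L"
        using insert.prems free_alg_single[of "letters w" S] word[of "letters w"] by auto
      have q: "q = Poly_Mapping.single 0 (Poly_Mapping.lookup p w) * Poly_Mapping.single w 1"
        by (simp add: q_def mult_single)
      have "q \<in> carrier (free_alg S)" "cls q \<in> L"
        unfolding q using w by (simp_all add: cls_smult A.subspaceD(4)[OF L] free_alg_closed)
      then show ?case
        using insert A.subspaceD(3)[OF L] by (simp add: cls_add free_alg_closed flip: q_def)
    qed
    from this[of "Poly_Mapping.keys p"] p show ?thesis
      using poly_mapping_sum_singles[of p] by (simp add: free_alg_simps(1))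
  qed
  then show ?thesis using A.subspaceD(1)[OF L] by (auto simp: carrier_presented)
qed

end

section \<open>A faithful representation\<close>

lemma poly_mapping_single_induct [case_names single add]:
  fixes p :: "'a \<Rightarrow>\<^sub>0 'b::comm_monoid_add"
  assumes "\<And>w c. P (Poly_Mapping.single w c)" "\<And>p q. P p \<Longrightarrow> P q \<Longrightarrow> P (p + q)"
  shows "P p"
proof -
  have "(\<Sum>u\<in>Poly_Mapping.keys p. Poly_Mapping.single u (Poly_Mapping.lookup p u)) \<in> {p. P p}"
    by (rule sum_in_subspace) (use assms(1)[of undefined 0] assms in auto)
  then show ?thesis by (simp flip: poly_mapping_sum_singles)
qed

text \<open>
  Indices \<open>(e, e', m, n, p, d)\<close> of basis vectors, where \<open>(p, d)\<close> is a group element.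
\<close>

type_synonym 'k idx = "real \<times> real \<times> (int^'k) \<times> (int^'k) \<times> (int^'k) \<times> real"

text \<open>
  The parameters of the algebra; \<open>\<E>\<close> may still be trivial.
\<close>

locale zeta_alg = zeta_group \<zeta> E for \<zeta> :: "real^'k" and E +
  fixes c :: "'f::field^'k"
begin

abbreviation "gens \<equiv> A_gens E :: ('f, 'k) gens set"
abbreviation "FA \<equiv> free_alg gens :: ('f, ('f, 'k) free_elem) module"
abbreviation "H0 \<equiv> A_H0 \<zeta> E :: ('f, ('f, 'k) H0_fun) module"
abbreviation "rels \<equiv> A_rels \<zeta> E c"
abbreviation "A \<equiv> A_alg \<zeta> E c"

abbreviation mult_A (infixl \<open>\<cdot>\<close> 70) where
  "x \<cdot> y \<equiv> x \<otimes>\<^bsub>A\<^esub> y"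

lemma H0_carrier: "f \<in> carrier H0 \<longleftrightarrow> f \<in> extensional (UNIV \<times> E)"
  by (simp add: A_H0_def fun_alg_carrier SG_simps)

lemma H0_ltrans: "ltrans SG g f \<in> carrier H0"
  by (simp add: A_H0_def)

lemma H0_falg: "falg H0"
  unfolding A_H0_def falg_def by (rule fun_alg_F_algebra)

interpretation H0: falg H0 by (rule H0_falg)

lemma gens_iff: "GenH f \<in> gens \<longleftrightarrow> f \<in> carrier H0" "GenT e \<in> gens \<longleftrightarrow> e \<in> E" "GenX s j \<in> gens"
  by (auto simp: A_gens_def H0_carrier PiE_def)

lemma E_diff: "d \<in> E \<Longrightarrow> e \<in> E \<Longrightarrow> d - e \<in> E"
  using E_add[of d "- e"] E_neg[of e] by simp

lemma free_gens_closed: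
  "f \<in> carrier H0 \<Longrightarrow> free_gen (GenH f) \<in> carrier FA" "e \<in> E \<Longrightarrow> free_gen (GenT e) \<in> carrier FA"
  "free_gen (GenX s j) \<in> carrier FA"
  by (simp_all add: free_gen_closed gens_iff)

lemma rels_closed:
  assumes "(l, r) \<in> rels"
  shows "l \<in> carrier FA \<and> r \<in> carrier FA"
  using assms
  by (induction rule: A_rels.induct)
    (simp_all add: free_gens_closed free_alg_closed H0_ltrans E_zero E_neg E_add E_diff zeta_powi_E)

sublocale presentation gens rels
  by unfold_locales (rule rels_closed)

lemma A_presented: "presented_alg gens rels = A"
  by (simp add: A_alg_def)

lemma A_cls_eq: "A_cls \<zeta> E c g = cls (free_gen g)"
  by (simp add: A_cls_def cls_def A_ideal_def)

text \<open>
  The action is described on the dual side: a function \<open>\<phi>\<close> of the index is composed with the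
  operation of a generator on basis vectors. This turns left multiplications into operators that act
  in the opposite order, so that a word acts by \<open>fold\<close> from its first letter on, and it avoids formal
  sums of basis vectors. The components \<open>e\<close>, \<open>e'\<close>, \<open>m\<close>, \<open>n\<close> need not be nonnegative. The second term for
  \<open>x\<^sub>j\<^sup>+\<close> comes from the Weyl relation: moving \<open>x\<^sub>j\<^sup>+\<close> past \<open>(x\<^sub>j\<^sup>-)\<^sup>m\<close> leaves \<open>m c\<^sub>j (x\<^sub>j\<^sup>-)\<^bsup>m-1\<^esup>\<close>.
\<close>

fun act :: "('f, 'k) gens \<Rightarrow> ('k idx \<Rightarrow> 'f)
    \<Rightarrow> 'k idx \<Rightarrow> 'f" where
  "act (GenH f) \<phi> (e, e', m, n, p, d) = f (p, d) * \<phi> (e, e', m, n, p, d)"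
| "act (GenT a) \<phi> (e, e', m, n, p, d) = \<phi> (e + max a 0, e' + max (- a) 0, m, n, p, a + d)"
| "act (GenX Plus j) \<phi> (e, e', m, n, p, d) =
     \<phi> (\<zeta>$j * e, \<zeta>$j * e', m, n + axis j 1, axis j 1 + p, \<zeta>$j * d)
     + of_int (m$j) * c$j * \<phi> (\<zeta>$j * e, \<zeta>$j * e', m - axis j 1, n, axis j 1 + p, \<zeta>$j * d)"
| "act (GenX Minus j) \<phi> (e, e', m, n, p, d) =
     \<phi> (inverse (\<zeta>$j) * e, inverse (\<zeta>$j) * e', m + axis j 1, n, axis j (- 1) + p, inverse (\<zeta>$j) * d)"

text \<open>
  The indices whose last two components form an element of the group. Values of functions in \<open>H0\<close> at other
  points are meaningless, so the relations hold at valid indices only.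
\<close>

definition valid :: "'k idx \<Rightarrow> bool" where
  "valid = (\<lambda>(e, e', m, n, p, d). d \<in> E)"

lemma valid_simp [simp]: "valid (e, e', m, n, p, d) \<longleftrightarrow> d \<in> E"
  by (simp add: valid_def)

lemma act_add: "act g (\<lambda>b. \<phi> b + \<psi> b) b = act g \<phi> b + act g \<psi> b"
  by (cases "(g, \<phi>, b)" rule: act.cases) (simp_all add: algebra_simps)

lemma act_mult: "act g (\<lambda>b. a * \<phi> b) b = a * act g \<phi> b"
  by (cases "(g, \<phi>, b)" rule: act.cases) (simp_all add: algebra_simps)

lemma act_cong: "g \<in> gens \<Longrightarrow> (\<And>b. valid b \<Longrightarrow> \<phi> b = \<psi> b) \<Longrightarrow> valid b \<Longrightarrow> act g \<phi> b = act g \<psi> b"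
  by (cases "(g, \<phi>, b)" rule: act.cases) (simp_all add: gens_iff E_add zeta_E)

lemma fold_act_add: "fold act ws (\<lambda>b. \<phi> b + \<psi> b) = (\<lambda>b. fold act ws \<phi> b + fold act ws \<psi> b)"
proof (induction ws arbitrary: \<phi> \<psi>)
  case (Cons g ws)
  have "act g (\<lambda>b. \<phi> b + \<psi> b) = (\<lambda>b. act g \<phi> b + act g \<psi> b)" by (rule ext) (rule act_add)
  then show ?case using Cons by simp
qed simp

lemma fold_act_mult: "fold act ws (\<lambda>b. a * \<phi> b) = (\<lambda>b. a * fold act ws \<phi> b)"
proof (induction ws arbitrary: \<phi>)
  case (Cons g ws)
  have "act g (\<lambda>b. a * \<phi> b) = (\<lambda>b. a * act g \<phi> b)" by (rule ext) (rule act_mult)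
  then show ?case using Cons by simp
qed simp

lemma fold_act_cong:
  "set ws \<subseteq> gens \<Longrightarrow> (\<And>b. valid b \<Longrightarrow> \<phi> b = \<psi> b) \<Longrightarrow> valid b \<Longrightarrow> fold act ws \<phi> b = fold act ws \<psi> b"
proof (induction ws arbitrary: \<phi> \<psi>)
  case (Cons g ws)
  show ?case
    unfolding fold.simps comp_def
  proof (rule Cons.IH)
    show "act g \<phi> b = act g \<psi> b" if "valid b" for b
      using Cons.prems(1) by (intro act_cong Cons.prems(2) that) auto
  qed (use Cons.prems in auto)
qed simp

text \<open>
  The action of the free algebra, extended linearly from words.
\<close>

definition pact :: "('f, 'k) free_elem \<Rightarrow> ('k idx \<Rightarrow> 'f)
    \<Rightarrow> 'k idx \<Rightarrow> 'f" where
  "pact p \<phi> b = (\<Sum>w\<in>Poly_Mapping.keys p. Poly_Mapping.lookup p w * fold act (letters w) \<phi> b)"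

lemma pact_superset:
  assumes "finite I" "Poly_Mapping.keys p \<subseteq> I"
  shows "pact p \<phi> b = (\<Sum>w\<in>I. Poly_Mapping.lookup p w * fold act (letters w) \<phi> b)"
  unfolding pact_def by (rule sum.mono_neutral_left) (use assms in \<open>auto simp: in_keys_iff\<close>)

lemma pact_single: "pact (Poly_Mapping.single w a) \<phi> b = a * fold act (letters w) \<phi> b"
  using pact_superset[of "{w}" "Poly_Mapping.single w a"] by simp

lemma pact_add: "pact (p + q) \<phi> b = pact p \<phi> b + pact q \<phi> b"
proof -
  let ?I = "Poly_Mapping.keys p \<union> Poly_Mapping.keys q"
  have "pact (p + q) \<phi> b = (\<Sum>w\<in>?I. Poly_Mapping.lookup (p + q) w * fold act (letters w) \<phi> b)"
    by (rule pact_superset) (use keys_add[of p q] in auto)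
  also have "\<dots> = pact p \<phi> b + pact q \<phi> b"
    by (simp add: pact_superset[of ?I] lookup_add distrib_right sum.distrib)
  finally show ?thesis .
qed

lemma pact_0: "pact 0 \<phi> b = 0"
  by (simp add: pact_def)

lemma pact_minus: "pact (p - q) \<phi> b = pact p \<phi> b - pact q \<phi> b"
  using pact_add[of "p - q" q \<phi> b] by simp

lemma pact_fun_add: "pact q (\<lambda>b. \<phi> b + \<psi> b) b = pact q \<phi> b + pact q \<psi> b"
  by (simp add: pact_def fold_act_add distrib_left sum.distrib)

lemma pact_fun_mult: "pact q (\<lambda>b. a * \<phi> b) b = a * pact q \<phi> b"
  by (simp add: pact_def fold_act_mult sum_distrib_left mult.left_commute)

lemma pact_cong:
  "q \<in> carrier FA \<Longrightarrow> (\<And>b. valid b \<Longrightarrow> \<phi> b = \<psi> b) \<Longrightarrow> valid b \<Longrightarrow> pact q \<phi> b = pact q \<psi> b"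
  unfolding pact_def by (intro sum.cong refl arg_cong2[where f = "(*)"] fold_act_cong) (auto simp: free_alg_simps(1))

lemma pact_mult: "pact (p * q) \<phi> b = pact q (pact p \<phi>) b"
proof (induction p rule: poly_mapping_single_induct)
  case (single v a)
  show ?case
  proof (induction q rule: poly_mapping_single_induct)
    case (single w a')
    have "pact (Poly_Mapping.single v a) \<phi> = (\<lambda>b. a * fold act (letters v) \<phi> b)"
      by (rule ext) (rule pact_single)
    then show ?case
      by (simp add: mult_single pact_single fold_act_mult plus_free_word_def)
  next
    case (add p q) then show ?case by (simp add: distrib_left pact_add)
  qed
next
  case (add p p')
  have "pact (p + p') \<phi> = (\<lambda>b. pact p \<phi> b + pact p' \<phi> b)" by (rule ext) (rule pact_add)
  then show ?case using add by (simp add: distrib_right pact_add pact_fun_add)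
qed

lemma pact_gen: "pact (free_gen g) \<phi> = act g \<phi>"
  by (rule ext) (simp add: free_gen_def pact_single)

lemma pact_one: "pact 1 \<phi> b = \<phi> b"
  by (simp add: single_one[symmetric] pact_single zero_free_word_def del: single_one)

lemma pact_scal: "pact (Poly_Mapping.single 0 a) \<phi> b = a * \<phi> b"
  by (simp add: pact_single zero_free_word_def)

lemma H0_ops:
  "(p, d) \<in> UNIV \<times> E \<Longrightarrow> (f \<oplus>\<^bsub>H0\<^esub> g) (p, d) = f (p, d) + g (p, d)"
  "(p, d) \<in> UNIV \<times> E \<Longrightarrow> (f \<otimes>\<^bsub>H0\<^esub> g) (p, d) = f (p, d) * g (p, d)"
  "(p, d) \<in> UNIV \<times> E \<Longrightarrow> (a \<odot>\<^bsub>H0\<^esub> f) (p, d) = a * f (p, d)"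
  "(p, d) \<in> UNIV \<times> E \<Longrightarrow> \<one>\<^bsub>H0\<^esub> (p, d) = 1"
  "(p, d) \<in> UNIV \<times> E \<Longrightarrow> \<zero>\<^bsub>H0\<^esub> (p, d) = 0"
  by (simp_all add: A_H0_def fun_alg_simps SG_simps)

lemma axis_cancel [simp]: "axis j 1 + axis j (- 1) = (0 :: int^'k)" "axis j (- 1) + (axis j 1 + p) = (p :: int^'k)" "axis j 1 + (axis j (- 1) + p) = (p :: int^'k)"
  by (simp_all add: vec_eq_iff axis_def)

lemma zeta_cancel [simp]: "inverse (\<zeta>$j) * (\<zeta>$j * x) = x" "\<zeta>$j * (inverse (\<zeta>$j) * x) = x"
  by (simp_all add: mult.assoc[symmetric])

lemma axis_index: "axis j a $ i = (if i = j then a else 0)" for a :: "'b::zero"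
  by (simp add: axis_def)

lemma pact_rel:
  assumes "(l, r) \<in> rels" "valid b"
  shows "pact l \<phi> b = pact r \<phi> b"
proof -
  obtain e e' m n p d where b: "b = (e, e', m, n, p, d)" by (cases b) auto
  with assms(2) have d: "d \<in> E" by simp
  note s = b pact_mult pact_add pact_minus pact_gen pact_one pact_scal pact_0
  from assms(1) show ?thesis
  proof cases
    case (h_add f g) then show ?thesis using d by (simp add: s H0_ops algebra_simps)
  next
    case (h_mult f g) then show ?thesis using d by (simp add: s H0_ops algebra_simps)
  next
    case (h_smult f a) 
    have "pact (Poly_Mapping.single 0 a) \<phi> = (\<lambda>b. a * \<phi> b)" by (rule ext) (rule pact_scal)
    with h_smult show ?thesis using d by (simp add: s H0_ops algebra_simps)
  next
    case h_one then show ?thesis using d by (simp add: s H0_ops)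
  next
    case t_zero then show ?thesis by (simp add: s)
  next
    case (t_plus e e') then show ?thesis by (simp add: s algebra_simps)
  next
    case (t_minus e e') then show ?thesis by (simp add: s algebra_simps)
  next
    case (t_comm e e') then show ?thesis by (simp add: s algebra_simps)
  next
    case (t_h a f) then show ?thesis using d by (simp add: s ltrans_apply SG_simps E_add)
  next
    case (x_h f t j)
    show ?thesis unfolding x_h(1,2) using d
      by (cases t) (simp_all add: s ltrans_apply SG_simps zeta_E z_axis distrib_left mult.left_commute)
  next
    case (x_comm j j' t t')
    then have "j' \<noteq> j" by simp
    with \<open>j \<noteq> j'\<close> show ?thesis unfolding x_comm(1,2)
      by (cases t; cases t') (simp_all add: s axis_index algebra_simps)
  next
    case (x_weyl j)
    show ?thesis unfolding x_weyl by (simp add: s axis_index algebra_simps)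
  next
    case (x_t a t j)
    have "max (z * a) 0 = z * max a 0" "max (- (z * a)) 0 = z * max (- a) 0" if "0 < z" for z :: real
      using that by (auto simp: max_def mult_le_0_iff zero_le_mult_iff)
    then show ?thesis unfolding x_t(1,2) using zeta_pos[of j]
      by (cases t) (simp_all add: s distrib_left)
  qed
qed

text \<open>
  The elements that act as zero at valid indices form a two-sided ideal, as generators preserve
  validity; it contains the relations.
\<close>

lemma pact_ideal:
  assumes "p \<in> rel_ideal gens rels" "valid b"
  shows "pact p \<phi> b = 0"
proof -
  let ?K = "{p \<in> carrier FA. \<forall>\<phi> b. valid b \<longrightarrow> pact p \<phi> b = 0}"
  have "ideal ?K FA"
  proof (rule free_alg_idealI)
    fix p q assume p: "p \<in> ?K" and q: "q \<in> carrier FA"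
    have "pact (p * q) \<phi> b = 0" if "valid b" for \<phi> b
    proof -
      have "pact (p * q) \<phi> b = pact q (pact p \<phi>) b" by (rule pact_mult)
      also have "\<dots> = pact q (\<lambda>b. 0 * \<phi> b) b" by (rule pact_cong) (use p q that in auto)
      also have "\<dots> = 0" unfolding pact_fun_mult by simp
      finally show ?thesis .
    qed
    then show "q * p \<in> ?K \<and> p * q \<in> ?K" using p q by (auto simp: pact_mult free_alg_closed)
  qed (auto simp: pact_0 pact_add free_alg_closed)
  then have "rel_ideal gens rels \<subseteq> ?K"
    by (rule J_least) (use rels_closed in \<open>auto simp: pact_rel pact_minus free_alg_closed\<close>)
  with assms show ?thesis by blast
qed

text \<open>
  The resulting action of the algebra. A class acts through a chosen representative, and values at
  indices that are not valid are set to \<open>0\<close>, which makes \<open>rep_mult\<close> hold without side conditions.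
\<close>

definition rep :: "('f, 'k) free_elem set \<Rightarrow> ('k idx \<Rightarrow> 'f)
    \<Rightarrow> 'k idx \<Rightarrow> 'f" where
  "rep Y \<phi> b = (if valid b then pact (SOME p. p \<in> Y) \<phi> b else 0)"

lemma rep_cls:
  assumes p: "p \<in> carrier FA"
  shows "rep (cls p) \<phi> b = (if valid b then pact p \<phi> b else 0)"
proof -
  define q where "q = (SOME q. q \<in> cls p)"
  have "q \<in> cls p" unfolding q_def by (rule someI) (rule cls_self[OF p])
  then have "q - p \<in> rel_ideal gens rels" by (simp add: cls_mem_iff[OF p])
  then have "valid b \<Longrightarrow> pact q \<phi> b = pact p \<phi> b" using pact_ideal[of "q - p" b \<phi>] by (simp add: pact_minus)
  then show ?thesis by (simp add: rep_def flip: q_def)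
qed

lemma rep_gen: "g \<in> gens \<Longrightarrow> valid b \<Longrightarrow> rep (A_cls \<zeta> E c g) \<phi> b = act g \<phi> b"
  by (simp add: A_cls_eq rep_cls free_gen_closed pact_gen)

lemma A_obtain: "x \<in> carrier A \<Longrightarrow> \<exists>p\<in>carrier FA. x = cls p"
  using carrier_presented by (auto simp: A_presented)

lemmas cls_ops = cls_add[unfolded A_presented] cls_mult[unfolded A_presented] cls_smult[unfolded A_presented]
  cls_one[unfolded A_presented] cls_scal[unfolded A_presented] cls_zero[unfolded A_presented]

lemma rep_mult:
  assumes "x \<in> carrier A" "y \<in> carrier A"
  shows "rep (x \<cdot> y) \<phi> b = rep y (rep x \<phi>) b"
proof -
  obtain p where p: "p \<in> carrier FA" "x = cls p" using A_obtain[OF assms(1)] by blast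
  obtain q where q: "q \<in> carrier FA" "y = cls q" using A_obtain[OF assms(2)] by blast
  have "pact q (pact p \<phi>) b = pact q (rep x \<phi>) b" if "valid b"
    by (rule pact_cong[OF q(1) _ that]) (simp add: p rep_cls)
  then show ?thesis using p(1) q(1)
    by (simp add: p(2) q(2) rep_cls free_alg_closed pact_mult flip: cls_ops(2))
qed

lemma rep_add:
  assumes "x \<in> carrier A" "y \<in> carrier A"
  shows "rep (x \<oplus>\<^bsub>A\<^esub> y) \<phi> b = rep x \<phi> b + rep y \<phi> b"
proof -
  obtain p where p: "p \<in> carrier FA" "x = cls p" using A_obtain[OF assms(1)] by blast
  obtain q where q: "q \<in> carrier FA" "y = cls q" using A_obtain[OF assms(2)] by blast
  show ?thesis using p q by (simp add: rep_cls free_alg_closed pact_add flip: cls_ops(1))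
qed

lemma rep_zero: "rep \<zero>\<^bsub>A\<^esub> \<phi> b = 0"
  by (simp add: rep_cls free_alg_closed pact_0 flip: cls_ops(6))

lemma rep_one: "rep \<one>\<^bsub>A\<^esub> \<phi> b = (if valid b then \<phi> b else 0)"
  by (simp add: rep_cls free_alg_closed pact_one flip: cls_ops(4))

sublocale A: falg A
  using falg by (simp add: A_presented)

lemma rep_finsum:
  assumes "\<And>i. i \<in> I \<Longrightarrow> f i \<in> carrier A"
  shows "rep (\<Oplus>\<^bsub>A\<^esub>i\<in>I. f i) \<phi> b = (\<Sum>i\<in>I. rep (f i) \<phi> b)"
  using assms
proof (induction I rule: infinite_finite_induct)
  case (insert i I)
  then have "f \<in> I \<rightarrow> carrier A" "f i \<in> carrier A" by auto
  then show ?case using insert by (simp add: rep_add)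
qed (simp_all add: rep_zero A.finsum_infinite)

end

section \<open>The anti-involution\<close>

lemma free_flip_add: "free_flip (p + q) = free_flip p + free_flip q"
  by (rule poly_mapping_eqI) (simp add: lookup_free_flip lookup_add)

lemma free_flip_minus: "free_flip (p - q) = free_flip p - free_flip q"
  by (rule poly_mapping_eqI) (simp add: lookup_free_flip lookup_minus)

lemma free_flip_zero: "free_flip 0 = 0"
  by (rule poly_mapping_eqI) (simp add: lookup_free_flip)

lemma free_flip_free_flip [simp]: "free_flip (free_flip p) = p"
  by (rule poly_mapping_eqI) (simp add: lookup_free_flip)

lemma free_flip_single:
  fixes w :: "('f::field, 'k::finite) gens free_word"
  shows "free_flip (Poly_Mapping.single w a) = Poly_Mapping.single (flip_word w) a"
proof (rule poly_mapping_eqI)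
  fix v :: "('f, 'k) gens free_word"
  have "w = flip_word v \<longleftrightarrow> flip_word w = v" by (metis flip_word_flip_word)
  then show "Poly_Mapping.lookup (free_flip (Poly_Mapping.single w a)) v
      = Poly_Mapping.lookup (Poly_Mapping.single (flip_word w) a) v"
    by (simp add: lookup_free_flip lookup_single when_def)
qed

lemma set_flip_word: "set (letters (flip_word w)) = flip_gen ` set (letters w)"
  by (simp add: flip_word_def)

lemma flip_word_plus: "flip_word (v + w) = flip_word w + flip_word v"
  by (simp add: flip_word_def plus_free_word_def)

lemma flip_word_zero [simp]: "flip_word 0 = 0"
  by (simp add: flip_word_def zero_free_word_def)

text \<open>
  Reversing words and exchanging generators is an anti-automorphism of the free algebra.
\<close>

lemma free_flip_mult: "free_flip (p * q) = free_flip q * free_flip p"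
proof (induction p rule: poly_mapping_single_induct)
  case (single v a)
  show ?case
    by (induction q rule: poly_mapping_single_induct)
      (simp_all add: mult_single free_flip_single flip_word_plus mult.commute distrib_left distrib_right free_flip_add)
next
  case (add p p')
  then show ?case by (simp add: distrib_left distrib_right free_flip_add)
qed

lemma free_flip_scal: "free_flip (Poly_Mapping.single 0 a) = Poly_Mapping.single 0 a"
  by (simp add: free_flip_single)

lemma free_flip_one: "free_flip 1 = 1"
  using free_flip_scal[of 1] by simp

lemma free_flip_gen: "free_flip (free_gen g) = free_gen (flip_gen g)"
  by (simp add: free_gen_def free_flip_single flip_word_def)

context zeta_alg
begin

text \<open>
  The images of the generators in the algebra, followed by the defining relations.
\<close>

abbreviation "hh f \<equiv> A_cls \<zeta> E c (GenH f)"
abbreviation "tt e \<equiv> A_cls \<zeta> E c (GenT e)"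
abbreviation "xx s j \<equiv> A_cls \<zeta> E c (GenX s j)"

lemma A_cls_closed: "g \<in> gens \<Longrightarrow> A_cls \<zeta> E c g \<in> carrier A"
  using cls_closed[OF free_gen_closed] by (simp add: A_presented A_cls_eq)

lemma gen_closed [simp]: "f \<in> carrier H0 \<Longrightarrow> hh f \<in> carrier A" "e \<in> E \<Longrightarrow> tt e \<in> carrier A" "xx s j \<in> carrier A"
  by (simp_all add: A_cls_closed gens_iff)

lemmas c_ops = cls_ops free_gens_closed free_alg_closed

interpretation H0: falg H0 by (rule H0_falg)

lemma hh_add: "f \<in> carrier H0 \<Longrightarrow> g \<in> carrier H0 \<Longrightarrow> hh (f \<oplus>\<^bsub>H0\<^esub> g) = hh f \<oplus>\<^bsub>A\<^esub> hh g"
  using cls_rel[OF A_rels.h_add[of f \<zeta> E g c]] by (simp add: A_cls_eq c_ops)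

lemma hh_mult: "f \<in> carrier H0 \<Longrightarrow> g \<in> carrier H0 \<Longrightarrow> hh (f \<otimes>\<^bsub>H0\<^esub> g) = hh f \<cdot> hh g"
  using cls_rel[OF A_rels.h_mult[of f \<zeta> E g c]] by (simp add: A_cls_eq c_ops)

lemma hh_smult: "f \<in> carrier H0 \<Longrightarrow> hh (a \<odot>\<^bsub>H0\<^esub> f) = a \<odot>\<^bsub>A\<^esub> hh f"
  using cls_rel[OF A_rels.h_smult[of f \<zeta> E a c]] by (simp add: A_cls_eq cls_ops(3) free_gens_closed)

lemma hh_one: "hh \<one>\<^bsub>H0\<^esub> = \<one>\<^bsub>A\<^esub>"
  using cls_rel[OF A_rels.h_one[of \<zeta> E c]] by (simp add: A_cls_eq c_ops)

lemma tt_zero: "tt 0 = \<one>\<^bsub>A\<^esub>"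
  using cls_rel[OF A_rels.t_zero[of \<zeta> E c]] by (simp add: A_cls_eq c_ops)

lemma tt_plus: "e \<in> E \<Longrightarrow> e' \<in> E \<Longrightarrow> 0 \<le> e \<Longrightarrow> 0 \<le> e' \<Longrightarrow> tt e \<cdot> tt e' = tt (e + e')"
  using cls_rel[OF A_rels.t_plus[of e E e' \<zeta> c]] by (simp add: A_cls_eq c_ops)

lemma tt_minus: "e \<in> E \<Longrightarrow> e' \<in> E \<Longrightarrow> 0 \<le> e \<Longrightarrow> 0 \<le> e' \<Longrightarrow> tt (- e) \<cdot> tt (- e') = tt (- e - e')"
  using cls_rel[OF A_rels.t_minus[of e E e' \<zeta> c]] by (simp add: A_cls_eq c_ops E_neg)

lemma tt_comm: "e \<in> E \<Longrightarrow> e' \<in> E \<Longrightarrow> 0 \<le> e \<Longrightarrow> 0 \<le> e' \<Longrightarrow> tt e \<cdot> tt (- e') = tt (- e') \<cdot> tt e"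
  using cls_rel[OF A_rels.t_comm[of e E e' \<zeta> c]] by (simp add: A_cls_eq c_ops E_neg)

lemma tt_h: "e \<in> E \<Longrightarrow> f \<in> carrier H0 \<Longrightarrow> tt e \<cdot> hh f = hh (ltrans SG (0, - e) f) \<cdot> tt e"
  using cls_rel[OF A_rels.t_h[of e E f \<zeta> c]] by (simp add: A_cls_eq c_ops H0_ltrans)

lemma xx_h: "f \<in> carrier H0 \<Longrightarrow> xx s j \<cdot> hh f = hh (ltrans SG (axis j (- pm_int s), 0) f) \<cdot> xx s j"
  using cls_rel[OF A_rels.x_h[of f \<zeta> E s j c]] by (simp add: A_cls_eq c_ops H0_ltrans)

lemma xx_t: "e \<in> E \<Longrightarrow> xx s j \<cdot> tt e = tt (\<zeta>$j powi pm_int s * e) \<cdot> xx s j"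
  using cls_rel[OF A_rels.x_t[of e E s j \<zeta> c]] by (simp add: A_cls_eq c_ops zeta_powi_E)

lemma xx_comm:
  assumes "j \<noteq> j'"
  shows "xx s j \<cdot> xx s' j' = xx s' j' \<cdot> xx s j"
proof -
  let ?a = "free_gen (GenX s j) :: ('f, 'k) free_elem" and ?b = "free_gen (GenX s' j') :: ('f, 'k) free_elem"
  have "?a * ?b - ?b * ?a - 0 \<in> rel_ideal gens rels"
    using cls_rel[OF A_rels.x_comm[OF assms]] cls_eq_iff[of "?a * ?b - ?b * ?a" 0]
    by (simp add: free_gens_closed free_alg_closed)
  then have "cls (?a * ?b) = cls (?b * ?a)"
    by (subst cls_eq_iff) (simp_all add: free_gens_closed free_alg_closed)
  then show ?thesis by (simp add: A_cls_eq c_ops)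
qed

lemma xx_weyl:
  "xx Plus j \<cdot> xx Minus j = xx Minus j \<cdot> xx Plus j \<oplus>\<^bsub>A\<^esub> c$j \<odot>\<^bsub>A\<^esub> \<one>\<^bsub>A\<^esub>"
proof -
  let ?a = "free_gen (GenX Plus j) :: ('f, 'k) free_elem" and ?b = "free_gen (GenX Minus j) :: ('f, 'k) free_elem"
  let ?s = "Poly_Mapping.single 0 (c$j) :: ('f, 'k) free_elem"
  have "?a * ?b - ?b * ?a - ?s \<in> rel_ideal gens rels"
    using cls_rel[OF A_rels.x_weyl[of j c \<zeta> E]] cls_eq_iff[of "?a * ?b - ?b * ?a" ?s]
    by (simp add: free_gens_closed free_alg_closed)
  then have "cls (?a * ?b) = cls (?b * ?a + ?s)"
    by (subst cls_eq_iff) (simp_all add: free_gens_closed free_alg_closed diff_diff_eq)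
  then show ?thesis by (simp add: A_cls_eq c_ops)
qed

lemma flip_gen_mem: "g \<in> gens \<Longrightarrow> flip_gen g \<in> gens"
  by (cases g) (simp_all add: gens_iff E_neg)

lemma free_flip_closed:
  assumes "p \<in> carrier FA"
  shows "free_flip p \<in> carrier FA"
  unfolding free_alg_simps(1)
proof (rule CollectI, rule subsetI)
  fix w assume "w \<in> Poly_Mapping.keys (free_flip p)"
  then have "flip_word w \<in> Poly_Mapping.keys p" by (simp add: in_keys_iff lookup_free_flip)
  then have sub: "set (letters (flip_word w)) \<subseteq> gens" using assms unfolding free_alg_simps(1) by blast
  have "set (letters w) = flip_gen ` set (letters (flip_word w))"
    using set_flip_word[of "flip_word w"] by simp
  also have "\<dots> \<subseteq> gens"
    by (rule image_subsetI, rule flip_gen_mem, rule subsetD[OF sub])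
  finally show "w \<in> {w. set (letters w) \<subseteq> gens}" by (rule CollectI)
qed

text \<open>
  The anti-automorphism maps each defining relation to a consequence of the relations. For \<open>h_mult\<close> this
  uses that \<open>H0\<close> is commutative.
\<close>

lemma flip_rel:
  assumes "(l, r) \<in> rels"
  shows "cls (free_flip l) = cls (free_flip r)"
  using assms
proof cases
  case (h_add f g)
  then show ?thesis by (simp add: free_flip_add free_flip_gen c_ops hh_add flip: A_cls_eq)
next
  case (h_mult f g)
  then have "f \<otimes>\<^bsub>H0\<^esub> g = g \<otimes>\<^bsub>H0\<^esub> f" by (simp add: A_H0_def fun_alg_simps(2) mult.commute)
  with h_mult show ?thesis by (simp add: free_flip_mult free_flip_gen c_ops hh_mult flip: A_cls_eq)
next
  case (h_smult f a)
  then show ?thesis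
    by (simp add: free_flip_mult free_flip_scal single_0_commute free_flip_gen cls_ops(3) free_gens_closed hh_smult
        flip: A_cls_eq)
next
  case h_one then show ?thesis by (simp add: free_flip_one free_flip_gen c_ops hh_one flip: A_cls_eq)
next
  case t_zero then show ?thesis by (simp add: free_flip_one free_flip_gen c_ops tt_zero flip: A_cls_eq)
next
  case (t_plus e e')
  then show ?thesis
    by (simp add: free_flip_mult free_flip_gen c_ops E_neg tt_minus add.commute flip: A_cls_eq)
next
  case (t_minus e e')
  then show ?thesis
    by (simp add: free_flip_mult free_flip_gen c_ops E_neg tt_plus add.commute flip: A_cls_eq)
next
  case (t_comm e e')
  then show ?thesis
    by (simp add: free_flip_mult free_flip_gen c_ops E_neg tt_comm flip: A_cls_eq)
next
  case (t_h e f)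
  have "ltrans SG (0, e) (ltrans SG (0, - e) f) = f"
    using t_h E_neg SG.ltrans_ltrans[of "(0, e)" "(0, - e)" f] SG.ltrans_one[of f]
    by (simp add: SG_simps A_H0_def)
  with t_h show ?thesis
    by (simp add: free_flip_mult free_flip_gen c_ops E_neg H0_ltrans tt_h flip: A_cls_eq)
next
  case (x_h f s j)
  have "ltrans SG (axis j (pm_int s), 0) (ltrans SG (axis j (- pm_int s), 0) f) = f"
    using x_h E_zero SG.ltrans_ltrans[of "(axis j (pm_int s), 0)" "(axis j (- pm_int s), 0)" f] SG.ltrans_one[of f]
    by (cases s) (simp_all add: SG_simps A_H0_def add.commute)
  with x_h show ?thesis
    by (cases s) (simp_all add: free_flip_mult free_flip_gen c_ops H0_ltrans xx_h flip: A_cls_eq)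
next
  case (x_comm j j' s s')
  then have "cls (free_flip l) = cls 0" 
    using xx_comm[of j j' "pm_neg s" "pm_neg s'"] cls_eq_iff[of "free_gen (GenX (pm_neg s') j') * free_gen (GenX (pm_neg s) j)" "free_gen (GenX (pm_neg s) j) * free_gen (GenX (pm_neg s') j')"]
      cls_eq_iff[of "free_gen (GenX (pm_neg s') j') * free_gen (GenX (pm_neg s) j) - free_gen (GenX (pm_neg s) j) * free_gen (GenX (pm_neg s') j')" 0]
    by (simp add: free_flip_mult free_flip_minus free_flip_gen free_gens_closed free_alg_closed A_cls_eq cls_ops)
  with x_comm show ?thesis by (simp add: free_flip_zero)
next
  case (x_weyl j)
  then have "free_flip l = l" "free_flip r = r"
    by (simp_all add: free_flip_mult free_flip_minus free_flip_gen free_flip_scal)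
  then show ?thesis using cls_rel[OF assms] by simp
next
  case (x_t e s j)
  have "\<zeta>$j powi pm_int (pm_neg s) * (- (\<zeta>$j powi pm_int s * e)) = - e"
    by (cases s) simp_all
  then have "xx (pm_neg s) j \<cdot> tt (- (\<zeta>$j powi pm_int s * e)) = tt (- e) \<cdot> xx (pm_neg s) j"
    using xx_t[OF E_neg[OF zeta_powi_E[OF x_t(3)]], of "pm_neg s" j j "pm_int s"] by (simp only:)
  then show ?thesis using x_t zeta_powi_E
    by (simp add: free_flip_mult free_flip_gen c_ops E_neg flip: A_cls_eq)
qed

lemma free_flip_ideal:
  assumes "p \<in> rel_ideal gens rels"
  shows "free_flip p \<in> rel_ideal gens rels"
proof -
  let ?J = "rel_ideal gens rels"
  let ?K = "{p \<in> carrier FA. free_flip p \<in> ?J}"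
  interpret J: ideal ?J FA by (rule ideal_J)
  interpret FA: falg FA by (rule free_alg_falg)
  note J = FA.subspaceD[OF FA.ideal_subspace[OF ideal_J], unfolded free_alg_simps(4,5)]
  have K: "ideal ?K FA"
  proof (rule free_alg_idealI)
    show "0 \<in> ?K" using J(2) by (simp add: free_flip_zero free_alg_closed)
    show "p + q \<in> ?K" if "p \<in> ?K" "q \<in> ?K" for p q
      using that J(3)[of "free_flip p" "free_flip q"] by (simp add: free_flip_add free_alg_closed)
    show "q * p \<in> ?K \<and> p * q \<in> ?K" if "p \<in> ?K" "q \<in> carrier FA" for p q
      using that J.I_l_closed[of "free_flip p" "free_flip q"] J.I_r_closed[of "free_flip p" "free_flip q"]
      by (simp add: free_flip_mult free_alg_closed free_flip_closed free_alg_simps(2))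
  qed auto
  have "l - r \<in> ?K" if "(l, r) \<in> rels" for l r
    using flip_rel[OF that] rels_closed[OF that] cls_eq_iff[of "free_flip l" "free_flip r"]
    by (simp add: free_flip_closed free_flip_minus free_alg_closed)
  then have "?J \<subseteq> ?K" by (rule J_least[OF K])
  with assms show ?thesis by blast
qed

lemma inv_cls:
  assumes p: "p \<in> carrier FA"
  shows "A_inv (cls p) = cls (free_flip p)"
proof (rule equalityI; rule subsetI)
  fix q assume "q \<in> A_inv (cls p)"
  then obtain q' where q': "q' \<in> carrier FA" "q' - p \<in> rel_ideal gens rels" "q = free_flip q'"
    using cls_mem_iff[OF p] by (auto simp: A_inv_def)
  then show "q \<in> cls (free_flip p)"
    using free_flip_ideal[OF q'(2)] by (simp add: cls_mem_iff[OF free_flip_closed[OF p]] free_flip_closed free_flip_minus)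
next
  fix q assume "q \<in> cls (free_flip p)"
  then have q: "q \<in> carrier FA" "q - free_flip p \<in> rel_ideal gens rels"
    using cls_mem_iff[OF free_flip_closed[OF p]] by auto
  from free_flip_ideal[OF q(2)] q(1) have "free_flip q \<in> cls p"
    by (simp add: cls_mem_iff[OF p] free_flip_closed free_flip_minus)
  then have "free_flip (free_flip q) \<in> A_inv (cls p)" unfolding A_inv_def by (rule imageI)
  then show "q \<in> A_inv (cls p)" by simp
qed

lemma inv_closed: "x \<in> carrier A \<Longrightarrow> A_inv x \<in> carrier A"
  using A_obtain[of x] cls_closed[unfolded A_presented] by (auto simp: inv_cls free_flip_closed)

lemma inv_mult: "x \<in> carrier A \<Longrightarrow> y \<in> carrier A \<Longrightarrow> A_inv (x \<cdot> y) = A_inv y \<cdot> A_inv x"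
  using A_obtain[of x] A_obtain[of y]
  by (auto simp: inv_cls free_flip_closed free_alg_closed free_flip_mult simp flip: cls_ops(2))

lemma inv_add: "x \<in> carrier A \<Longrightarrow> y \<in> carrier A \<Longrightarrow> A_inv (x \<oplus>\<^bsub>A\<^esub> y) = A_inv x \<oplus>\<^bsub>A\<^esub> A_inv y"
  using A_obtain[of x] A_obtain[of y]
  by (auto simp: inv_cls free_flip_closed free_alg_closed free_flip_add simp flip: cls_ops(1))

lemma inv_smult: "x \<in> carrier A \<Longrightarrow> A_inv (a \<odot>\<^bsub>A\<^esub> x) = a \<odot>\<^bsub>A\<^esub> A_inv x"
  using A_obtain[of x]
  by (auto simp: inv_cls free_flip_closed free_alg_closed free_flip_mult free_flip_scal single_0_commute
      simp flip: cls_ops(3))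

lemma inv_one: "A_inv \<one>\<^bsub>A\<^esub> = \<one>\<^bsub>A\<^esub>"
  by (simp add: inv_cls free_alg_closed free_flip_one flip: cls_ops(4))

lemma inv_inv: "x \<in> carrier A \<Longrightarrow> A_inv (A_inv x) = x"
  using A_obtain[of x] by (auto simp: inv_cls free_flip_closed)

lemma inv_gen: "g \<in> gens \<Longrightarrow> A_inv (A_cls \<zeta> E c g) = A_cls \<zeta> E c (flip_gen g)"
  by (simp add: A_cls_eq inv_cls free_gen_closed free_flip_gen)

lemma anti_involution_inv: "anti_involution A A_inv"
  by (simp add: anti_involution_def inv_closed inv_mult inv_add inv_smult inv_one inv_inv)

end

section \<open>Monomials\<close>

text \<open>
  Exponent vectors in \<open>\<nat>\<^sup>k\<close> are represented by lists of indices; \<open>vsum js\<close> counts how often each index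
  occurs.
\<close>

definition vsum :: "'k list \<Rightarrow> int^'k" where
  "vsum js = (\<Sum>j\<leftarrow>js. axis j 1)"

lemma vsum_simps [simp]: "vsum [] = 0" "vsum (j # js) = axis j 1 + vsum js" "vsum (js @ js') = vsum js + vsum js'"
  by (simp_all add: vsum_def)

lemma vsum_index: "vsum js $ j = int (count_list js j)"
  by (induction js) (simp_all add: axis_def)

lemma vsum_nonneg: "0 \<le> vsum js $ j"
  by (simp add: vsum_index)

lemma vsum_surj:
  fixes n :: "int^'k"
  assumes "\<And>j. 0 \<le> n$j"
  shows "\<exists>js. vsum js = n"
proof -
  have r: "vsum (replicate m j) = axis j (int m)" for m and j :: 'k
    by (induction m) (auto simp: vec_eq_iff axis_def)
  have "\<exists>js. vsum js = (\<chi> j. if j \<in> I then n$j else 0)" if "finite I" for I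
    using that
  proof (induction I)
    case empty
    show ?case by (rule exI[of _ "[]"]) (simp add: vec_eq_iff)
  next
    case (insert i I)
    then obtain js where "vsum js = (\<chi> j. if j \<in> I then n$j else 0)" by blast
    then have "vsum (replicate (nat (n$i)) i @ js) = (\<chi> j. if j \<in> insert i I then n$j else 0)"
      using insert.hyps assms[of i] by (auto simp: r vec_eq_iff axis_def)
    then show ?case by blast
  qed
  from this[of UNIV] show ?thesis by (simp add: vec_nth_inverse)
qed

context zeta_alg
begin

interpretation H0: falg H0 by (rule H0_falg)

text \<open>
  The product of the generators \<open>x\<^sub>j\<^sup>\<plusminus>\<close> along a list. As these commute for a fixed sign, it depends on the
  exponent vector only (\<open>xlist_eq\<close>).
\<close>

primrec xlist :: "pm \<Rightarrow> 'k list \<Rightarrow> ('f, 'k) free_elem set" where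
  "xlist s [] = \<one>\<^bsub>A\<^esub>"
| "xlist s (j # js) = xx s j \<cdot> xlist s js"

lemma xlist_closed [simp]: "xlist s js \<in> carrier A"
  by (induction js) simp_all

lemma xlist_append: "xlist s (js @ js') = xlist s js \<cdot> xlist s js'"
  by (induction js) (simp_all add: A.m_assoc)

lemma xx_comm': "xx s j \<cdot> xx s j' = xx s j' \<cdot> xx s j"
  using xx_comm[of j j' s s] by (cases "j = j'") simp_all

lemma xx_xlist_comm: "xx s j \<cdot> xlist s js = xlist s js \<cdot> xx s j"
proof (induction js)
  case (Cons i js)
  have "xx s j \<cdot> (xx s i \<cdot> xlist s js) = xx s i \<cdot> (xx s j \<cdot> xlist s js)"
    by (simp add: A.m_assoc[symmetric] xx_comm'[of s j i])
  then show ?case by (simp add: Cons A.m_assoc)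
qed simp

lemma xlist_eq:
  "vsum js = vsum js' \<Longrightarrow> xlist s js = xlist s js'"
proof (induction js arbitrary: js')
  case Nil
  have "count_list js' j = 0" for j using Nil vsum_index[of js' j] by simp
  then have "js' = []" by (metis count_list_0_iff list.set_intros(1) neq_Nil_conv)
  then show ?case by simp
next
  case (Cons j js)
  have "0 < vsum js' $ j" unfolding Cons.prems[symmetric] using vsum_nonneg[of js j] by (simp add: axis_def)
  then have "count_list js' j \<noteq> 0" by (simp add: vsum_index)
  then have "j \<in> set js'" using count_notin by metis
  then obtain us vs where js': "js' = us @ j # vs" by (meson split_list)
  have "vsum js = vsum (us @ vs)" using Cons.prems by (simp add: js' algebra_simps)
  from Cons.IH[OF this] show ?case
    by (simp add: js' xlist_append A.m_assoc[symmetric] xx_xlist_comm[symmetric])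
qed

lemma xlist_h:
  "f \<in> carrier H0 \<Longrightarrow> xlist Plus js \<cdot> hh f = hh (ltrans SG (- vsum js, 0) f) \<cdot> xlist Plus js"
proof (induction js)
  case Nil
  have "(0, 0) = \<one>\<^bsub>SG\<^esub>" by (simp add: SG_simps)
  then have "ltrans SG (0, 0) f = f" using Nil SG.ltrans_one[of f] by (simp add: A_H0_def)
  then show ?case using Nil by simp
next
  case (Cons j js)
  let ?f = "ltrans SG (- vsum js, 0) f"
  have 1: "ltrans SG (axis j (- 1), 0) ?f = ltrans SG (- vsum (j # js), 0) f"
  proof -
    have "axis j (- 1) = - (axis j 1 :: int^'k)" by (simp add: vec_eq_iff axis_def)
    then show ?thesis
      using SG.ltrans_ltrans[of "(axis j (- 1), 0)" "(- vsum js, 0)" f] E_zero by (simp add: SG_simps algebra_simps)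
  qed
  have "xlist Plus (j # js) \<cdot> hh f = xx Plus j \<cdot> (hh ?f \<cdot> xlist Plus js)"
    using Cons by (simp add: A.m_assoc)
  also have "\<dots> = (xx Plus j \<cdot> hh ?f) \<cdot> xlist Plus js"
    by (simp add: A.m_assoc H0_ltrans)
  also have "xx Plus j \<cdot> hh ?f = hh (ltrans SG (- vsum (j # js), 0) f) \<cdot> xx Plus j"
    by (rule xx_h[of ?f Plus j, OF H0_ltrans, unfolded pm_int.simps 1])
  finally show ?case by (simp add: A.m_assoc H0_ltrans)
qed

lemma xlist_t_Plus: "e \<in> E \<Longrightarrow> xlist Plus js \<cdot> tt e = tt (z (vsum js) * e) \<cdot> xlist Plus js"
proof (induction js)
  case (Cons j js)
  have "xlist Plus (j # js) \<cdot> tt e = xx Plus j \<cdot> tt (z (vsum js) * e) \<cdot> xlist Plus js"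
    using Cons by (simp add: A.m_assoc z_E)
  then show ?case
    using xx_t[OF z_E[OF Cons.prems, of "vsum js"], of Plus j] zeta_E(1)[OF z_E[OF Cons.prems, of "vsum js"], of j]
    by (simp add: z_add z_axis A.m_assoc z_E Cons.prems mult.assoc)
qed simp

lemma xlist_t_Minus: "e \<in> E \<Longrightarrow> xlist Minus js \<cdot> tt e = tt (z (- vsum js) * e) \<cdot> xlist Minus js"
proof (induction js)
  case (Cons j js)
  have 1: "z (- vsum (j # js)) = inverse (\<zeta>$j) * z (- vsum js)"
    by (simp only: vsum_simps minus_add_distrib z_add) (simp add: z_minus z_axis)
  have "xlist Minus (j # js) \<cdot> tt e = xx Minus j \<cdot> tt (z (- vsum js) * e) \<cdot> xlist Minus js"
    using Cons by (simp add: A.m_assoc z_E)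
  then show ?case
    using xx_t[OF z_E[OF Cons.prems, of "- vsum js"], of Minus j] zeta_E(2)[OF z_E[OF Cons.prems, of "- vsum js"], of j]
    unfolding 1 by (simp add: A.m_assoc z_E Cons.prems mult.assoc)
qed simp

text \<open>
  The derivation rule of the Weyl algebra: \<open>x\<^sub>j\<^sup>+ (x\<^sup>-)\<^sup>m = (x\<^sup>-)\<^sup>m x\<^sub>j\<^sup>+ + m\<^sub>j c\<^sub>j (x\<^sup>-)\<^bsup>m-\<epsilon>\<^esup>\<close> with \<open>\<epsilon> = \<epsilon>\<^sub>j\<close>.
\<close>

lemma xx_Plus_xlist_Minus:
  "xx Plus j \<cdot> xlist Minus js = xlist Minus js \<cdot> xx Plus j
     \<oplus>\<^bsub>A\<^esub> (of_nat (count_list js j) * c$j) \<odot>\<^bsub>A\<^esub> xlist Minus (remove1 j js)"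
proof (induction js)
  case Nil then show ?case by simp
next
  case (Cons i js)
  let ?X = "xlist Minus" and ?k = "of_nat (count_list js j) * c$j"
  note cl = A.m_assoc A.r_distr A.l_distr A.smult_mult_right A.smult_mult_left
  have IH: "xx Minus i \<cdot> (xx Plus j \<cdot> ?X js)
      = ?X (i # js) \<cdot> xx Plus j \<oplus>\<^bsub>A\<^esub> ?k \<odot>\<^bsub>A\<^esub> (xx Minus i \<cdot> ?X (remove1 j js))"
    unfolding Cons by (simp add: cl)
  show ?case
  proof (cases "i = j")
    case False
    have "xx Plus j \<cdot> ?X (i # js) = xx Minus i \<cdot> (xx Plus j \<cdot> ?X js)"
      using xx_comm[of j i Plus Minus] False by (simp add: A.m_assoc[symmetric])
    then show ?thesis using IH False by simp
  next
    case True
    have "xx Plus j \<cdot> ?X (i # js) = (xx Plus j \<cdot> xx Minus j) \<cdot> ?X js"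
      using True by (simp add: A.m_assoc)
    also have "\<dots> = xx Minus j \<cdot> (xx Plus j \<cdot> ?X js) \<oplus>\<^bsub>A\<^esub> c$j \<odot>\<^bsub>A\<^esub> ?X js"
      unfolding xx_weyl by (simp add: cl)
    also have "\<dots> = ?X (i # js) \<cdot> xx Plus j \<oplus>\<^bsub>A\<^esub> (?k \<odot>\<^bsub>A\<^esub> (xx Minus j \<cdot> ?X (remove1 j js)) \<oplus>\<^bsub>A\<^esub> c$j \<odot>\<^bsub>A\<^esub> ?X js)"
      using IH True by (simp add: A.a_assoc)
    also have "?k \<odot>\<^bsub>A\<^esub> (xx Minus j \<cdot> ?X (remove1 j js)) = ?k \<odot>\<^bsub>A\<^esub> ?X js"
    proof (cases "j \<in> set js")
      case True
      then obtain us vs where "js = us @ j # vs" "j \<notin> set us" by (meson split_list_first)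
      then have "vsum (j # remove1 j js) = vsum js" by (simp add: remove1_append algebra_simps)
      then show ?thesis using xlist_eq[of "j # remove1 j js" js Minus] by simp
    qed (simp add: count_list_0_iff)
    also have "?k \<odot>\<^bsub>A\<^esub> ?X js \<oplus>\<^bsub>A\<^esub> c$j \<odot>\<^bsub>A\<^esub> ?X js = (of_nat (count_list (i # js) j) * c$j) \<odot>\<^bsub>A\<^esub> ?X (remove1 j (i # js))"
      using True by (simp add: A.smult_add_left[symmetric] algebra_simps)
    finally show ?thesis .
  qed
qed

lemma inv_xlist: "A_inv (xlist s js) = xlist (pm_neg s) js"
proof (induction js)
  case (Cons j js)
  then show ?case using xx_xlist_comm[of "pm_neg s" j js] by (simp add: inv_mult inv_gen gens_iff)
qed (simp add: inv_one)

text \<open>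
  The monomial with exponent vector \<open>n\<close>, for nonnegative \<open>n\<close>.
\<close>

definition xmon :: "pm \<Rightarrow> int^'k \<Rightarrow> ('f, 'k) free_elem set" where
  "xmon s n = xlist s (SOME js. vsum js = n)"

lemma xmon_vsum: "xmon s (vsum js) = xlist s js"
  unfolding xmon_def by (rule xlist_eq) (rule someI[of "\<lambda>js'. vsum js' = vsum js" js], rule refl)

lemma xmon_closed [simp]: "xmon s n \<in> carrier A"
  by (simp add: xmon_def)

text \<open>
  The monomials of \<open>B\<^sup>+\<close>, indexed by the cone. With \<open>t\<close> on the left, \<open>Pm g\<close> has weight \<open>g\<close>: the pair
  \<open>(n, e)\<close> is the product \<open>(0, e) (n, 0)\<close>.
\<close>

definition Pm :: "(int^'k) \<times> real \<Rightarrow> ('f, 'k) free_elem set" where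
  "Pm g = tt (snd g) \<cdot> xmon Plus (fst g)"

text \<open>
  The monomials of \<open>B\<^sup>-\<close>; \<open>Nm (n, e)\<close> is \<open>(x\<^sup>-)\<^sup>n t\<^bsup>-e\<^esup>\<close>.
\<close>

definition Nm :: "(int^'k) \<times> real \<Rightarrow> ('f, 'k) free_elem set" where
  "Nm g = A_inv (Pm g)"

abbreviation "Cone \<equiv> sdp_nonneg \<zeta> E"

lemma Cone_cases:
  assumes "g \<in> Cone"
  obtains js d where "g = (vsum js, d)" "d \<in> E" "0 \<le> d"
  using assms vsum_surj[of "fst g"] by (cases g) (auto simp: SG_nonneg)

lemma vsum_Cone: "d \<in> E \<Longrightarrow> 0 \<le> d \<Longrightarrow> (vsum js, d) \<in> Cone"
  by (simp add: SG_nonneg vsum_nonneg)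

lemma Pm_vsum: "Pm (vsum js, d) = tt d \<cdot> xlist Plus js"
  by (simp add: Pm_def xmon_vsum)

lemma Nm_vsum: "d \<in> E \<Longrightarrow> Nm (vsum js, d) = xlist Minus js \<cdot> tt (- d)"
  by (simp add: Nm_def Pm_vsum inv_mult inv_xlist inv_gen gens_iff)

lemma Pm_closed [simp]: "g \<in> Cone \<Longrightarrow> Pm g \<in> carrier A"
  by (cases g) (simp add: Pm_def SG_nonneg)

lemma Nm_closed [simp]: "g \<in> Cone \<Longrightarrow> Nm g \<in> carrier A"
  by (simp add: Nm_def inv_closed)

lemma Pm_one: "Pm \<one>\<^bsub>SG\<^esub> = \<one>\<^bsub>A\<^esub>"
  using Pm_vsum[of "[]" 0] by (simp add: SG_simps tt_zero)

lemma Nm_one: "Nm \<one>\<^bsub>SG\<^esub> = \<one>\<^bsub>A\<^esub>"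
  by (simp add: Nm_def Pm_one inv_one)

lemma Pm_mult:
  assumes "g \<in> Cone" "g' \<in> Cone"
  shows "Pm g \<cdot> Pm g' = Pm (g \<otimes>\<^bsub>SG\<^esub> g')"
proof -
  obtain js d where g: "g = (vsum js, d)" "d \<in> E" "0 \<le> d" using assms(1) by (rule Cone_cases)
  obtain js' d' where g': "g' = (vsum js', d')" "d' \<in> E" "0 \<le> d'" using assms(2) by (rule Cone_cases)
  note E' = z_E[OF g'(2), of "vsum js"]
  have "Pm g \<cdot> Pm g' = tt d \<cdot> (xlist Plus js \<cdot> tt d') \<cdot> xlist Plus js'"
    using g g' by (simp add: Pm_vsum A.m_assoc)
  also have "\<dots> = (tt d \<cdot> tt (z (vsum js) * d')) \<cdot> xlist Plus (js @ js')"
    using g g' E' by (simp add: xlist_t_Plus A.m_assoc xlist_append)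
  also have "\<dots> = tt (d + z (vsum js) * d') \<cdot> xlist Plus (js @ js')"
    using g g' E' less_imp_le[OF z_pos] by (simp add: tt_plus)
  also have "\<dots> = Pm (g \<otimes>\<^bsub>SG\<^esub> g')"
    using Pm_vsum[of "js @ js'"] by (simp add: g(1) g'(1) SG_simps)
  finally show ?thesis .
qed

lemma Nm_mult: "g \<in> Cone \<Longrightarrow> g' \<in> Cone \<Longrightarrow> Nm g \<cdot> Nm g' = Nm (g' \<otimes>\<^bsub>SG\<^esub> g)"
  by (simp add: Nm_def inv_mult[symmetric] Pm_mult)

lemma Pm_h:
  assumes "g \<in> Cone" "f \<in> carrier H0"
  shows "Pm g \<cdot> hh f = hh (ltrans SG (inv\<^bsub>SG\<^esub> g) f) \<cdot> Pm g"
proof -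
  obtain js d where g: "g = (vsum js, d)" "d \<in> E" "0 \<le> d" using assms(1) by (rule Cone_cases)
  let ?f = "ltrans SG (- vsum js, 0) f"
  have "Pm g \<cdot> hh f = (tt d \<cdot> hh ?f) \<cdot> xlist Plus js"
    using g assms(2) by (simp add: Pm_vsum A.m_assoc xlist_h H0_ltrans)
  also have "\<dots> = hh (ltrans SG (0, - d) ?f) \<cdot> Pm g"
    using g by (simp add: Pm_vsum A.m_assoc tt_h H0_ltrans)
  also have "ltrans SG (0, - d) ?f = ltrans SG (inv\<^bsub>SG\<^esub> g) f"
    using g E_zero E_neg[of d] SG.ltrans_ltrans[of "(0, - d)" "(- vsum js, 0)" f] SG_inv[of d "vsum js"]
    by (simp add: SG_simps)
  finally show ?thesis .
qed

lemma h_Nm: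
  assumes "g \<in> Cone" "f \<in> carrier H0"
  shows "hh f \<cdot> Nm g = Nm g \<cdot> hh (ltrans SG (inv\<^bsub>SG\<^esub> g) f)"
proof -
  have hh: "A_inv (hh f') = hh f'" if "f' \<in> carrier H0" for f' using that by (simp add: inv_gen gens_iff)
  show ?thesis using arg_cong[OF Pm_h[OF assms], of A_inv] assms
    by (simp add: inv_mult hh H0_ltrans Nm_def)
qed

section \<open>Spanning\<close>

text \<open>
  The span of the products \<open>N\<^sub>g f P\<^sub>h\<close>. The following lemmas show that it is stable under left
  multiplication by each kind of generator.
\<close>

definition Span :: "('f, 'k) free_elem set set" where
  "Span = lin_span A {Nm g \<cdot> hh f \<cdot> Pm g' | g f g'. g \<in> Cone \<and> f \<in> carrier H0 \<and> g' \<in> Cone}"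

lemma Span_gens: "{Nm g \<cdot> hh f \<cdot> Pm g' | g f g'. g \<in> Cone \<and> f \<in> carrier H0 \<and> g' \<in> Cone} \<subseteq> carrier A"
  by auto

lemma Span_base: "g \<in> Cone \<Longrightarrow> f \<in> carrier H0 \<Longrightarrow> g' \<in> Cone \<Longrightarrow> Nm g \<cdot> hh f \<cdot> Pm g' \<in> Span"
  unfolding Span_def by (rule subsetD[OF A.lin_span_incl]) blast

lemma Span_subspace: "submodule Span base_field A"
  unfolding Span_def by (rule A.lin_span_subspace[OF Span_gens])

lemma Span_left_mult:
  assumes a: "a \<in> carrier A"
    and base: "\<And>g f g'. g \<in> Cone \<Longrightarrow> f \<in> carrier H0 \<Longrightarrow> g' \<in> Cone \<Longrightarrow>
      a \<cdot> (Nm g \<cdot> hh f \<cdot> Pm g') \<in> Span"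
    and x: "x \<in> Span"
  shows "a \<cdot> x \<in> Span"
proof -
  note D = A.subspaceD[OF Span_subspace]
  show ?thesis
    using x[unfolded Span_def] Span_gens
  proof (induction rule: A.lin_span_induct)
    case (base x) then show ?case using assms(2) by blast
  next
    case zero show ?case using a D(2) by simp
  next
    case (add x y)
    then have "x \<in> carrier A" "y \<in> carrier A" using D(1) unfolding Span_def by blast+
    then show ?case using a D(3)[OF add(3,4)] by (simp add: A.r_distr)
  next
    case (smult k x)
    then have "x \<in> carrier A" using D(1) unfolding Span_def by blast
    then show ?case using a D(4)[OF smult(2)] by (simp add: A.smult_mult_right)
  qed
qed

lemma Span_h:
  assumes f: "f \<in> carrier H0" and x: "x \<in> Span"
  shows "hh f \<cdot> x \<in> Span"
proof (rule Span_left_mult[OF _ _ x])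
  fix g f' g' assume g: "g \<in> Cone" "f' \<in> carrier H0" "g' \<in> Cone"
  have "hh f \<cdot> (Nm g \<cdot> hh f' \<cdot> Pm g') = (hh f \<cdot> Nm g) \<cdot> hh f' \<cdot> Pm g'"
    using f g by (simp add: A.m_assoc)
  also have "\<dots> = Nm g \<cdot> hh (ltrans SG (inv\<^bsub>SG\<^esub> g) f \<otimes>\<^bsub>H0\<^esub> f') \<cdot> Pm g'"
    using f g by (simp add: h_Nm hh_mult H0_ltrans A.m_assoc)
  finally show "hh f \<cdot> (Nm g \<cdot> hh f' \<cdot> Pm g') \<in> Span"
    using g H0_ltrans by (simp add: Span_base)
qed (simp add: f)

lemma Span_Nm:
  assumes k: "k \<in> Cone" and x: "x \<in> Span"
  shows "Nm k \<cdot> x \<in> Span"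
proof (rule Span_left_mult[OF _ _ x])
  fix g f g' assume g: "g \<in> Cone" "f \<in> carrier H0" "g' \<in> Cone"
  have "Nm k \<cdot> (Nm g \<cdot> hh f \<cdot> Pm g') = Nm (g \<otimes>\<^bsub>SG\<^esub> k) \<cdot> hh f \<cdot> Pm g'"
    using k g by (simp add: A.m_assoc[symmetric] Nm_mult)
  then show "Nm k \<cdot> (Nm g \<cdot> hh f \<cdot> Pm g') \<in> Span"
    using k g by (simp add: Span_base nonneg_mult)
qed (simp add: k)

lemma Span_Pm:
  assumes g: "g \<in> Cone" and k: "k \<in> Cone" and f: "f \<in> carrier H0" and g': "g' \<in> Cone"
  shows "Nm g \<cdot> Pm k \<cdot> (hh f \<cdot> Pm g') \<in> Span"
proof -
  have "Nm g \<cdot> Pm k \<cdot> (hh f \<cdot> Pm g') = Nm g \<cdot> (Pm k \<cdot> hh f) \<cdot> Pm g'"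
    using assms by (simp add: A.m_assoc)
  also have "\<dots> = Nm g \<cdot> hh (ltrans SG (inv\<^bsub>SG\<^esub> k) f) \<cdot> Pm (k \<otimes>\<^bsub>SG\<^esub> g')"
    using assms by (simp add: A.m_assoc H0_ltrans Pm_mult Pm_h nonneg_mult flip: Pm_mult)
  finally show ?thesis using assms by (simp add: Span_base nonneg_mult H0_ltrans)
qed

lemma tt_Cone: "e \<in> E \<Longrightarrow> 0 \<le> e \<Longrightarrow> tt e = Pm (0, e)" "e \<in> E \<Longrightarrow> 0 \<le> e \<Longrightarrow> tt (- e) = Nm (0, e)"
  using Pm_vsum[of "[]" e] Nm_vsum[of e "[]"] E_neg by simp_all

lemma xx_Cone: "xx Plus j = Pm (axis j 1, 0)" "xx Minus j = Nm (axis j 1, 0)"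
  using Pm_vsum[of "[j]" 0] Nm_vsum[of 0 "[j]"] E_zero by (simp_all add: tt_zero)

lemma Cone_gens: "e \<in> E \<Longrightarrow> 0 \<le> e \<Longrightarrow> (0, e) \<in> Cone" "(axis j 1, 0) \<in> Cone"
  by (simp_all add: SG_nonneg E_zero axis_def)

lemma Span_tt:
  assumes e: "e \<in> E" "0 \<le> e" and x: "x \<in> Span"
  shows "tt e \<cdot> x \<in> Span"
proof (rule Span_left_mult[OF _ _ x])
  fix g f g' assume g: "g \<in> Cone" "f \<in> carrier H0" "g' \<in> Cone"
  obtain js d where gd: "g = (vsum js, d)" "d \<in> E" "0 \<le> d" using g(1) by (rule Cone_cases)
  \<comment> \<open>Moving \<open>t\<^sup>e\<close> to the right of \<open>(x\<^sup>-)\<^sup>m\<close> multiplies the exponent by \<open>\<zeta>\<^sup>m\<close>.\<close>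
  let ?e = "z (vsum js) * e"
  have e': "?e \<in> E" "0 \<le> ?e" using e z_E less_imp_le[OF z_pos] by auto
  have "tt e \<cdot> xlist Minus js = xlist Minus js \<cdot> tt ?e"
    using xlist_t_Minus[OF e'(1), of js] by (simp add: z_minus mult.assoc[symmetric])
  then have "tt e \<cdot> Nm g = xlist Minus js \<cdot> (tt ?e \<cdot> tt (- d))"
    using e e' gd E_neg by (simp add: Nm_vsum A.m_assoc[symmetric])
  then have "tt e \<cdot> Nm g = Nm g \<cdot> Pm (0, ?e)"
    using e' gd E_neg by (simp add: Nm_vsum A.m_assoc tt_comm flip: tt_Cone)
  then have "tt e \<cdot> (Nm g \<cdot> hh f \<cdot> Pm g') = Nm g \<cdot> Pm (0, ?e) \<cdot> (hh f \<cdot> Pm g')"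
    using e g Cone_gens(1)[OF e'] by (simp add: A.m_assoc[symmetric])
  then show "tt e \<cdot> (Nm g \<cdot> hh f \<cdot> Pm g') \<in> Span"
    using Span_Pm[OF g(1) Cone_gens(1)[OF e'] g(2,3)] by simp
qed (simp add: e)

lemma Span_xx:
  assumes x: "x \<in> Span"
  shows "xx Plus j \<cdot> x \<in> Span"
proof (rule Span_left_mult[OF _ _ x])
  fix g f g' assume g: "g \<in> Cone" "f \<in> carrier H0" "g' \<in> Cone"
  obtain js d where gd: "g = (vsum js, d)" "d \<in> E" "0 \<le> d" using g(1) by (rule Cone_cases)
  let ?d = "\<zeta>$j * d" and ?k = "of_nat (count_list js j) * c$j" and ?r = "(vsum (remove1 j js), d)"
  have d': "?d \<in> E" "0 \<le> ?d" using gd zeta_E zeta_pos[of j] by auto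
  have cone: "(vsum js, ?d) \<in> Cone" "?r \<in> Cone" using gd d' by (simp_all add: vsum_Cone)
  have xt: "xx Plus j \<cdot> tt (- d) = tt (- ?d) \<cdot> xx Plus j"
    using xx_t[OF E_neg[OF gd(2)], of Plus j] by simp
  have "xx Plus j \<cdot> Nm g = (xx Plus j \<cdot> xlist Minus js) \<cdot> tt (- d)"
    using gd E_neg by (simp add: Nm_vsum A.m_assoc)
  also have "\<dots> = xlist Minus js \<cdot> (xx Plus j \<cdot> tt (- d)) \<oplus>\<^bsub>A\<^esub> ?k \<odot>\<^bsub>A\<^esub> Nm ?r"
    unfolding xx_Plus_xlist_Minus using gd E_neg by (simp add: Nm_vsum A.l_distr A.m_assoc A.smult_mult_left)
  also have "xlist Minus js \<cdot> (xx Plus j \<cdot> tt (- d)) = Nm (vsum js, ?d) \<cdot> Pm (axis j 1, 0)"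
    unfolding xt using d' E_neg[of ?d] by (simp add: Nm_vsum A.m_assoc flip: xx_Cone)
  finally have *: "xx Plus j \<cdot> Nm g = Nm (vsum js, ?d) \<cdot> Pm (axis j 1, 0) \<oplus>\<^bsub>A\<^esub> ?k \<odot>\<^bsub>A\<^esub> Nm ?r" .
  have "xx Plus j \<cdot> (Nm g \<cdot> hh f \<cdot> Pm g') = (xx Plus j \<cdot> Nm g) \<cdot> (hh f \<cdot> Pm g')"
    using g by (simp add: A.m_assoc)
  also have "\<dots> = Nm (vsum js, ?d) \<cdot> Pm (axis j 1, 0) \<cdot> (hh f \<cdot> Pm g')
      \<oplus>\<^bsub>A\<^esub> ?k \<odot>\<^bsub>A\<^esub> (Nm ?r \<cdot> hh f \<cdot> Pm g')"
    unfolding * using g cone Cone_gens(2)[of j] by (simp add: A.l_distr A.m_assoc A.smult_mult_left)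
  finally show "xx Plus j \<cdot> (Nm g \<cdot> hh f \<cdot> Pm g') \<in> Span"
    using Span_Pm[OF cone(1) Cone_gens(2) g(2,3)] Span_base[OF cone(2) g(2,3)]
    by (simp add: A.subspaceD(3,4)[OF Span_subspace])
qed simp

lemma Span_carrier: "Span = carrier A"
proof (rule carrier_generated[unfolded A_presented])
  show "submodule Span base_field A" by (rule Span_subspace)
  show "\<one>\<^bsub>A\<^esub> \<in> Span"
    using Span_base[OF nonneg_one H0.one_closed nonneg_one] by (simp add: Nm_one Pm_one hh_one)
  fix g :: "('f, 'k) gens" and x assume g: "g \<in> gens" and x: "x \<in> Span"
  show "cls (free_gen g) \<cdot> x \<in> Span"
  proof (cases g)
    case (GenH f)
    then show ?thesis using g x Span_h by (simp add: gens_iff flip: A_cls_eq)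
  next
    case (GenT e)
    then have e: "e \<in> E" using g by (simp add: gens_iff)
    show ?thesis
    proof (cases "0 \<le> e")
      case True
      then show ?thesis using GenT e x Span_tt by (simp flip: A_cls_eq)
    next
      case False
      then have "tt e = Nm (0, - e)" using tt_Cone(2)[of "- e"] e E_neg by simp
      then show ?thesis using GenT e x False Span_Nm[OF Cone_gens(1), of "- e"] E_neg by (simp flip: A_cls_eq)
    qed
  next
    case (GenX s j)
    then show ?thesis using x Span_xx Span_Nm[OF Cone_gens(2)]
      by (cases s) (simp_all add: xx_Cone(2) flip: A_cls_eq)
  qed
qed

section \<open>Linear independence\<close>

text \<open>
  At an index whose third component is \<open>0\<close> the second term in the action of \<open>x\<^sub>j\<^sup>+\<close> vanishes.
\<close>

lemma rep_xlist_Plus: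
  "d \<in> E \<Longrightarrow> rep (xlist Plus js) \<phi> (e, e', 0, n, p, d)
     = \<phi> (z (vsum js) * e, z (vsum js) * e', 0, vsum js + n, vsum js + p, z (vsum js) * d)"
proof (induction js arbitrary: \<phi> n p d e e')
  case (Cons j js)
  then show ?case
    by (simp add: rep_mult rep_gen gens_iff z_E z_add z_axis mult.assoc mult.left_commute add.assoc add.left_commute add.commute)
qed (simp add: rep_one)

lemma rep_xlist_Minus:
  "d \<in> E \<Longrightarrow> rep (xlist Minus js) \<phi> (e, e', m, n, p, d)
     = \<phi> (z (- vsum js) * e, z (- vsum js) * e', vsum js + m, n, - vsum js + p, z (- vsum js) * d)"
proof (induction js arbitrary: \<phi> m p d e e')
  case (Cons j js)
  have 1: "z (- vsum (j # js)) = inverse (\<zeta>$j) * z (- vsum js)"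
    by (simp only: vsum_simps minus_add_distrib z_add) (simp add: z_minus z_axis)
  have 2: "axis j (- 1) = - (axis j 1 :: int^'k)" by (simp add: vec_eq_iff axis_def)
  show ?case unfolding 1 using Cons z_E[OF Cons.prems, of "- vsum js"]
    by (simp add: rep_mult rep_gen gens_iff z_E mult.assoc 2 algebra_simps)
qed (simp add: rep_one)

text \<open>
  The action of \<open>N\<^sub>g f P\<^sub>h\<close> on the vectors with index \<open>(0, 0, 0, 0, p, q)\<close>. The first four components of the
  resulting index determine \<open>g = (m, d)\<close> and \<open>h = (n, e)\<close>.
\<close>

lemma rep_tri:
  assumes g: "(m, d) \<in> Cone" and f: "f \<in> carrier H0" and g': "(n, e) \<in> Cone" and q: "q \<in> E"
  shows "rep (Nm (m, d) \<cdot> hh f \<cdot> Pm (n, e)) \<phi> (0, 0, 0, 0, p, q)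
    = f ((n, e) \<otimes>\<^bsub>SG\<^esub> (p, q))
      * \<phi> (z (- m) * e, z (- m) * d, m, n, - m + (n + p), z (- m) * (- d + (e + z n * q)))"
proof -
  obtain js where m: "m = vsum js" using vsum_surj[of m] g by (auto simp: SG_nonneg)
  obtain js' where n: "n = vsum js'" using vsum_surj[of n] g' by (auto simp: SG_nonneg)
  have d: "d \<in> E" "0 \<le> d" "e \<in> E" "0 \<le> e" using g g' by (auto simp: SG_nonneg)
  have E': "z (vsum js') * q \<in> E" "e + z (vsum js') * q \<in> E" "e + z (vsum js') * q - d \<in> E" "- d \<in> E"
    using d q by (simp_all add: z_E E_add E_diff E_neg)
  show ?thesis
    unfolding m n using d E' f q
    by (simp add: Nm_vsum Pm_vsum rep_mult rep_gen gens_iff rep_xlist_Plus rep_xlist_Minus SG_simps)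
qed

end

section \<open>The triangular decomposition\<close>

context zeta_alg
begin

interpretation H0: falg H0 by (rule H0_falg)

abbreviation "\<iota> \<equiv> A_emb \<zeta> E c"
abbreviation "Bp \<equiv> A_Bplus \<zeta> E c"
abbreviation "Bm \<equiv> A_Bminus \<zeta> E c"

lemma \<iota>_hh: "\<iota> f = hh f"
  by (simp add: A_emb_def)

lemma \<iota>_hom: "\<iota> \<in> alg_hom H0 A"
  by (rule alg_homI) (simp_all add: \<iota>_hh hh_add hh_mult hh_smult hh_one)

lemma rep_smult:
  assumes "x \<in> carrier A"
  shows "rep (a \<odot>\<^bsub>A\<^esub> x) \<phi> b = a * rep x \<phi> b"
proof -
  obtain p where p: "p \<in> carrier FA" "x = cls p" using A_obtain[OF assms] by blast
  have "pact (Poly_Mapping.single 0 a) \<phi> = (\<lambda>b. a * \<phi> b)" by (rule ext) (rule pact_scal)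
  then show ?thesis using p by (simp add: rep_cls free_alg_closed pact_mult pact_fun_mult flip: cls_ops(3))
qed

text \<open>
  The indicator function of the indices that start with \<open>a, b, m, n\<close>.
\<close>

definition ind :: "real \<Rightarrow> real \<Rightarrow> int^'k \<Rightarrow> int^'k \<Rightarrow> 'k idx \<Rightarrow> 'f" where
  "ind a b m n = (\<lambda>(e, e', m', n', p, d). if e = a \<and> e' = b \<and> m' = m \<and> n' = n then 1 else 0)"

lemma ind_simp [simp]: "ind a b m n (e, e', m', n', p, d) = (if e = a \<and> e' = b \<and> m' = m \<and> n' = n then 1 else 0)"
  by (simp add: ind_def)

text \<open>
  Testing a vanishing combination on the indicator function that belongs to one pair \<open>u0\<close> leaves the
  term of \<open>u0\<close> alone, and says that \<open>h u0\<close> vanishes at the product of \<open>snd u0\<close> and \<open>y\<close> for all \<open>y\<close> in the group.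
\<close>

lemma indep_NP:
  assumes F: "finite F" "F \<subseteq> Cone \<times> Cone" and h: "\<And>u. u \<in> F \<Longrightarrow> h u \<in> carrier H0"
    and 0: "(\<Oplus>\<^bsub>A\<^esub>u\<in>F. Nm (fst u) \<cdot> \<iota> (h u) \<cdot> Pm (snd u)) = \<zero>\<^bsub>A\<^esub>"
    and u0: "u0 \<in> F"
  shows "h u0 = \<zero>\<^bsub>H0\<^esub>"
proof -
  obtain m0 d0 n0 e0 where u0_eq: "u0 = ((m0, d0), (n0, e0))" by (metis surj_pair)
  have cone: "(m0, d0) \<in> Cone" "(n0, e0) \<in> Cone" using u0 F(2) u0_eq by auto
  let ?\<phi> = "ind (z (- m0) * e0) (z (- m0) * d0) m0 n0"
  have eval: "h u0 ((n0, e0) \<otimes>\<^bsub>SG\<^esub> (p, q)) = 0" if q: "q \<in> E" for p q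
  proof -
    have cl: "Nm (fst u) \<cdot> \<iota> (h u) \<cdot> Pm (snd u) \<in> carrier A" if "u \<in> F" for u
      using that F(2) h by (auto simp: \<iota>_hh)
    have "rep (Nm (fst u) \<cdot> \<iota> (h u) \<cdot> Pm (snd u)) ?\<phi> (0, 0, 0, 0, p, q)
        = (if u = u0 then h u0 ((n0, e0) \<otimes>\<^bsub>SG\<^esub> (p, q)) else 0)" if u: "u \<in> F" for u
    proof -
      obtain m d n e where ue: "u = ((m, d), (n, e))" by (metis surj_pair)
      have "(m, d) \<in> Cone" "(n, e) \<in> Cone" using u F(2) ue by auto
      then show ?thesis
        using rep_tri[of m d "h u" n e q ?\<phi> p] h[OF u] q by (auto simp: \<iota>_hh ue u0_eq)
    qed
    then have "(\<Sum>u\<in>F. rep (Nm (fst u) \<cdot> \<iota> (h u) \<cdot> Pm (snd u)) ?\<phi> (0, 0, 0, 0, p, q))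
        = (\<Sum>u\<in>F. if u = u0 then h u0 ((n0, e0) \<otimes>\<^bsub>SG\<^esub> (p, q)) else 0)"
      by (rule sum.cong[OF refl])
    also have "\<dots> = h u0 ((n0, e0) \<otimes>\<^bsub>SG\<^esub> (p, q))" using F(1) u0 by simp
    finally have "rep (\<Oplus>\<^bsub>A\<^esub>u\<in>F. Nm (fst u) \<cdot> \<iota> (h u) \<cdot> Pm (snd u)) ?\<phi> (0, 0, 0, 0, p, q)
        = h u0 ((n0, e0) \<otimes>\<^bsub>SG\<^esub> (p, q))"
      by (subst rep_finsum[OF cl])
    then show ?thesis unfolding 0 rep_zero by (rule sym)
  qed
  have "h u0 y = \<zero>\<^bsub>H0\<^esub> y" for y
  proof (cases "y \<in> carrier SG")
    case True
    \<comment> \<open>As \<open>(n0, e0)\<close> is invertible, its product with \<open>(p, q)\<close> runs through the whole group.\<close>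
    obtain p q where pq: "inv\<^bsub>SG\<^esub> (n0, e0) \<otimes>\<^bsub>SG\<^esub> y = (p, q)" by (metis surj_pair)
    have c: "(n0, e0) \<in> carrier SG" using cone(2) by (rule nonneg_carrier)
    have "(p, q) \<in> carrier SG" using True c by (simp flip: pq)
    then have "q \<in> E" by (simp add: SG_simps)
    from eval[OF this, of p] have "h u0 y = 0"
      using True c by (simp add: SG.m_assoc[symmetric] flip: pq)
    then show ?thesis using True by (cases y) (simp add: H0_ops SG_simps)
  next
    case False
    then show ?thesis
      using h[OF u0] H0.zero_closed unfolding H0_carrier extensional_def
      by (cases y) (auto simp: SG_simps)
  qed
  then show ?thesis by (rule ext)
qed

lemma tri_basis: "triangular_basis A H0 \<iota> Nm Cone Pm Cone"
proof unfold_locales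
  show "\<iota> \<in> alg_hom H0 A" by (rule \<iota>_hom)
  show "carrier A \<subseteq> lin_span A {Nm i \<cdot> \<iota> h \<cdot> Pm j | i h j. i \<in> Cone \<and> h \<in> carrier H0 \<and> j \<in> Cone}"
    using Span_carrier by (simp add: Span_def \<iota>_hh)
  show "\<forall>u\<in>F. h u = \<zero>\<^bsub>H0\<^esub>"
    if "finite F" "F \<subseteq> Cone \<times> Cone" "\<And>u. u \<in> F \<Longrightarrow> h u \<in> carrier H0"
      "(\<Oplus>\<^bsub>A\<^esub>u\<in>F. Nm (fst u) \<cdot> \<iota> (h u) \<cdot> Pm (snd u)) = \<zero>\<^bsub>A\<^esub>" for F h
    by (rule ballI, rule indep_NP[OF that])
qed (rule Nm_closed Pm_closed, assumption)+

lemma xlist_in_subalg: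
  assumes "unital_subalg B A" "range (xx s) \<subseteq> B"
  shows "xlist s js \<in> B"
  using assms by (induction js) (auto simp: A.unital_subalgD(3) intro!: A.unital_subalgD(6)[OF assms(1)])

lemma Bp_span: "Bp = lin_span A (Pm ` Cone)"
  unfolding A_Bplus_def
proof (rule A.subalg_gen_eq_span)
  let ?S = "range (xx Plus) \<union> {tt e |e. e \<in> E \<inter> {0..}}"
  have "tt e \<in> Pm ` Cone" if "e \<in> E" "0 \<le> e" for e
    using tt_Cone(1)[OF that] Cone_gens(1)[OF that] by blast
  moreover have "xx Plus j \<in> Pm ` Cone" for j
    using xx_Cone(1)[of j] Cone_gens(2)[of j] by blast
  ultimately show "?S \<subseteq> Pm ` Cone" by auto
  have "?S \<subseteq> carrier A" by auto
  from A.unital_subalg_gen[OF this] have u: "unital_subalg (subalg_gen A ?S) A" .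
  show "Pm ` Cone \<subseteq> subalg_gen A ?S"
  proof (rule image_subsetI)
    fix g assume "g \<in> Cone"
    then obtain js d where g: "g = (vsum js, d)" "d \<in> E" "0 \<le> d" by (rule Cone_cases)
    have "tt d \<in> subalg_gen A ?S" using g A.subalg_gen_incl[of ?S] by auto
    moreover have "xlist Plus js \<in> subalg_gen A ?S"
      by (rule xlist_in_subalg[OF u]) (use A.subalg_gen_incl[of ?S] in blast)
    ultimately show "Pm g \<in> subalg_gen A ?S" using A.unital_subalgD(6)[OF u] by (simp add: g(1) Pm_vsum)
  qed
  show "Pm ` Cone \<subseteq> carrier A" by auto
  show "\<one>\<^bsub>A\<^esub> \<in> Pm ` Cone" using Pm_one nonneg_one by (metis imageI)
  show "x \<cdot> y \<in> Pm ` Cone" if "x \<in> Pm ` Cone" "y \<in> Pm ` Cone" for x y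
    using that by (auto simp: Pm_mult nonneg_mult)
qed

lemma Bm_span: "Bm = lin_span A (Nm ` Cone)"
  unfolding A_Bminus_def
proof (rule A.subalg_gen_eq_span)
  let ?S = "range (xx Minus) \<union> {tt (- e) |e. e \<in> E \<inter> {0..}}"
  have "tt (- e) \<in> Nm ` Cone" if "e \<in> E" "0 \<le> e" for e
    using tt_Cone(2)[OF that] Cone_gens(1)[OF that] by blast
  moreover have "xx Minus j \<in> Nm ` Cone" for j
    using xx_Cone(2)[of j] Cone_gens(2)[of j] by blast
  ultimately show "?S \<subseteq> Nm ` Cone" by auto
  have "?S \<subseteq> carrier A" using E_neg by auto
  from A.unital_subalg_gen[OF this] have u: "unital_subalg (subalg_gen A ?S) A" .
  show "Nm ` Cone \<subseteq> subalg_gen A ?S"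
  proof (rule image_subsetI)
    fix g assume "g \<in> Cone"
    then obtain js d where g: "g = (vsum js, d)" "d \<in> E" "0 \<le> d" by (rule Cone_cases)
    have "tt (- d) \<in> subalg_gen A ?S" using g A.subalg_gen_incl[of ?S] by auto
    moreover have "xlist Minus js \<in> subalg_gen A ?S"
      by (rule xlist_in_subalg[OF u]) (use A.subalg_gen_incl[of ?S] in blast)
    ultimately show "Nm g \<in> subalg_gen A ?S" using A.unital_subalgD(6)[OF u] g(2) by (simp add: g(1) Nm_vsum)
  qed
  show "Nm ` Cone \<subseteq> carrier A" by auto
  show "\<one>\<^bsub>A\<^esub> \<in> Nm ` Cone" using Nm_one nonneg_one by (metis imageI)
  show "x \<cdot> y \<in> Nm ` Cone" if "x \<in> Nm ` Cone" "y \<in> Nm ` Cone" for x y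
    using that by (auto simp: Nm_mult nonneg_mult)
qed

lemma Bp_subalg: "unital_subalg Bp A"
  unfolding A_Bplus_def by (rule A.unital_subalg_gen) auto

lemma Bm_subalg: "unital_subalg Bm A"
  unfolding A_Bminus_def by (rule A.unital_subalg_gen) (auto simp: E_neg)

lemma \<iota>_inj: "inj_on \<iota> (carrier H0)"
proof (rule inj_onI)
  fix f g assume fg: "f \<in> carrier H0" "g \<in> carrier H0" "\<iota> f = \<iota> g"
  show "f = g"
  proof (rule extensionalityI[of _ "UNIV \<times> E"])
    fix y :: "(int^'k) \<times> real" assume "y \<in> UNIV \<times> E"
    then obtain p d where y: "y = (p, d)" "d \<in> E" by auto
    have "rep (hh f) (\<lambda>_. 1) (0, 0, 0, 0, p, d) = rep (hh g) (\<lambda>_. 1) (0, 0, 0, 0, p, d)"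
      using fg(3) by (simp add: \<iota>_hh)
    then show "f y = g y" using fg(1,2) y by (simp add: rep_gen gens_iff)
  qed (use fg H0_carrier in auto)
qed

lemma RTA1: "RTA1 A H0 \<iota> Bm Bp"
  unfolding RTA1_def
  using Bm_subalg Bp_subalg H0.F_algebra \<iota>_hom \<iota>_inj triangular_basis.triangular_mult_iso[OF tri_basis]
  by (simp add: Bm_span Bp_span)

section \<open>Weight spaces\<close>

text \<open>
  The coefficient of \<open>P\<^sub>g\<close> in an element of \<open>B\<^sup>+\<close>, as a linear functional.
\<close>

definition coef :: "(int^'k) \<times> real \<Rightarrow> ('f, 'k) free_elem set \<Rightarrow> 'f" where
  "coef g x = rep x (ind (snd g) 0 0 (fst g)) (0, 0, 0, 0, 0, 0)"

lemma rep_Pm: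
  assumes "(n, e) \<in> Cone" "q \<in> E"
  shows "rep (Pm (n, e)) \<phi> (0, 0, 0, 0, p, q) = \<phi> (e, 0, 0, n, n + p, e + z n * q)"
proof -
  have "(n, e) \<otimes>\<^bsub>SG\<^esub> (p, q) \<in> UNIV \<times> E"
    using assms by (simp add: SG_simps SG_nonneg E_add z_E)
  then have 1: "\<one>\<^bsub>H0\<^esub> ((n, e) \<otimes>\<^bsub>SG\<^esub> (p, q)) = 1"
    by (cases "(n, e) \<otimes>\<^bsub>SG\<^esub> (p, q)") (simp add: H0_ops)
  have "Pm (n, e) = Nm (0, 0) \<cdot> hh \<one>\<^bsub>H0\<^esub> \<cdot> Pm (n, e)"
    using Nm_one assms by (simp add: SG_simps hh_one)
  then show ?thesis
    using rep_tri[of 0 0 "\<one>\<^bsub>H0\<^esub>" n e q \<phi> p] assms nonneg_one H0.one_closed 1 by (simp add: SG_simps)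
qed

lemma coef_Pm: "g \<in> Cone \<Longrightarrow> g' \<in> Cone \<Longrightarrow> coef g (Pm g') = (if g' = g then 1 else 0)"
  by (cases g; cases g') (auto simp: coef_def rep_Pm E_zero)

lemma coef_smult: "x \<in> carrier A \<Longrightarrow> coef g (a \<odot>\<^bsub>A\<^esub> x) = a * coef g x"
  by (simp add: coef_def rep_smult)

lemma coef_zero: "coef g \<zero>\<^bsub>A\<^esub> = 0"
  by (simp add: coef_def rep_zero)

lemma coef_finsum: "(\<And>i. i \<in> I \<Longrightarrow> f i \<in> carrier A) \<Longrightarrow> coef g (\<Oplus>\<^bsub>A\<^esub>i\<in>I. f i) = (\<Sum>i\<in>I. coef g (f i))"
  by (simp add: coef_def rep_finsum)

lemma Bp_expand:
  assumes "b \<in> Bp"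
  shows "\<exists>F. finite F \<and> F \<subseteq> Cone \<and> (\<forall>g\<in>Cone - F. coef g b = 0) \<and> b = (\<Oplus>\<^bsub>A\<^esub>g\<in>F. coef g b \<odot>\<^bsub>A\<^esub> Pm g)"
proof -
  have "b \<in> lin_ext A Pm ` {p. Poly_Mapping.keys p \<subseteq> Cone}"
    using assms unfolding Bp_span by (subst (asm) A.lin_span_image) auto
  then obtain p where p: "Poly_Mapping.keys p \<subseteq> Cone" "b = lin_ext A Pm p" by blast
  let ?F = "Poly_Mapping.keys p"
  have P: "Pm g \<in> carrier A" if "g \<in> ?F" for g using that p(1) by auto
  have b: "b = (\<Oplus>\<^bsub>A\<^esub>g\<in>?F. Poly_Mapping.lookup p g \<odot>\<^bsub>A\<^esub> Pm g)"
    using p(2) by (simp add: lin_ext_def)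
  have c: "coef g b = Poly_Mapping.lookup p g" if g: "g \<in> Cone" for g
  proof -
    have "coef g b = (\<Sum>g'\<in>?F. coef g (Poly_Mapping.lookup p g' \<odot>\<^bsub>A\<^esub> Pm g'))"
      unfolding b by (rule coef_finsum) (simp add: P)
    also have "\<dots> = (\<Sum>g'\<in>?F. if g' = g then Poly_Mapping.lookup p g' else 0)"
    proof (rule sum.cong[OF refl])
      fix g' assume "g' \<in> ?F"
      then have "g' \<in> Cone" using p(1) by blast
      then show "coef g (Poly_Mapping.lookup p g' \<odot>\<^bsub>A\<^esub> Pm g') = (if g' = g then Poly_Mapping.lookup p g' else 0)"
        using g by (simp add: coef_smult coef_Pm)
    qed
    also have "\<dots> = Poly_Mapping.lookup p g" by (simp add: in_keys_iff)
    finally show ?thesis .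
  qed
  have "(\<Oplus>\<^bsub>A\<^esub>g\<in>?F. Poly_Mapping.lookup p g \<odot>\<^bsub>A\<^esub> Pm g) = (\<Oplus>\<^bsub>A\<^esub>g\<in>?F. coef g b \<odot>\<^bsub>A\<^esub> Pm g)"
    by (rule A.finsum_cong') (use p(1) c in auto)
  with b have e: "b = (\<Oplus>\<^bsub>A\<^esub>g\<in>?F. coef g b \<odot>\<^bsub>A\<^esub> Pm g)" by (rule trans)
  have "\<forall>g\<in>Cone - ?F. coef g b = 0" using c by (simp add: in_keys_iff)
  with finite_keys p(1) show ?thesis by (intro exI[of _ ?F] conjI e)
qed

abbreviation "\<Phi> \<equiv> (fun_aut SG :: _ \<Rightarrow> ('f, 'k) H0_fun \<Rightarrow> _)"

lemma H0_Fun: "H0 = fun_alg (carrier SG)"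
  by (simp add: A_H0_def)

lemma \<Phi>_apply: "f \<in> carrier H0 \<Longrightarrow> \<Phi> g f = ltrans SG (inv\<^bsub>SG\<^esub> g) f"
  unfolding H0_Fun by (rule SG.fun_aut_apply)

lemma \<Phi>_inj: "inj_on \<Phi> (carrier SG)"
  by (rule SG.fun_aut_inj)

lemma \<Phi>_hom: "group_hom SG (alg_aut H0) \<Phi>"
  unfolding H0_Fun by (rule SG.fun_aut_group_hom)

text \<open>
  The weight spaces of \<open>B\<^sup>+\<close> are lines. If \<open>x\<close> has weight \<open>g\<close> and \<open>g' \<noteq> g\<close>, compare the functions in front of
  \<open>P\<^bsub>g'\<^esub>\<close> in \<open>x f = g(f) x\<close>, at the point \<open>g'\<close>, with \<open>f\<close> the indicator function of the unit element. On the
  left this gives \<open>coef g' x\<close> times \<open>f(1) = 1\<close>, on the right \<open>coef g' x\<close> times \<open>f(g\<^sup>-\<^sup>1 g') = 0\<close>.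
\<close>

lemma weight_space_Pm:
  assumes g: "g \<in> Cone"
  shows "weight_space A H0 \<iota> Bp (\<Phi> g) = range (\<lambda>a. a \<odot>\<^bsub>A\<^esub> Pm g)"
proof (intro equalityI subsetI)
  fix x assume "x \<in> range (\<lambda>a. a \<odot>\<^bsub>A\<^esub> Pm g)"
  then obtain a where x: "x = a \<odot>\<^bsub>A\<^esub> Pm g" by blast
  have "Pm g \<in> Bp" using g A.lin_span_incl[of "Pm ` Cone"] by (auto simp: Bp_span)
  then have "x \<in> Bp" unfolding x by (rule A.unital_subalgD(7)[OF Bp_subalg])
  moreover have "x \<cdot> \<iota> f = \<iota> (\<Phi> g f) \<cdot> x" if f: "f \<in> carrier H0" for f
    using Pm_h[OF g f] g f by (simp add: x \<iota>_hh \<Phi>_apply A.smult_mult_left A.smult_mult_right H0_ltrans)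
  ultimately show "x \<in> weight_space A H0 \<iota> Bp (\<Phi> g)" using g by (auto simp: weight_space_def x)
next
  fix x assume "x \<in> weight_space A H0 \<iota> Bp (\<Phi> g)"
  then have x: "x \<in> Bp" "x \<in> carrier A" "\<And>f. f \<in> carrier H0 \<Longrightarrow> x \<cdot> hh f = hh (\<Phi> g f) \<cdot> x"
    by (auto simp: weight_space_def \<iota>_hh)
  obtain F where F: "finite F" "F \<subseteq> Cone" "\<forall>g\<in>Cone - F. coef g x = 0" "x = (\<Oplus>\<^bsub>A\<^esub>g\<in>F. coef g x \<odot>\<^bsub>A\<^esub> Pm g)"
    using Bp_expand[OF x(1)] by blast
  have cg: "g \<in> carrier SG" by (rule nonneg_carrier[OF g])
  have zero: "coef g' x = 0" if g': "g' \<in> Cone" "g' \<noteq> g" for g'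
  proof -
    obtain n' e' where ne: "g' = (n', e')" by (cases g')
    have cg': "g' \<in> carrier SG" by (rule nonneg_carrier[OF g'(1)])
    define f :: "('f, 'k) H0_fun" where "f = (\<lambda>y\<in>UNIV \<times> E. if y = (0, 0) then 1 else 0)"
    have f: "f \<in> carrier H0" by (simp add: f_def H0_carrier)
    have "inv\<^bsub>SG\<^esub> g \<otimes>\<^bsub>SG\<^esub> g' \<noteq> (0, 0)"
      using g'(2) cg cg' SG.inv_equality[of "inv\<^bsub>SG\<^esub> g" g'] SG.inv_inv[OF cg]
      by (metis SG.inv_closed SG.inv_comm SG.inv_equality SG_simps(3))
    moreover have "inv\<^bsub>SG\<^esub> g \<otimes>\<^bsub>SG\<^esub> g' \<in> UNIV \<times> E" using cg cg' by (metis SG.inv_closed SG.m_closed SG_simps(1))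
    ultimately have f0: "\<Phi> g f g' = 0" using cg' f by (simp add: \<Phi>_apply ltrans_apply) (simp add: f_def)
    let ?\<phi> = "ind e' 0 0 n'"
    have "rep (hh (\<Phi> g f) \<cdot> x) ?\<phi> (0, 0, 0, 0, 0, 0) = rep x (rep (hh (\<Phi> g f)) ?\<phi>) (0, 0, 0, 0, 0, 0)"
      using x(2) f by (simp add: rep_mult \<Phi>_apply H0_ltrans)
    also have "\<dots> = (\<Sum>k\<in>F. coef k x * rep (Pm k) (rep (hh (\<Phi> g f)) ?\<phi>) (0, 0, 0, 0, 0, 0))"
    proof -
      have "rep (\<Oplus>\<^bsub>A\<^esub>g\<in>F. coef g x \<odot>\<^bsub>A\<^esub> Pm g) \<psi> b = (\<Sum>k\<in>F. coef k x * rep (Pm k) \<psi> b)" for \<psi> b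
      proof -
        have "rep (\<Oplus>\<^bsub>A\<^esub>g\<in>F. coef g x \<odot>\<^bsub>A\<^esub> Pm g) \<psi> b = (\<Sum>k\<in>F. rep (coef k x \<odot>\<^bsub>A\<^esub> Pm k) \<psi> b)"
          by (rule rep_finsum) (use F(2) in auto)
        also have "\<dots> = (\<Sum>k\<in>F. coef k x * rep (Pm k) \<psi> b)"
          by (rule sum.cong[OF refl]) (use F(2) in \<open>auto intro!: rep_smult\<close>)
        finally show ?thesis .
      qed
      then show ?thesis using F(4) by simp
    qed
    also have "\<dots> = 0"
    proof (rule sum.neutral, rule ballI)
      fix k assume "k \<in> F"
      then have k: "k \<in> Cone" using F(2) by blast
      obtain n e where kne: "k = (n, e)" by (cases k)
      have e: "e \<in> E" using k kne by (simp add: SG_nonneg)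
      have "rep (Pm k) (rep (hh (\<Phi> g f)) ?\<phi>) (0, 0, 0, 0, 0, 0) = \<Phi> g f (n, e) * ?\<phi> (e, 0, 0, n, n, e)"
        using k e kne f by (simp add: rep_Pm E_zero rep_gen gens_iff \<Phi>_apply H0_ltrans del: ind_simp)
      also have "\<dots> = 0" using f0 by (auto simp: ne)
      finally show "coef k x * rep (Pm k) (rep (hh (\<Phi> g f)) ?\<phi>) (0, 0, 0, 0, 0, 0) = 0" by simp
    qed
    finally have "rep (x \<cdot> hh f) ?\<phi> (0, 0, 0, 0, 0, 0) = 0" using x(3)[OF f] by simp
    moreover have "rep (x \<cdot> hh f) ?\<phi> (0, 0, 0, 0, 0, 0) = coef g' x"
      using x(2) f E_zero by (simp add: rep_mult rep_gen gens_iff coef_def ne) (simp add: f_def E_zero)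
    ultimately show ?thesis by simp
  qed
  have "x = coef g x \<odot>\<^bsub>A\<^esub> Pm g"
  proof -
    have 1: "(\<Oplus>\<^bsub>A\<^esub>k\<in>F \<union> {g}. coef k x \<odot>\<^bsub>A\<^esub> Pm k) = (\<Oplus>\<^bsub>A\<^esub>k\<in>F. coef k x \<odot>\<^bsub>A\<^esub> Pm k)"
      by (rule A.add.finprod_mono_neutral_cong_right) (use F g in auto)
    have "(\<Oplus>\<^bsub>A\<^esub>k\<in>F \<union> {g}. coef k x \<odot>\<^bsub>A\<^esub> Pm k) = (\<Oplus>\<^bsub>A\<^esub>k\<in>{g}. coef k x \<odot>\<^bsub>A\<^esub> Pm k)"
      by (rule A.add.finprod_mono_neutral_cong_right) (use F g zero in auto)
    also have "\<dots> = coef g x \<odot>\<^bsub>A\<^esub> Pm g" using g by simp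
    finally show ?thesis using F(4) 1 by simp
  qed
  then show "x \<in> range (\<lambda>a. a \<odot>\<^bsub>A\<^esub> Pm g)" by blast
qed

lemma Q_eq: "A_Q \<zeta> E = \<Phi> ` Cone"
  by (simp add: A_Q_def)

text \<open>
  Families of weight vectors, and the weights at which a family does not vanish.
\<close>

abbreviation "families \<equiv> \<Pi>\<^sub>E \<theta>\<in>\<Phi> ` Cone. weight_space A H0 \<iota> Bp \<theta>"
abbreviation "supp a \<equiv> {\<theta>\<in>\<Phi> ` Cone. a \<theta> \<noteq> \<zero>\<^bsub>A\<^esub>}"

lemma decomposition_exists:
  assumes b: "b \<in> Bp"
  defines "a \<equiv> (\<lambda>\<theta>\<in>\<Phi> ` Cone. coef (inv_into Cone \<Phi> \<theta>) b \<odot>\<^bsub>A\<^esub> Pm (inv_into Cone \<Phi> \<theta>))"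
  shows "a \<in> families"
    "finite (supp a)" "(\<Oplus>\<^bsub>A\<^esub>\<theta>\<in>supp a. a \<theta>) = b"
proof -
  have inj: "inj_on \<Phi> Cone" by (rule inj_on_subset[OF \<Phi>_inj]) (use nonneg_carrier in blast)
  have a: "a (\<Phi> g) = coef g b \<odot>\<^bsub>A\<^esub> Pm g" if "g \<in> Cone" for g
    using that by (simp add: a_def inv_into_f_f[OF inj])
  show "a \<in> families"
  proof (rule PiE_I)
    fix \<theta> assume "\<theta> \<in> \<Phi> ` Cone"
    then obtain g where "g \<in> Cone" "\<theta> = \<Phi> g" by blast
    then show "a \<theta> \<in> weight_space A H0 \<iota> Bp \<theta>" by (simp add: a weight_space_Pm)
  qed (simp add: a_def)
  obtain F where F: "finite F" "F \<subseteq> Cone" "\<forall>g\<in>Cone - F. coef g b = 0" "b = (\<Oplus>\<^bsub>A\<^esub>g\<in>F. coef g b \<odot>\<^bsub>A\<^esub> Pm g)"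
    using Bp_expand[OF b] by blast
  have sub: "supp a \<subseteq> \<Phi> ` F"
  proof
    fix \<theta> assume "\<theta> \<in> supp a"
    then obtain g where g: "g \<in> Cone" "\<theta> = \<Phi> g" "a (\<Phi> g) \<noteq> \<zero>\<^bsub>A\<^esub>" by blast
    then have "coef g b \<noteq> 0" using a[OF g(1)] by (metis A.smult_0 Pm_closed)
    then have "g \<in> F" using F(3) g(1) by blast
    then show "\<theta> \<in> \<Phi> ` F" using g(2) by blast
  qed
  then show "finite (supp a)" using F(1) by (rule finite_subset[OF _ finite_imageI])
  have cl: "a \<theta> \<in> carrier A" if "\<theta> \<in> \<Phi> ` Cone" for \<theta> using that by (auto simp: a)
  have "(\<Oplus>\<^bsub>A\<^esub>\<theta>\<in>supp a. a \<theta>) = (\<Oplus>\<^bsub>A\<^esub>\<theta>\<in>\<Phi> ` F. a \<theta>)"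
    by (rule A.add.finprod_mono_neutral_cong_left) (use F(1,2) sub cl in auto)
  also have "\<dots> = (\<Oplus>\<^bsub>A\<^esub>g\<in>F. a (\<Phi> g))"
    by (rule A.finsum_reindex) (use F(2) cl inj_on_subset[OF inj F(2)] in auto)
  also have "\<dots> = (\<Oplus>\<^bsub>A\<^esub>g\<in>F. coef g b \<odot>\<^bsub>A\<^esub> Pm g)"
    by (rule A.finsum_cong') (use F(2) a in auto)
  finally show "(\<Oplus>\<^bsub>A\<^esub>\<theta>\<in>supp a. a \<theta>) = b" using F(4) by simp
qed

text \<open>
  The components of a weight decomposition are determined by the functionals \<open>coef\<close>.
\<close>

lemma decomposition_unique:
  assumes a: "a \<in> families"
    and fin: "finite (supp a)" and sum: "(\<Oplus>\<^bsub>A\<^esub>\<theta>\<in>supp a. a \<theta>) = b"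
    and g: "g \<in> Cone"
  shows "a (\<Phi> g) = coef g b \<odot>\<^bsub>A\<^esub> Pm g"
proof -
  have inj: "inj_on \<Phi> Cone" by (rule inj_on_subset[OF \<Phi>_inj]) (use nonneg_carrier in blast)
  let ?D = "supp a"
  have ex: "\<exists>k. a (\<Phi> g') = k \<odot>\<^bsub>A\<^esub> Pm g'" if "g' \<in> Cone" for g'
    using PiE_mem[OF a, of "\<Phi> g'"] that by (auto simp: weight_space_Pm)
  have cl: "a \<theta> \<in> carrier A" if "\<theta> \<in> \<Phi> ` Cone" for \<theta> using that ex by fastforce
  have other: "coef g (a \<theta>) = 0" if "\<theta> \<in> \<Phi> ` Cone" "\<theta> \<noteq> \<Phi> g" for \<theta>
  proof -
    from that obtain g' where g': "g' \<in> Cone" "\<theta> = \<Phi> g'" "g' \<noteq> g" by blast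
    obtain k where "a \<theta> = k \<odot>\<^bsub>A\<^esub> Pm g'" using ex[OF g'(1)] g'(2) by blast
    then show ?thesis using g g' by (simp add: coef_smult coef_Pm)
  qed
  have "coef g b = (\<Sum>\<theta>\<in>?D. coef g (a \<theta>))"
    unfolding sum[symmetric] by (rule coef_finsum) (use cl in blast)
  also have "\<dots> = (\<Sum>\<theta>\<in>?D. if \<theta> = \<Phi> g then coef g (a (\<Phi> g)) else 0)"
    by (rule sum.cong[OF refl]) (use other in auto)
  also have "\<dots> = coef g (a (\<Phi> g))"
    using fin g coef_zero by (simp add: sum.delta')
  finally have c: "coef g b = coef g (a (\<Phi> g))" .
  obtain k where k: "a (\<Phi> g) = k \<odot>\<^bsub>A\<^esub> Pm g" using ex[OF g] by blast
  then have "coef g b = k" using c g by (simp add: coef_smult coef_Pm)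
  then show ?thesis using k by simp
qed

lemma \<Phi>_one: "\<Phi> \<one>\<^bsub>SG\<^esub> = \<one>\<^bsub>alg_aut H0\<^esub>"
  by (rule group_hom.hom_one[OF \<Phi>_hom])

lemma \<Phi>_mult: "g \<in> carrier SG \<Longrightarrow> h \<in> carrier SG \<Longrightarrow> \<Phi> g \<otimes>\<^bsub>alg_aut H0\<^esub> \<Phi> h = \<Phi> (g \<otimes>\<^bsub>SG\<^esub> h)"
  by (rule group_hom.hom_mult[OF \<Phi>_hom, symmetric])

lemma \<Phi>_closed: "g \<in> carrier SG \<Longrightarrow> \<Phi> g \<in> carrier (alg_aut H0)"
  by (rule group_hom.hom_closed[OF \<Phi>_hom])

lemma Q_submonoid: "submonoid (\<Phi> ` Cone) (alg_aut H0)"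
proof
  show "\<Phi> ` Cone \<subseteq> carrier (alg_aut H0)" using \<Phi>_closed nonneg_carrier by blast
  show "\<one>\<^bsub>alg_aut H0\<^esub> \<in> \<Phi> ` Cone" using \<Phi>_one nonneg_one by (metis imageI)
  show "x \<otimes>\<^bsub>alg_aut H0\<^esub> y \<in> \<Phi> ` Cone" if "x \<in> \<Phi> ` Cone" "y \<in> \<Phi> ` Cone" for x y
    using that nonneg_carrier nonneg_mult by (auto simp: \<Phi>_mult)
qed

lemma RTA2: "RTA2 A H0 \<iota> Bp (A_Q \<zeta> E)"
  unfolding RTA2_def Q_eq
proof (intro conjI ballI)
  show "submonoid (\<Phi> ` Cone) (alg_aut H0)" by (rule Q_submonoid)
  show "\<theta> \<otimes>\<^bsub>alg_aut H0\<^esub> \<theta>' \<in> \<Phi> ` Cone - {\<one>\<^bsub>alg_aut H0\<^esub>}"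
    if \<theta>: "\<theta> \<in> \<Phi> ` Cone - {\<one>\<^bsub>alg_aut H0\<^esub>}" and \<theta>': "\<theta>' \<in> \<Phi> ` Cone - {\<one>\<^bsub>alg_aut H0\<^esub>}" for \<theta> \<theta>'
  proof -
    obtain g where g: "g \<in> Cone" "\<theta> = \<Phi> g" using \<theta> by blast
    obtain h where h: "h \<in> Cone" "\<theta>' = \<Phi> h" using \<theta>' by blast
    have "g \<noteq> \<one>\<^bsub>SG\<^esub>" using \<theta> g(2) \<Phi>_one by auto
    then have "g \<otimes>\<^bsub>SG\<^esub> h \<noteq> \<one>\<^bsub>SG\<^esub>" using nonneg_mult_one[OF g(1) h(1)] by blast
    then have "\<Phi> (g \<otimes>\<^bsub>SG\<^esub> h) \<noteq> \<Phi> \<one>\<^bsub>SG\<^esub>"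
      using inj_onD[OF \<Phi>_inj, of "g \<otimes>\<^bsub>SG\<^esub> h" "\<one>\<^bsub>SG\<^esub>"] g(1) h(1) nonneg_carrier by blast
    then show ?thesis using g h nonneg_mult nonneg_carrier by (simp add: \<Phi>_mult \<Phi>_one)
  qed
  show "\<exists>!a. a \<in> families \<and>
        finite (supp a) \<and> (\<Oplus>\<^bsub>A\<^esub>\<theta>\<in>supp a. a \<theta>) = b" if b: "b \<in> Bp" for b
  proof (rule ex_ex1I)
    show "\<exists>a. a \<in> families \<and>
        finite (supp a) \<and> (\<Oplus>\<^bsub>A\<^esub>\<theta>\<in>supp a. a \<theta>) = b"
      using decomposition_exists[OF b] by blast
    fix a a'
    assume A: "a \<in> families \<and>
        finite (supp a) \<and> (\<Oplus>\<^bsub>A\<^esub>\<theta>\<in>supp a. a \<theta>) = b"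
      and A': "a' \<in> families \<and>
        finite (supp a') \<and> (\<Oplus>\<^bsub>A\<^esub>\<theta>\<in>supp a'. a' \<theta>) = b"
    show "a = a'"
    proof (rule PiE_ext)
      show "a \<in> families" "a' \<in> families"
        using A A' by blast+
      fix \<theta> assume "\<theta> \<in> \<Phi> ` Cone"
      then obtain g where g: "g \<in> Cone" "\<theta> = \<Phi> g" by blast
      show "a \<theta> = a' \<theta>"
        unfolding g(2) using decomposition_unique[of a b g] decomposition_unique[of a' b g] A A' g(1) by simp
    qed
  qed
  show "weight_space A H0 \<iota> Bp \<one>\<^bsub>alg_aut H0\<^esub> = {a \<odot>\<^bsub>A\<^esub> \<one>\<^bsub>A\<^esub> | a. True}"
    using weight_space_Pm[OF nonneg_one] by (auto simp: \<Phi>_one Pm_one)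
  show "\<exists>S. finite S \<and> S \<subseteq> carrier A \<and> weight_space A H0 \<iota> Bp \<theta> = lin_span A S" if \<theta>: "\<theta> \<in> \<Phi> ` Cone" for \<theta>
  proof -
    obtain g where g: "g \<in> Cone" "\<theta> = \<Phi> g" using \<theta> by blast
    have sp: "submodule (range (\<lambda>a. a \<odot>\<^bsub>A\<^esub> Pm g)) base_field A"
    proof (rule A.subspaceI)
      show "\<zero>\<^bsub>A\<^esub> \<in> range (\<lambda>a. a \<odot>\<^bsub>A\<^esub> Pm g)" by (rule image_eqI[of _ _ 0]) (use g in auto)
      show "x \<oplus>\<^bsub>A\<^esub> y \<in> range (\<lambda>a. a \<odot>\<^bsub>A\<^esub> Pm g)" if "x \<in> range (\<lambda>a. a \<odot>\<^bsub>A\<^esub> Pm g)" "y \<in> range (\<lambda>a. a \<odot>\<^bsub>A\<^esub> Pm g)" for x y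
        using that g A.smult_add_left[of "Pm g", symmetric] by auto
      show "k \<odot>\<^bsub>A\<^esub> x \<in> range (\<lambda>a. a \<odot>\<^bsub>A\<^esub> Pm g)" if "x \<in> range (\<lambda>a. a \<odot>\<^bsub>A\<^esub> Pm g)" for k x
        using that g A.smult_smult[of "Pm g"] by auto
    qed (use g in auto)
    have 1: "Pm g \<in> lin_span A {Pm g}" using A.lin_span_incl by blast
    have "range (\<lambda>a. a \<odot>\<^bsub>A\<^esub> Pm g) = lin_span A {Pm g}"
    proof
      show "range (\<lambda>a. a \<odot>\<^bsub>A\<^esub> Pm g) \<subseteq> lin_span A {Pm g}"
        using A.subspaceD(4)[OF A.lin_span_subspace[of "{Pm g}"] 1] g by auto
      have "Pm g \<in> range (\<lambda>a. a \<odot>\<^bsub>A\<^esub> Pm g)" by (rule image_eqI[of _ _ 1]) (use g in auto)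
      then show "lin_span A {Pm g} \<subseteq> range (\<lambda>a. a \<odot>\<^bsub>A\<^esub> Pm g)" by (intro A.lin_span_least[OF sp]) blast
    qed
    then show ?thesis using g by (intro exI[of _ "{Pm g}"]) (simp add: weight_space_Pm)
  qed
qed

section \<open>The anti-involution on the outer factors\<close>

lemma inv_Bp: "x \<in> Bp \<Longrightarrow> A_inv x \<in> Bm"
proof -
  note D = A.unital_subalgD[OF Bm_subalg]
  have "submodule {x \<in> carrier A. A_inv x \<in> Bm} base_field A"
  proof (rule A.subspaceI)
    have "A_inv \<zero>\<^bsub>A\<^esub> = \<zero>\<^bsub>A\<^esub>" using inv_smult[of "\<one>\<^bsub>A\<^esub>" 0] inv_one by simp
    then show "\<zero>\<^bsub>A\<^esub> \<in> {x \<in> carrier A. A_inv x \<in> Bm}" using D(4) by simp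
  qed (use D in \<open>auto simp: inv_add inv_smult\<close>)
  moreover have "Pm ` Cone \<subseteq> {x \<in> carrier A. A_inv x \<in> Bm}"
    using A.lin_span_incl[of "Nm ` Cone"] by (auto simp: Bm_span simp flip: Nm_def)
  ultimately have "Bp \<subseteq> {x \<in> carrier A. A_inv x \<in> Bm}" unfolding Bp_span by (rule A.lin_span_least)
  then show "x \<in> Bp \<Longrightarrow> A_inv x \<in> Bm" by blast
qed

lemma inv_Bm: "x \<in> Bm \<Longrightarrow> A_inv x \<in> Bp"
proof -
  note D = A.unital_subalgD[OF Bp_subalg]
  have "submodule {x \<in> carrier A. A_inv x \<in> Bp} base_field A"
  proof (rule A.subspaceI)
    have "A_inv \<zero>\<^bsub>A\<^esub> = \<zero>\<^bsub>A\<^esub>" using inv_smult[of "\<one>\<^bsub>A\<^esub>" 0] inv_one by simp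
    then show "\<zero>\<^bsub>A\<^esub> \<in> {x \<in> carrier A. A_inv x \<in> Bp}" using D(4) by simp
  qed (use D in \<open>auto simp: inv_add inv_smult\<close>)
  moreover have "Nm ` Cone \<subseteq> {x \<in> carrier A. A_inv x \<in> Bp}"
    using A.lin_span_incl[of "Pm ` Cone"] by (auto simp: Bp_span Nm_def inv_inv inv_closed)
  ultimately have "Bm \<subseteq> {x \<in> carrier A. A_inv x \<in> Bp}" unfolding Bm_span by (rule A.lin_span_least)
  then show "x \<in> Bm \<Longrightarrow> A_inv x \<in> Bp" by blast
qed

lemma H0_timesI:
  assumes "b \<in> B" "b \<in> carrier A"
  shows "b \<in> H0_times A H0 \<iota> B"
proof -
  have "lin_ext A (\<lambda>(h, b). \<iota> h \<cdot> b) (Poly_Mapping.single (\<one>\<^bsub>H0\<^esub>, b) 1) = b"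
    using assms by (subst A.lin_ext_single) (simp_all add: \<iota>_hh hh_one)
  moreover have "Poly_Mapping.keys (Poly_Mapping.single (\<one>\<^bsub>H0\<^esub>, b) (1::'f)) \<subseteq> carrier H0 \<times> B"
    using assms H0.one_closed by simp
  ultimately show ?thesis unfolding H0_times_def by (metis (mono_tags, lifting) mem_Collect_eq)
qed

lemma RTA3: "RTA3 A H0 \<iota> Bm Bp A_inv"
  unfolding RTA3_def
proof (intro conjI)
  show "anti_involution A A_inv" by (rule anti_involution_inv)
  show "\<forall>h\<in>carrier H0. A_inv (\<iota> h) = \<iota> h" by (simp add: \<iota>_hh inv_gen gens_iff)
  show "A_inv ` Bp \<subseteq> H0_times A H0 \<iota> Bm"
    using inv_Bp A.unital_subalgD(2)[OF Bm_subalg] by (auto intro!: H0_timesI)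
  show "A_inv ` Bm \<subseteq> H0_times A H0 \<iota> Bp"
    using inv_Bm A.unital_subalgD(2)[OF Bp_subalg] by (auto intro!: H0_timesI)
qed

theorem strict: "strict_RTA A H0 \<iota> Bm Bp (A_Q \<zeta> E) A_inv"
  unfolding strict_RTA_def using A.F_algebra RTA1 RTA2 RTA3 by blast

end

section \<open>Bases and discrete gradings\<close>

lemma finite_vec_interval: "finite {n :: int^'k. \<forall>j. 0 \<le> n$j \<and> n$j \<le> b$j}"
proof (rule finite_subset)
  show "{n :: int^'k. \<forall>j. 0 \<le> n$j \<and> n$j \<le> b$j} \<subseteq> (\<lambda>f. \<chi> j. f j) ` (\<Pi>\<^sub>E j\<in>UNIV. {0..b$j})"
  proof
    fix n :: "int^'k" assume "n \<in> {n. \<forall>j. 0 \<le> n$j \<and> n$j \<le> b$j}"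
    then have "(\<lambda>j. n$j) \<in> (\<Pi>\<^sub>E j\<in>UNIV. {0..b$j})" by auto
    then show "n \<in> (\<lambda>f. \<chi> j. f j) ` (\<Pi>\<^sub>E j\<in>UNIV. {0..b$j})"
      by (intro image_eqI[of _ _ "\<lambda>j. n$j"]) (auto simp: vec_eq_iff)
  qed
qed (intro finite_imageI finite_PiE, auto)

locale zeta_alg_nontrivial = zeta_alg \<zeta> E c for \<zeta> :: "real^'k" and E and c :: "'f::field^'k" +
  assumes E_nontrivial: "E \<noteq> {0}"
begin

abbreviation "GA \<equiv> alg_aut H0"

interpretation GA: group GA by (rule falg.group_alg_aut[OF H0_falg])

lemma E_pos: "\<exists>e\<in>E. 0 < e"
proof -
  obtain e where e: "e \<in> E" "e \<noteq> 0" using E_nontrivial E_zero by blast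
  show ?thesis
  proof (cases "0 < e")
    case True with e show ?thesis by blast
  next
    case False with e E_neg[OF e(1)] show ?thesis by (intro bexI[of _ "- e"]) auto
  qed
qed

lemma E_int_mult: "e \<in> E \<Longrightarrow> of_int m * e \<in> E"
proof -
  assume e: "e \<in> E"
  have n: "of_nat n * e \<in> E" for n
    by (induction n) (auto simp: E_zero E_add e algebra_simps)
  show ?thesis
  proof (cases "0 \<le> m")
    case True then show ?thesis using n[of "nat m"] by simp
  next
    case False then show ?thesis using E_neg[OF n[of "nat (- m)"]] by simp
  qed
qed

lemma \<Phi>_eq: "g \<in> carrier SG \<Longrightarrow> h \<in> carrier SG \<Longrightarrow> \<Phi> g = \<Phi> h \<longleftrightarrow> g = h"
  using inj_onD[OF \<Phi>_inj] by blast

lemma Cone_SG: "g \<in> Cone \<Longrightarrow> g \<in> carrier SG"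
  by (rule nonneg_carrier)

text \<open>
  The condition that \<open>\<E> = \<eta>\<int>\<close> with \<open>\<eta> \<noteq> 0\<close>, and that all \<open>\<zeta>\<^sub>j\<close> are \<open>1\<close>.
\<close>

definition cyclic :: bool where
  "cyclic \<longleftrightarrow> (\<exists>\<eta>. \<eta> \<noteq> 0 \<and> E = {\<eta> * of_int m | m. True}) \<and> (\<forall>j. \<zeta>$j = 1)"

text \<open>
  If \<open>\<E> = \<eta>\<int>\<close>, then \<open>\<zeta>\<^sub>j\<close> and its inverse are both integers.
\<close>

lemma cyclic_zeta:
  assumes "\<eta> \<noteq> 0" "E = {\<eta> * of_int m | m. True}"
  shows "\<zeta>$j = 1"
proof -
  have \<eta>: "\<eta> \<in> E" unfolding assms(2) by (rule CollectI, rule exI[of _ 1]) simp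
  obtain m :: int where m: "\<zeta>$j * \<eta> = \<eta> * of_int m" using zeta_E(1)[OF \<eta>, of j] unfolding assms(2) by blast
  obtain m' :: int where m': "inverse (\<zeta>$j) * \<eta> = \<eta> * of_int m'" using zeta_E(2)[OF \<eta>, of j] unfolding assms(2) by blast
  have 1: "\<zeta>$j = of_int m" "inverse (\<zeta>$j) = of_int m'" using m m' assms(1) by simp_all
  then have "of_int (m * m') = (1 :: real)" by (metis of_int_mult right_inverse zeta_nz)
  then have "m * m' = 1" by linarith
  moreover have "0 < m" using zeta_pos[of j] 1(1) by simp
  ultimately have "m = 1" by (auto simp: zmult_eq_1_iff)
  then show ?thesis using 1(1) by simp
qed

lemma cyclicI:
  assumes "0 < \<eta>" "\<eta> \<in> E" "\<And>e. e \<in> E \<Longrightarrow> 0 \<le> e \<Longrightarrow> \<exists>m. e = \<eta> * of_int m"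
  shows cyclic
proof -
  have "E = {\<eta> * of_int m | m. True}"
  proof (intro equalityI subsetI)
    fix e assume e: "e \<in> E"
    show "e \<in> {\<eta> * of_int m | m. True}"
    proof (cases "0 \<le> e")
      case True with assms(3)[OF e] show ?thesis by blast
    next
      case False
      with assms(3)[OF E_neg[OF e]] obtain m where "- e = \<eta> * of_int m" by auto
      then have "e = \<eta> * of_int (- m)" by simp
      then show ?thesis by blast
    qed
  next
    fix e assume "e \<in> {\<eta> * of_int m | m. True}"
    then show "e \<in> E" using E_int_mult[OF assms(2)] by (auto simp: mult.commute)
  qed
  moreover have "\<eta> \<noteq> 0" using assms(1) by simp
  ultimately show ?thesis unfolding cyclic_def using cyclic_zeta[of \<eta>] by blast
qed

lemma cyclicD:
  assumes cyclic
  shows "\<exists>\<eta>. 0 < \<eta> \<and> \<eta> \<in> E \<and> (\<forall>e\<in>E. \<exists>m. e = \<eta> * of_int m)"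
proof -
  from assms obtain \<eta> where \<eta>: "\<eta> \<noteq> 0" "E = {\<eta> * of_int m | m. True}" by (auto simp: cyclic_def)
  have "\<bar>\<eta>\<bar> \<in> E"
    unfolding \<eta>(2) by (rule CollectI, rule exI[of _ "if \<eta> < 0 then - 1 else 1"]) simp
  moreover have "\<exists>m. e = \<bar>\<eta>\<bar> * of_int m" if e: "e \<in> E" for e
  proof -
    obtain m where "e = \<eta> * of_int m" using e unfolding \<eta>(2) by blast
    then show ?thesis by (intro exI[of _ "if \<eta> < 0 then - m else m"]) simp
  qed
  ultimately show ?thesis using \<eta>(1) by (intro exI[of _ "\<bar>\<eta>\<bar>"]) simp
qed

lemma discrete_cyclic:
  assumes "RTA_discretely_graded H0 (A_Q \<zeta> E)"
  shows cyclic
proof -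
  obtain e0 where e0: "e0 \<in> E" "0 < e0" using E_pos by blast
  have c0: "(0, e0) \<in> Cone" using e0 by (intro Cone_gens) auto
  let ?I = "{\<theta> \<in> carrier GA. RTA_ge H0 (A_Q \<zeta> E) \<theta> \<one>\<^bsub>GA\<^esub> \<and> RTA_ge H0 (A_Q \<zeta> E) (\<Phi> (0, e0)) \<theta>}"
  let ?S = "{e \<in> E. 0 \<le> e \<and> e \<le> e0}"
  have fin: "finite ?I" using assms c0 unfolding RTA_discretely_graded_def Q_eq by blast
  have "(\<lambda>e. \<Phi> (0, e)) ` ?S \<subseteq> ?I"
  proof
    fix \<theta> assume "\<theta> \<in> (\<lambda>e. \<Phi> (0, e)) ` ?S"
    then obtain e where e: "e \<in> E" "0 \<le> e" "e \<le> e0" and \<theta>: "\<theta> = \<Phi> (0, e)" by blast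
    have c: "(0, e) \<in> Cone" "(0, e0 - e) \<in> Cone" using e e0 E_diff[of e0 e] by (auto simp: SG_nonneg)
    have m: "\<Phi> (0, e0 - e) \<otimes>\<^bsub>GA\<^esub> \<Phi> (0, e) = \<Phi> (0, e0)"
      using c Cone_SG by (simp add: \<Phi>_mult) (simp add: SG_simps)
    have "\<Phi> (0, e) = \<Phi> (0, e) \<otimes>\<^bsub>GA\<^esub> \<one>\<^bsub>GA\<^esub>"
      by (rule GA.r_one[OF \<Phi>_closed[OF Cone_SG[OF c(1)]], symmetric])
    then show "\<theta> \<in> ?I"
      unfolding RTA_ge_def Q_eq \<theta> using c Cone_SG m[symmetric] \<Phi>_closed by blast
  qed
  then have "finite ((\<lambda>e. \<Phi> (0, e)) ` ?S)" using fin by (rule finite_subset)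
  moreover have "inj_on (\<lambda>e. \<Phi> (0, e)) ?S"
    by (rule inj_onI) (auto simp: \<Phi>_eq SG_simps)
  ultimately have "finite ?S" by (rule finite_imageD)
  then have fin: "finite {e \<in> E. 0 < e \<and> e \<le> e0}" by (rule rev_finite_subset) auto
  define \<eta> where "\<eta> = Min {e \<in> E. 0 < e \<and> e \<le> e0}"
  have "\<eta> \<in> {e \<in> E. 0 < e \<and> e \<le> e0}" unfolding \<eta>_def by (rule Min_in[OF fin]) (use e0 in blast)
  then have \<eta>: "\<eta> \<in> E" "0 < \<eta>" "\<eta> \<le> e0" by auto
  have min: "\<eta> \<le> e" if "e \<in> E" "0 < e" for e
  proof (cases "e \<le> e0")
    case True then show ?thesis unfolding \<eta>_def using that by (intro Min_le[OF fin]) auto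
  qed (use \<eta> in auto)
  show ?thesis
  proof (rule cyclicI[OF \<eta>(2,1)])
    fix e assume e: "e \<in> E"
    define r where "r = e - of_int \<lfloor>e / \<eta>\<rfloor> * \<eta>"
    have "r \<in> E" unfolding r_def by (intro E_diff e E_int_mult \<eta>)
    moreover have "0 \<le> r" unfolding r_def using floor_divide_lower[OF \<eta>(2), of e] by simp
    moreover have "r < \<eta>" unfolding r_def using floor_divide_upper[OF \<eta>(2), of e] by (simp add: algebra_simps)
    ultimately have "r = 0" using min[of r] by force
    then have "e = \<eta> * of_int \<lfloor>e / \<eta>\<rfloor>" by (simp add: r_def mult.commute)
    then show "\<exists>m. e = \<eta> * of_int m" by blast
  qed
qed

lemma z_one:
  assumes "\<And>j. \<zeta>$j = 1"
  shows "z n = 1"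
  by (simp add: zeta_pow_def assms)

lemma cyclic_discrete:
  assumes cyclic
  shows "RTA_discretely_graded H0 (A_Q \<zeta> E)"
  unfolding RTA_discretely_graded_def Q_eq
proof (rule ballI)
  have z1: "z n = 1" for n by (rule z_one) (use assms in \<open>simp add: cyclic_def\<close>)
  obtain \<eta> where \<eta>: "0 < \<eta>" "\<eta> \<in> E" "\<And>e. e \<in> E \<Longrightarrow> \<exists>m. e = \<eta> * of_int m"
    using cyclicD[OF assms] by blast
  fix \<theta>0 assume "\<theta>0 \<in> \<Phi> ` Cone"
  then obtain n0 e0 where c0: "(n0, e0) \<in> Cone" and \<theta>0: "\<theta>0 = \<Phi> (n0, e0)" by auto
  let ?N = "{n. \<forall>j. 0 \<le> n$j \<and> n$j \<le> n0$j}" and ?S = "{e \<in> E. 0 \<le> e \<and> e \<le> e0}"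
  have "?S \<subseteq> (\<lambda>m. \<eta> * of_int m) ` {0..\<lceil>e0 / \<eta>\<rceil>}"
  proof
    fix e assume e: "e \<in> ?S"
    then obtain m where m: "e = \<eta> * of_int m" using \<eta>(3) by blast
    have "0 \<le> m" using e \<eta>(1) unfolding m by (simp add: zero_le_mult_iff)
    moreover have "of_int m \<le> e0 / \<eta>" using e \<eta>(1) unfolding m by (simp add: field_simps)
    then have "m \<le> \<lceil>e0 / \<eta>\<rceil>" by linarith
    ultimately show "e \<in> (\<lambda>m. \<eta> * of_int m) ` {0..\<lceil>e0 / \<eta>\<rceil>}" using m by auto
  qed
  then have "finite ?S" by (rule finite_subset) simp
  then have fin: "finite (\<Phi> ` (?N \<times> ?S))" using finite_vec_interval[of n0] by blast
  have "{\<theta> \<in> carrier GA. RTA_ge H0 (\<Phi> ` Cone) \<theta> \<one>\<^bsub>GA\<^esub> \<and> RTA_ge H0 (\<Phi> ` Cone) \<theta>0 \<theta>} \<subseteq> \<Phi> ` (?N \<times> ?S)"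
  proof
    fix \<theta> assume "\<theta> \<in> {\<theta> \<in> carrier GA. RTA_ge H0 (\<Phi> ` Cone) \<theta> \<one>\<^bsub>GA\<^esub> \<and> RTA_ge H0 (\<Phi> ` Cone) \<theta>0 \<theta>}"
    then obtain g k where g: "g \<in> Cone" "\<theta> = \<Phi> g \<otimes>\<^bsub>GA\<^esub> \<one>\<^bsub>GA\<^esub>" and k: "k \<in> Cone" "\<theta>0 = \<Phi> k \<otimes>\<^bsub>GA\<^esub> \<theta>"
      unfolding RTA_ge_def by blast
    have \<theta>: "\<theta> = \<Phi> g" unfolding g(2) by (rule GA.r_one[OF \<Phi>_closed[OF Cone_SG[OF g(1)]]])
    obtain n e where ne: "g = (n, e)" by (cases g)
    obtain n' e' where ne': "k = (n', e')" by (cases k)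
    have "\<Phi> (n0, e0) = \<Phi> (k \<otimes>\<^bsub>SG\<^esub> g)" using k(2) \<theta>0 \<theta> g(1) k(1) Cone_SG by (simp add: \<Phi>_mult)
    then have "(n0, e0) = k \<otimes>\<^bsub>SG\<^esub> g" using \<Phi>_eq[of "(n0, e0)" "k \<otimes>\<^bsub>SG\<^esub> g"] c0 g(1) k(1) Cone_SG by simp
    then have "n0 = n' + n" "e0 = e' + e" by (simp_all add: ne ne' SG_simps z1)
    then have "n \<in> ?N" "e \<in> ?S" using g(1) k(1) by (auto simp: ne ne' SG_nonneg)
    then show "\<theta> \<in> \<Phi> ` (?N \<times> ?S)" using \<theta> ne by blast
  qed
  then show "finite {\<theta> \<in> carrier GA. RTA_ge H0 (\<Phi> ` Cone) \<theta> \<one>\<^bsub>GA\<^esub> \<and> RTA_ge H0 (\<Phi> ` Cone) \<theta>0 \<theta>}"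
    using fin by (rule finite_subset)
qed

text \<open>
  The integral combination of group elements with coefficients \<open>k\<close>. It is the product of their powers in
  the group if all \<open>\<zeta>\<^sub>j\<close> are \<open>1\<close>.
\<close>

definition comb :: "((int^'k) \<times> real) set \<Rightarrow> ((int^'k) \<times> real \<Rightarrow> int) \<Rightarrow> (int^'k) \<times> real" where
  "comb S k = (\<chi> j. \<Sum>s\<in>S. k s * fst s $ j, \<Sum>s\<in>S. of_int (k s) * snd s)"

lemma int_pow_SG:
  assumes z1: "\<And>n. z n = 1" and s: "s \<in> carrier SG"
  shows "s [^]\<^bsub>SG\<^esub> (k :: int) = (\<chi> j. k * fst s $ j, of_int k * snd s)"
proof -
  obtain n e where ne: "s = (n, e)" "e \<in> E" using s by (auto simp: SG_simps)
  have p: "s [^]\<^bsub>SG\<^esub> m = (\<chi> j. int m * n $ j, of_nat m * e)" for m :: nat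
    by (induction m) (auto simp: ne SG_simps z1 vec_eq_iff algebra_simps)
  show ?thesis
  proof (cases "0 \<le> k")
    case True
    then show ?thesis using p[of "nat k"] int_pow_int[of SG s "nat k"] by (simp add: ne)
  next
    case False
    have "s [^]\<^bsub>SG\<^esub> k = inv\<^bsub>SG\<^esub> (s [^]\<^bsub>SG\<^esub> nat (- k))"
      using False s SG.int_pow_neg[of s "int (nat (- k))"] int_pow_int[of SG s "nat (- k)"] by simp
    also have "\<dots> = (\<chi> j. k * n $ j, of_int k * e)"
      unfolding p using False E_int_mult[OF ne(2), of "- k"] by (subst SG_inv) (auto simp: z1 vec_eq_iff)
    finally show ?thesis by (simp add: ne)
  qed
qed

text \<open>
  When all \<open>\<zeta>\<^sub>j\<close> are \<open>1\<close> the group is commutative, and products of powers of automorphisms in its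
  image can be computed in the group.
\<close>

lemma finprod_comb:
  assumes z1: "\<And>n. z n = 1" and D: "D \<subseteq> carrier SG" and S: "finite S" "S \<subseteq> D"
  shows "finprod (subgroup_generated GA (\<Phi> ` D)) (\<lambda>\<delta>. \<delta> [^]\<^bsub>GA\<^esub> (k \<delta> :: int)) (\<Phi> ` S) = \<Phi> (comb S (\<lambda>s. k (\<Phi> s)))
    \<and> comb S (\<lambda>s. k (\<Phi> s)) \<in> carrier SG"
proof -
  let ?K = "subgroup_generated GA (\<Phi> ` D)"
  have D': "\<Phi> ` D \<subseteq> carrier GA" using D \<Phi>_closed by blast
  have K: "carrier ?K = generate GA (\<Phi> ` D)"
    using D' by (simp add: carrier_subgroup_generated Int_absorb1)
  have sub: "generate GA (\<Phi> ` D) \<subseteq> \<Phi> ` carrier SG"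
    by (rule GA.generate_subgroup_incl[OF _ group_hom.img_is_subgroup[OF \<Phi>_hom]]) (use D in blast)
  have comm: "\<Phi> g \<otimes>\<^bsub>GA\<^esub> \<Phi> h = \<Phi> h \<otimes>\<^bsub>GA\<^esub> \<Phi> g" if "g \<in> carrier SG" "h \<in> carrier SG" for g h
    using that by (cases g; cases h) (simp add: \<Phi>_mult SG_simps z1 add.commute)
  interpret K: comm_group ?K
  proof (rule group.group_comm_groupI)
    show "Group.group ?K" by (rule GA.group_subgroup_generated)
    show "x \<otimes>\<^bsub>?K\<^esub> y = y \<otimes>\<^bsub>?K\<^esub> x" if xy: "x \<in> carrier ?K" "y \<in> carrier ?K" for x y
    proof -
      obtain g where g: "g \<in> carrier SG" "x = \<Phi> g"
        using subsetD[OF sub xy(1)[unfolded K]] by (rule imageE)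
      obtain h where h: "h \<in> carrier SG" "y = \<Phi> h"
        using subsetD[OF sub xy(2)[unfolded K]] by (rule imageE)
      show ?thesis using comm[OF g(1) h(1)] g(2) h(2) by simp
    qed
  qed
  have gen: "subgroup (generate GA (\<Phi> ` D)) GA" by (rule GA.generate_is_subgroup[OF D'])
  have pow: "\<Phi> s [^]\<^bsub>GA\<^esub> m \<in> carrier ?K" if "s \<in> D" for s and m :: int
    unfolding K by (rule GA.subgroup_int_pow_closed[OF gen]) (use that in \<open>blast intro: generate.incl\<close>)
  have inj: "inj_on \<Phi> D" by (rule inj_on_subset[OF \<Phi>_inj D])
  show ?thesis
    using S
  proof (induction S)
    case empty
    have "comb {} (\<lambda>s. k (\<Phi> s)) = \<one>\<^bsub>SG\<^esub>" by (simp add: comb_def SG_simps vec_eq_iff)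
    then show ?case by (simp add: \<Phi>_one)
  next
    case (insert s S)
    then have s: "s \<in> D" "s \<in> carrier SG" and IH: "finprod ?K (\<lambda>\<delta>. \<delta> [^]\<^bsub>GA\<^esub> k \<delta>) (\<Phi> ` S) = \<Phi> (comb S (\<lambda>s. k (\<Phi> s)))"
      "comb S (\<lambda>s. k (\<Phi> s)) \<in> carrier SG" using D by auto
    have ni: "\<Phi> s \<notin> \<Phi> ` S" using insert inj s by (auto dest: inj_onD)
    have "finprod ?K (\<lambda>\<delta>. \<delta> [^]\<^bsub>GA\<^esub> k \<delta>) (insert (\<Phi> s) (\<Phi> ` S))
        = \<Phi> s [^]\<^bsub>GA\<^esub> k (\<Phi> s) \<otimes>\<^bsub>?K\<^esub> finprod ?K (\<lambda>\<delta>. \<delta> [^]\<^bsub>GA\<^esub> k \<delta>) (\<Phi> ` S)"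
      by (rule K.finprod_insert) (use insert ni pow in auto)
    also have "\<dots> = \<Phi> (s [^]\<^bsub>SG\<^esub> k (\<Phi> s)) \<otimes>\<^bsub>GA\<^esub> \<Phi> (comb S (\<lambda>s. k (\<Phi> s)))"
      unfolding IH(1) using s by (simp add: group_hom.hom_int_pow[OF \<Phi>_hom])
    also have "\<dots> = \<Phi> (s [^]\<^bsub>SG\<^esub> k (\<Phi> s) \<otimes>\<^bsub>SG\<^esub> comb S (\<lambda>s. k (\<Phi> s)))"
      using s IH(2) by (simp add: \<Phi>_mult)
    also have eq: "s [^]\<^bsub>SG\<^esub> k (\<Phi> s) \<otimes>\<^bsub>SG\<^esub> comb S (\<lambda>s. k (\<Phi> s)) = comb (insert s S) (\<lambda>s. k (\<Phi> s))"
      unfolding int_pow_SG[OF z1 s(2)] using insert.hyps by (simp add: comb_def SG_simps z1 vec_eq_iff)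
    finally have 1: "finprod ?K (\<lambda>\<delta>. \<delta> [^]\<^bsub>GA\<^esub> k \<delta>) (\<Phi> ` insert s S) = \<Phi> (comb (insert s S) (\<lambda>s. k (\<Phi> s)))"
      by simp
    have "s [^]\<^bsub>SG\<^esub> k (\<Phi> s) \<otimes>\<^bsub>SG\<^esub> comb S (\<lambda>s. k (\<Phi> s)) \<in> carrier SG" using s IH(2) by simp
    with 1 show ?case unfolding eq by blast
  qed
qed

lemma Z_independent_iff:
  assumes z1: "\<And>n. z n = 1" and D: "D \<subseteq> carrier SG"
  shows "Z_independent GA (\<Phi> ` D) \<longleftrightarrow> (\<forall>S k. finite S \<and> S \<subseteq> D \<and> comb S k = (0, 0) \<longrightarrow> (\<forall>s\<in>S. k s = 0))"
proof
  have inj: "inj_on \<Phi> D" by (rule inj_on_subset[OF \<Phi>_inj D])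
  {
    assume L: "Z_independent GA (\<Phi> ` D)"
    show "\<forall>S k. finite S \<and> S \<subseteq> D \<and> comb S k = (0, 0) \<longrightarrow> (\<forall>s\<in>S. k s = 0)"
    proof (intro allI impI ballI)
      fix S k s assume S: "finite S \<and> S \<subseteq> D \<and> comb S k = (0, 0)" and s: "s \<in> S"
      define k' where "k' \<delta> = k (inv_into D \<Phi> \<delta>)" for \<delta>
      have k': "k' (\<Phi> s) = k s" if "s \<in> S" for s
      proof -
        have "s \<in> D" using that S by blast
        then show ?thesis by (simp add: k'_def inv_into_f_f[OF inj])
      qed
      have "comb S (\<lambda>s. k' (\<Phi> s)) = comb S k" unfolding comb_def by (simp add: k')
      then have "finprod (subgroup_generated GA (\<Phi> ` D)) (\<lambda>\<delta>. \<delta> [^]\<^bsub>GA\<^esub> k' \<delta>) (\<Phi> ` S) = \<one>\<^bsub>GA\<^esub>"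
        using finprod_comb[OF z1 D, of S k'] S \<Phi>_one by (simp add: SG_simps)
      then have "\<forall>\<delta>\<in>\<Phi> ` S. k' \<delta> = 0" using L S unfolding Z_independent_def by blast
      then show "k s = 0" using s k' by auto
    qed
  next
    assume R: "\<forall>S k. finite S \<and> S \<subseteq> D \<and> comb S k = (0, 0) \<longrightarrow> (\<forall>s\<in>S. k s = 0)"
    show "Z_independent GA (\<Phi> ` D)"
      unfolding Z_independent_def
    proof (intro allI impI)
      fix T and k :: "_ \<Rightarrow> int"
      assume T: "finite T \<and> T \<subseteq> \<Phi> ` D \<and>
        finprod (subgroup_generated GA (\<Phi> ` D)) (\<lambda>\<delta>. \<delta> [^]\<^bsub>GA\<^esub> k \<delta>) T = \<one>\<^bsub>GA\<^esub>"
      then obtain S where S: "S \<subseteq> D" "finite S" "T = \<Phi> ` S" by (meson finite_subset_image)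
      have "\<Phi> (comb S (\<lambda>s. k (\<Phi> s))) = \<Phi> \<one>\<^bsub>SG\<^esub>" "comb S (\<lambda>s. k (\<Phi> s)) \<in> carrier SG"
        using finprod_comb[OF z1 D S(2,1), of k] T S(3) \<Phi>_one by simp_all
      then have "comb S (\<lambda>s. k (\<Phi> s)) = (0, 0)" using \<Phi>_eq by (metis SG.one_closed SG_simps(3))
      with R S have "\<forall>s\<in>S. k (\<Phi> s) = 0" by blast
      then show "\<forall>\<delta>\<in>T. k \<delta> = 0" using S(3) by blast
    qed
  }
qed

lemma cyclic_based:
  assumes cyclic
  shows "RTA_based H0 (A_Q \<zeta> E)"
proof -
  have z1: "z n = 1" for n by (rule z_one) (use assms in \<open>simp add: cyclic_def\<close>)
  obtain \<eta> where \<eta>: "0 < \<eta>" "\<eta> \<in> E" "\<And>e. e \<in> E \<Longrightarrow> \<exists>m. e = \<eta> * of_int m"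
    using cyclicD[OF assms] by blast
  define D :: "((int^'k) \<times> real) set" where "D = insert (0, \<eta>) (range (\<lambda>j. (axis j 1, 0)))"
  have DC: "D \<subseteq> Cone" using Cone_gens \<eta> by (auto simp: D_def)
  then have DS: "D \<subseteq> carrier SG" using Cone_SG by blast
  have comm: "\<delta> \<otimes>\<^bsub>GA\<^esub> \<delta>' = \<delta>' \<otimes>\<^bsub>GA\<^esub> \<delta>" if \<delta>: "\<delta> \<in> \<Phi> ` D" "\<delta>' \<in> \<Phi> ` D" for \<delta> \<delta>'
  proof -
    obtain g where g: "g \<in> carrier SG" "\<delta> = \<Phi> g" using \<delta>(1) DS by blast
    obtain h where h: "h \<in> carrier SG" "\<delta>' = \<Phi> h" using \<delta>(2) DS by blast
    show ?thesis using g h by (cases g; cases h) (simp add: \<Phi>_mult SG_simps z1 add.commute)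
  qed
  have ind: "Z_independent GA (\<Phi> ` D)"
    unfolding Z_independent_iff[OF z1 DS]
  proof (intro allI impI ballI)
    fix S k s assume S: "finite S \<and> S \<subseteq> D \<and> comb S k = (0, 0)" and s: "s \<in> S"
    have c1: "(\<Sum>s\<in>S. k s * fst s $ j) = 0" for j
      using S by (auto simp: comb_def vec_eq_iff)
    have c2: "(\<Sum>s\<in>S. of_int (k s) * snd s) = 0" using S by (simp add: comb_def)
    have "s \<in> D" using S s by blast
    then consider "s = (0, \<eta>)" | j where "s = (axis j 1, 0)" by (auto simp: D_def)
    then show "k s = 0"
    proof cases
      case 1
      have "(\<Sum>t\<in>S. of_int (k t) * snd t) = (\<Sum>t\<in>S. if t = s then of_int (k s) * \<eta> else 0)"
        by (rule sum.cong[OF refl]) (use S 1 in \<open>auto simp: D_def\<close>)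
      also have "\<dots> = of_int (k s) * \<eta>" using S s by simp
      finally show ?thesis using c2 \<eta>(1) by simp
    next
      case (2 j)
      have "(\<Sum>t\<in>S. k t * fst t $ j) = (\<Sum>t\<in>S. if t = s then k s else 0)"
      proof (rule sum.cong[OF refl])
        fix t assume "t \<in> S"
        then have "t \<in> D" using S by blast
        then consider "t = (0, \<eta>)" | i where "t = (axis i 1, 0)" by (auto simp: D_def)
        then show "k t * fst t $ j = (if t = s then k s else 0)"
        proof cases
          case 1 then show ?thesis using 2 \<eta>(1) by simp
        next
          case (2 i)
          have "axis i 1 = (axis j 1 :: int^'k) \<longleftrightarrow> i = j" by (simp add: axis_eq_axis)
          then show ?thesis using 2 \<open>s = (axis j 1, 0)\<close> by (auto simp: axis_index)
        qed
      qed
      also have "\<dots> = k s" using S s by simp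
      finally show ?thesis using c1[of j] by simp
    qed
  qed
  have "\<Phi> ` Cone = \<Inter>{M. submonoid M GA \<and> \<Phi> ` D \<subseteq> M}"
  proof
    show "\<Inter>{M. submonoid M GA \<and> \<Phi> ` D \<subseteq> M} \<subseteq> \<Phi> ` Cone"
      using Q_submonoid DC by blast
    show "\<Phi> ` Cone \<subseteq> \<Inter>{M. submonoid M GA \<and> \<Phi> ` D \<subseteq> M}"
    proof (intro Inter_greatest image_subsetI)
      fix M g assume M: "M \<in> {M. submonoid M GA \<and> \<Phi> ` D \<subseteq> M}" and g: "g \<in> Cone"
      interpret M: submonoid M GA using M by blast
      have DM: "\<Phi> (0, \<eta>) \<in> M" "\<Phi> (axis j 1, 0) \<in> M" for j using M by (auto simp: D_def)
      obtain js d where jd: "g = (vsum js, d)" "d \<in> E" "0 \<le> d" using g by (rule Cone_cases)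
      have 1: "\<Phi> (vsum js, 0) \<in> M" for js
      proof (induction js)
        case Nil then show ?case using M.one_closed \<Phi>_one by (simp add: SG_simps)
      next
        case (Cons j js)
        have "\<Phi> (vsum (j # js), 0) = \<Phi> (axis j 1, 0) \<otimes>\<^bsub>GA\<^esub> \<Phi> (vsum js, 0)"
          using E_zero by (subst \<Phi>_mult) (simp_all add: SG_simps)
        then show ?case using M.m_closed[OF DM(2) Cons] by simp
      qed
      have 2: "\<Phi> (0, \<eta> * of_nat m) \<in> M" for m
      proof (induction m)
        case 0 then show ?case using M.one_closed \<Phi>_one by (simp add: SG_simps)
      next
        case (Suc m)
        have "\<Phi> (0, \<eta> * of_nat (Suc m)) = \<Phi> (0, \<eta>) \<otimes>\<^bsub>GA\<^esub> \<Phi> (0, \<eta> * of_nat m)"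
          using \<eta>(2) E_int_mult[OF \<eta>(2), of "int m"]
          by (subst \<Phi>_mult) (simp_all add: SG_simps algebra_simps)
        then show ?case using M.m_closed[OF DM(1) Suc] by simp
      qed
      obtain m where m: "d = \<eta> * of_int m" using \<eta>(3)[OF jd(2)] by blast
      then have "0 \<le> m" using jd(3) \<eta>(1) by (simp add: zero_le_mult_iff)
      then have "\<Phi> (0, d) \<in> M" using 2[of "nat m"] m by simp
      moreover have "\<Phi> g = \<Phi> (0, d) \<otimes>\<^bsub>GA\<^esub> \<Phi> (vsum js, 0)"
        using jd E_zero by (subst \<Phi>_mult) (simp_all add: SG_simps)
      ultimately show "\<Phi> g \<in> M" using M.m_closed 1 by simp
    qed
  qed
  then show ?thesis
    unfolding RTA_based_def Q_eq using comm ind DC by (intro exI[of _ "\<Phi> ` D"]) blast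
qed

lemma based_cyclic:
  assumes "RTA_based H0 (A_Q \<zeta> E)"
  shows cyclic
proof -
  from assms[unfolded RTA_based_def Q_eq] obtain \<Delta> where \<Delta>: "\<Delta> \<subseteq> \<Phi> ` Cone"
    "\<forall>\<delta>\<in>\<Delta>. \<forall>\<delta>'\<in>\<Delta>. \<delta> \<otimes>\<^bsub>GA\<^esub> \<delta>' = \<delta>' \<otimes>\<^bsub>GA\<^esub> \<delta>"
    "Z_independent GA \<Delta>" "\<Phi> ` Cone = \<Inter>{M. submonoid M GA \<and> \<Delta> \<subseteq> M}"
    by (elim exE conjE)
  \<comment> \<open>\<open>Q\<close> lies in the centralizer of \<open>\<Delta>\<close>, hence \<open>\<Delta>\<close> in that of \<open>Q\<close>, and then \<open>Q\<close> in its own.\<close>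
  let ?C = "\<lambda>T. {\<theta> \<in> carrier GA. \<forall>x\<in>T. \<theta> \<otimes>\<^bsub>GA\<^esub> x = x \<otimes>\<^bsub>GA\<^esub> \<theta>}"
  have QG: "\<Phi> ` Cone \<subseteq> carrier GA" using Cone_SG \<Phi>_closed by blast
  have least: "\<Phi> ` Cone \<subseteq> M" if "submonoid M GA" "\<Delta> \<subseteq> M" for M using that \<Delta>(4) by blast
  have cent: "submonoid (?C T) GA" if T: "T \<subseteq> carrier GA" for T
  proof
    show "\<one>\<^bsub>GA\<^esub> \<in> (?C T)" using T by auto
    fix x y assume xy: "x \<in> (?C T)"
      "y \<in> (?C T)"
    have "x \<otimes>\<^bsub>GA\<^esub> y \<otimes>\<^bsub>GA\<^esub> t = t \<otimes>\<^bsub>GA\<^esub> (x \<otimes>\<^bsub>GA\<^esub> y)" if t: "t \<in> T" for t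
    proof -
      have c: "x \<in> carrier GA" "y \<in> carrier GA" "t \<in> carrier GA" using xy t T by auto
      have "x \<otimes>\<^bsub>GA\<^esub> y \<otimes>\<^bsub>GA\<^esub> t = x \<otimes>\<^bsub>GA\<^esub> (t \<otimes>\<^bsub>GA\<^esub> y)" using xy t c by (simp add: GA.m_assoc)
      also have "\<dots> = (t \<otimes>\<^bsub>GA\<^esub> x) \<otimes>\<^bsub>GA\<^esub> y" using xy t c by (simp add: GA.m_assoc[symmetric])
      finally show ?thesis using c by (simp add: GA.m_assoc)
    qed
    then show "x \<otimes>\<^bsub>GA\<^esub> y \<in> (?C T)" using xy by auto
  qed auto
  have \<Delta>G: "\<Delta> \<subseteq> carrier GA" using \<Delta>(1) QG by blast
  have "\<Phi> ` Cone \<subseteq> (?C \<Delta>)"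
    by (rule least[OF cent[OF \<Delta>G]]) (use \<Delta>G \<Delta>(2) in blast)
  then have 1: "\<theta> \<otimes>\<^bsub>GA\<^esub> x = x \<otimes>\<^bsub>GA\<^esub> \<theta>" if "\<theta> \<in> \<Phi> ` Cone" "x \<in> \<Delta>" for \<theta> x using that by blast
  have "\<Phi> ` Cone \<subseteq> (?C (\<Phi> ` Cone))"
  proof (rule least[OF cent[OF QG]], rule subsetI)
    fix \<delta> assume "\<delta> \<in> \<Delta>"
    then show "\<delta> \<in> (?C (\<Phi> ` Cone))"
      using \<Delta>G 1[symmetric] by blast
  qed
  then have comm: "\<Phi> g \<otimes>\<^bsub>GA\<^esub> \<Phi> h = \<Phi> h \<otimes>\<^bsub>GA\<^esub> \<Phi> g" if "g \<in> Cone" "h \<in> Cone" for g h using that by blast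
  obtain e0 where e0: "e0 \<in> E" "0 < e0" using E_pos by blast
  have \<zeta>1: "\<zeta>$j = 1" for j
  proof -
    have c: "(axis j 1, 0) \<in> Cone" "(0, e0) \<in> Cone" using Cone_gens e0 by auto
    from comm[OF c] have "\<Phi> ((axis j 1, 0) \<otimes>\<^bsub>SG\<^esub> (0, e0)) = \<Phi> ((0, e0) \<otimes>\<^bsub>SG\<^esub> (axis j 1, 0))"
      using c Cone_SG by (simp add: \<Phi>_mult)
    then have "(axis j 1, 0) \<otimes>\<^bsub>SG\<^esub> (0, e0) = (0, e0) \<otimes>\<^bsub>SG\<^esub> (axis j 1, 0)"
      using c Cone_SG \<Phi>_eq by (metis SG.m_closed)
    then show ?thesis using e0(2) by (simp add: SG_simps z_axis)
  qed
  have z1: "z n = 1" for n by (rule z_one[OF \<zeta>1])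
  define D where "D = {g \<in> Cone. \<Phi> g \<in> \<Delta>}"
  have DC: "D \<subseteq> Cone" and DS: "D \<subseteq> carrier SG" and \<Phi>D: "\<Phi> ` D = \<Delta>"
    using \<Delta>(1) Cone_SG by (auto simp: D_def)
  have ind: "\<forall>s\<in>S. k s = 0" if "finite S" "S \<subseteq> D" "comb S k = (0, 0)" for S k
    using \<Delta>(3) that unfolding \<Phi>D[symmetric] Z_independent_iff[OF z1 DS] by blast
  \<comment> \<open>The nonnegative combinations of the base already form a submonoid, so they exhaust the cone.\<close>
  define T where "T = {g \<in> Cone. \<exists>S k. finite S \<and> S \<subseteq> D \<and> (\<forall>s. 0 \<le> k s) \<and> g = comb S k}"
  have mono: "comb S k = comb S' (\<lambda>s. if s \<in> S then k s else 0)" if "finite S'" "S \<subseteq> S'" for S S' k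
  proof -
    have "(\<Sum>s\<in>S. k s * fst s $ j) = (\<Sum>s\<in>S'. (if s \<in> S then k s else 0) * fst s $ j)" for j
      by (rule sum.mono_neutral_cong_left) (use that in auto)
    moreover have "(\<Sum>s\<in>S. of_int (k s) * snd s) = (\<Sum>s\<in>S'. of_int (if s \<in> S then k s else 0) * snd s)"
      by (rule sum.mono_neutral_cong_left) (use that in auto)
    ultimately show ?thesis by (simp add: comb_def)
  qed
  have add: "comb S k \<otimes>\<^bsub>SG\<^esub> comb S k' = comb S (\<lambda>s. k s + k' s)" for S k k'
    by (simp add: comb_def SG_simps z1 vec_eq_iff sum.distrib distrib_right)
  have "submonoid (\<Phi> ` T) GA"
  proof
    show "\<Phi> ` T \<subseteq> carrier GA" using QG by (auto simp: T_def)
    have "\<one>\<^bsub>SG\<^esub> = comb {} (\<lambda>_. 0)" by (simp add: comb_def SG_simps vec_eq_iff)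
    then have "\<one>\<^bsub>SG\<^esub> \<in> T" unfolding T_def using nonneg_one
      by (intro CollectI conjI exI[of _ "{}"] exI[of _ "\<lambda>_. 0"]) simp_all
    then show "\<one>\<^bsub>GA\<^esub> \<in> \<Phi> ` T" using \<Phi>_one by (metis imageI)
    fix x y assume "x \<in> \<Phi> ` T" "y \<in> \<Phi> ` T"
    then obtain g h where g: "g \<in> T" "x = \<Phi> g" and h: "h \<in> T" "y = \<Phi> h" by blast
    obtain S k where S: "finite S" "S \<subseteq> D" "\<forall>s. 0 \<le> k s" "g = comb S k" using g(1) by (auto simp: T_def)
    obtain S' k' where S': "finite S'" "S' \<subseteq> D" "\<forall>s. 0 \<le> k' s" "h = comb S' k'" using h(1) by (auto simp: T_def)
    have c: "g \<in> Cone" "h \<in> Cone" using g(1) h(1) by (auto simp: T_def)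
    let ?k = "\<lambda>s. (if s \<in> S then k s else 0) + (if s \<in> S' then k' s else 0)"
    have "g \<otimes>\<^bsub>SG\<^esub> h = comb (S \<union> S') ?k"
      unfolding S(4) S'(4) mono[of "S \<union> S'" S k, OF finite_UnI[OF S(1) S'(1)] Un_upper1]
        mono[of "S \<union> S'" S' k', OF finite_UnI[OF S(1) S'(1)] Un_upper2] by (rule add)
    moreover have "\<forall>s. 0 \<le> ?k s" using S(3) S'(3) by simp
    ultimately have "g \<otimes>\<^bsub>SG\<^esub> h \<in> T"
      unfolding T_def using nonneg_mult[OF c] S(1,2) S'(1,2)
      by (intro CollectI conjI exI[of _ "S \<union> S'"] exI[of _ ?k]) simp_all
    then show "x \<otimes>\<^bsub>GA\<^esub> y \<in> \<Phi> ` T" using g h c Cone_SG by (simp add: \<Phi>_mult)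
  qed
  moreover have "\<Delta> \<subseteq> \<Phi> ` T"
  proof -
    have "g \<in> T" if g: "g \<in> D" for g
    proof -
      have "g = comb {g} (\<lambda>_. 1)" by (simp add: comb_def prod_eq_iff vec_eq_iff)
      then show ?thesis unfolding T_def using g DC
        by (intro CollectI conjI exI[of _ "{g}"] exI[of _ "\<lambda>_. 1"]) auto
    qed
    then show ?thesis using \<Phi>D by blast
  qed
  ultimately have "\<Phi> ` Cone \<subseteq> \<Phi> ` T" by (rule least)
  then have CT: "g \<in> T" if g: "g \<in> Cone" for g
  proof -
    from g \<open>\<Phi> ` Cone \<subseteq> \<Phi> ` T\<close> obtain h where h: "h \<in> T" "\<Phi> g = \<Phi> h" by blast
    then have "h \<in> Cone" by (simp add: T_def)
    with h g show ?thesis using \<Phi>_eq Cone_SG by metis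
  qed
  \<comment> \<open>As all terms are nonnegative, an element \<open>(0, x)\<close> only involves base elements \<open>(0, a)\<close>.\<close>
  have expand: "\<exists>S k. finite S \<and> S \<subseteq> D \<and> (\<forall>s. 0 \<le> k s) \<and> (0, x) = comb S k \<and> (\<forall>s\<in>S. k s \<noteq> 0 \<longrightarrow> fst s = 0)"
    if x: "x \<in> E" "0 \<le> x" for x
  proof -
    have "(0, x) \<in> T" by (rule CT) (rule Cone_gens(1)[OF x])
    then obtain S k where S: "finite S" "S \<subseteq> D" "\<forall>s. 0 \<le> k s" "(0, x) = comb S k" by (auto simp: T_def)
    have "fst s $ j = 0" if s: "s \<in> S" "k s \<noteq> 0" for s j
    proof -
      have "(\<Sum>s\<in>S. k s * fst s $ j) = 0" using S(4) by (auto simp: comb_def vec_eq_iff)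
      moreover have "0 \<le> k s * fst s $ j" if "s \<in> S" for s
        using that S(2,3) DC by (cases s) (force simp: SG_nonneg)
      ultimately have "k s * fst s $ j = 0" using S(1) s(1) by (simp add: sum_nonneg_eq_0_iff)
      then show ?thesis using s(2) by simp
    qed
    then have "\<forall>s\<in>S. k s \<noteq> 0 \<longrightarrow> fst s = 0" by (auto simp: vec_eq_iff)
    with S show ?thesis by blast
  qed
  \<comment> \<open>Otherwise \<open>(0, a) + (0, b - a) - (0, b) = 0\<close>, with coefficient at least \<open>1\<close> at \<open>(0, a)\<close>.\<close>
  have uniq: "\<not> a < b" if ab: "(0, a) \<in> D" "(0, b) \<in> D" for a b
  proof
    assume "a < b"
    have "a \<in> E" "b \<in> E" using ab DC by (auto simp: SG_nonneg subset_iff)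
    then have "b - a \<in> E" "0 \<le> b - a" using \<open>a < b\<close> E_diff by auto
    then obtain S k where S: "finite S" "S \<subseteq> D" "\<forall>s. 0 \<le> k s" "(0, b - a) = comb S k" using expand by metis
    let ?S = "S \<union> {(0, a), (0, b)}"
    let ?k1 = "\<lambda>s. if s \<in> S then k s else 0" and ?k2 = "\<lambda>s. if s \<in> {(0, a), (0, b)} then (if s = (0, a) then 1 else - 1) else (0::int)"
    have "comb S k = comb ?S ?k1" by (rule mono) (use S in auto)
    moreover have "comb {(0, a), (0, b)} (\<lambda>s. if s = (0, a) then 1 else - 1) = comb ?S ?k2"
      by (rule mono) (use S in auto)
    moreover have "comb {(0, a), (0, b)} (\<lambda>s. if s = (0, a) then 1 else - 1) = (0, a - b)"
      using \<open>a < b\<close> by (simp add: comb_def vec_eq_iff)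
    ultimately have "comb ?S (\<lambda>s. ?k1 s + ?k2 s) = (0, b - a) \<otimes>\<^bsub>SG\<^esub> (0, a - b)"
      using add[of ?S ?k1 ?k2] S(4) by simp
    also have "\<dots> = (0, 0)" by (simp add: SG_simps)
    finally have all: "\<forall>s\<in>?S. ?k1 s + ?k2 s = 0" using S(1,2) ab by (intro ind) auto
    have "?k1 (0, a) + 1 = 0"
      using bspec[OF all, of "(0, a)"] by (cases "(0, a) \<in> S") simp_all
    moreover have "0 \<le> ?k1 (0, a)" using S(3) by simp
    ultimately show False by linarith
  qed
  have "\<exists>a. (0, a) \<in> D"
  proof (rule ccontr)
    assume no: "\<nexists>a. (0, a) \<in> D"
    obtain S k where S: "finite S" "S \<subseteq> D" "(0, e0) = comb S k" "\<forall>s\<in>S. k s \<noteq> 0 \<longrightarrow> fst s = 0"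
      using expand[OF e0(1)] e0(2) by (meson less_imp_le)
    have "k s = 0" if "s \<in> S" for s using S(2,4) that no by (cases s) force
    then have "comb S k = (0, 0)" by (simp add: comb_def vec_eq_iff)
    with S(3) e0(2) show False by simp
  qed
  then obtain a where a: "(0, a) \<in> D" by blast
  have only: "s = (0, a)" if "s \<in> D" "fst s = 0" for s
    using uniq[OF a, of "snd s"] uniq[OF _ a, of "snd s"] that by (cases s) force
  have mult: "\<exists>m. x = a * of_int m" if x: "x \<in> E" "0 \<le> x" for x
  proof -
    obtain S k where S: "finite S" "S \<subseteq> D" "(0, x) = comb S k" "\<forall>s\<in>S. k s \<noteq> 0 \<longrightarrow> fst s = 0"
      using expand[OF x] by metis
    have "x = (\<Sum>s\<in>S. of_int (k s) * snd s)" using S(3) by (simp add: comb_def)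
    also have "\<dots> = (\<Sum>s\<in>S. a * of_int (k s))"
    proof (rule sum.cong[OF refl])
      fix s assume s: "s \<in> S"
      show "of_int (k s) * snd s = a * of_int (k s)"
      proof (cases "k s = 0")
        case False
        then have "s = (0, a)" using s S(2,4) only by blast
        then show ?thesis by simp
      qed simp
    qed
    also have "\<dots> = a * of_int (\<Sum>s\<in>S. k s)" by (simp add: sum_distrib_left)
    finally show ?thesis by blast
  qed
  have aE: "a \<in> E" "0 \<le> a" using a DC by (auto simp: SG_nonneg)
  moreover have "a \<noteq> 0" using mult[OF e0(1)] e0(2) by auto
  ultimately show cyclic using mult by (intro cyclicI) auto
qed

end

theorem theorem4p25:
  fixes \<zeta> :: "real^'k" and c :: "'f::field^'k" and E :: "real set"
  assumes zeta_pos: "\<And>j. 0 < \<zeta>$j"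
    and E_subgroup: "0 \<in> E" "\<And>d e. d \<in> E \<Longrightarrow> e \<in> E \<Longrightarrow> d + e \<in> E" "\<And>e. e \<in> E \<Longrightarrow> - e \<in> E"
    and E_nontrivial: "E \<noteq> {0}"
    and zeta_E: "\<And>j e. e \<in> E \<Longrightarrow> \<zeta>$j * e \<in> E" "\<And>j e. e \<in> E \<Longrightarrow> inverse (\<zeta>$j) * e \<in> E"
  shows "strict_RTA (A_alg \<zeta> E c) (A_H0 \<zeta> E) (A_emb \<zeta> E c) (A_Bminus \<zeta> E c) (A_Bplus \<zeta> E c)
           (A_Q \<zeta> E) A_inv \<and>
         (RTA_based (A_H0 \<zeta> E :: ('f, ('f, 'k) H0_fun) module) (A_Q \<zeta> E) \<longleftrightarrow>
           RTA_discretely_graded (A_H0 \<zeta> E :: ('f, ('f, 'k) H0_fun) module) (A_Q \<zeta> E)) \<and>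
         (RTA_discretely_graded (A_H0 \<zeta> E :: ('f, ('f, 'k) H0_fun) module) (A_Q \<zeta> E) \<longleftrightarrow>
           (\<exists>\<eta>. \<eta> \<noteq> 0 \<and> E = {\<eta> * of_int m | m. True}) \<and> (\<forall>j. \<zeta>$j = 1))"
proof -
  interpret zeta_alg_nontrivial \<zeta> E c
    by unfold_locales (fact assms)+
  show ?thesis
    using strict based_cyclic cyclic_based discrete_cyclic cyclic_discrete
    unfolding cyclic_def by blast
qed

end
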